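(* Let $(X,\mathcal{B},\mu,T)$ be an invertible probability measure preserving system on a standard probability space, let $\mu=\int_{\bar X}\mu_{\bar x}\,d\bar\mu(\bar x)$ be its ergodic decomposition, let $T_{\bar x}$ denote the ergodic component (the ergodic system given by $T$ with the invariant measure $\mu_{\bar x}$) corresponding to $\bar x\in\bar X$, and let $$D=\{(\bar x_1,\bar x_2)\in\bar X\times\bar X:\ T_{\bar x_1}\perp T_{\bar x_2}\}.$$ (1) If $T$ is disjoint from every ergodic $S\in\mathrm{MPT}$, then $(\bar\mu\times\bar\mu)(D)=1$. (2) Conversely, if the ergodic decomposition measure $\bar\mu$ has no atoms and $(\bar\mu\times\bar\mu)(D)=1$, then $(X,\mathcal{B},\mu,T)$ is disjoint from every ergodic probability measure preserving system $(Y,\mathcal{C},\eta,S)$ on a standard probability space.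
   Context: $\mathrm{MPT}$ is the group of invertible measure preserving transformations of $[0,1]$ with Lebesgue measure (modulo null sets). A joining of two systems $(X,\mathcal B,\mu,T)$ and $(Y,\mathcal C,\eta,S)$ is a $T\times S$-invariant probability measure on $X\times Y$ whose marginals are $\mu$ and $\eta$. The systems are disjoint, written $T\perp S$, if the product measure $\mu\times\eta$ is their only joining. The ergodic decomposition of $\mu$ is $\mu=\int_{\bar X}\mu_{\bar x}\,d\bar\mu(\bar x)$, where $(\bar X,\bar\mu)$ is the standard probability space of ergodic components (the factor corresponding to the $\sigma$-algebra of $T$-invariant sets) and the $\mu_{\bar x}$ are $T$-invariant, ergodic, and carried by disjoint invariant sets for distinct $\bar x$. *)

theory Defs
  imports "HOL-Probability.Probability"
begin

text \<open>A standard probability space is a probability measure on the Borel \<open>\<sigma>\<close>-algebra of some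
  Polish topology on the underlying set. The \<open>\<sigma>\<close>-algebras are not completed, and transformations
  and factor maps are pointwise defined Borel maps.\<close>

definition Polish_topology :: "'a topology \<Rightarrow> bool" where
  "Polish_topology X \<longleftrightarrow> completely_metrizable_space X \<and> separable_space X"

definition standard_prob_space :: "'a measure \<Rightarrow> bool" where
  "standard_prob_space M \<longleftrightarrow>
     prob_space M \<and>
     (\<exists>X. Polish_topology X \<and> topspace X = space M \<and>
          sets M = sigma_sets (topspace X) {U. openin X U})"

definition pmp_system :: "'a measure \<Rightarrow> ('a \<Rightarrow> 'a) \<Rightarrow> bool" where
  "pmp_system M T \<longleftrightarrow> prob_space M \<and> T \<in> measurable M M \<and> distr M M T = M"

definition invertible_pmp_system :: "'a measure \<Rightarrow> ('a \<Rightarrow> 'a) \<Rightarrow> bool" where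
  "invertible_pmp_system M T \<longleftrightarrow>
     pmp_system M T \<and>
     (\<exists>R \<in> measurable M M. \<forall>x \<in> space M. R (T x) = x \<and> T (R x) = x)"

definition invariant_set :: "'a measure \<Rightarrow> ('a \<Rightarrow> 'a) \<Rightarrow> 'a set \<Rightarrow> bool" where
  "invariant_set M T A \<longleftrightarrow> A \<in> sets M \<and> T -` A \<inter> space M = A"

definition ergodic_system :: "'a measure \<Rightarrow> ('a \<Rightarrow> 'a) \<Rightarrow> bool" where
  "ergodic_system M T \<longleftrightarrow>
     pmp_system M T \<and> (\<forall>A. invariant_set M T A \<longrightarrow> emeasure M A = 0 \<or> emeasure M A = 1)"

definition joinings ::
  "'a measure \<Rightarrow> ('a \<Rightarrow> 'a) \<Rightarrow> 'b measure \<Rightarrow> ('b \<Rightarrow> 'b) \<Rightarrow> ('a \<times> 'b) measure set" where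
  "joinings M T N S =
     {L. sets L = sets (M \<Otimes>\<^sub>M N) \<and> prob_space L \<and>
         distr L L (map_prod T S) = L \<and>
         distr L M fst = M \<and> distr L N snd = N}"

definition disjoint_systems ::
  "'a measure \<Rightarrow> ('a \<Rightarrow> 'a) \<Rightarrow> 'b measure \<Rightarrow> ('b \<Rightarrow> 'b) \<Rightarrow> bool" where
  "disjoint_systems M T N S \<longleftrightarrow> joinings M T N S = {M \<Otimes>\<^sub>M N}"

definition unit_interval_measure :: "real measure" where
  "unit_interval_measure = restrict_space lborel {0..1}"

text \<open>The following is the set of all Borel representatives of elements of the group MPT. Every
  transformation of the unit interval that is invertible and measure preserving modulo null sets
  agrees almost everywhere with a pointwise invertible Borel one, and ergodicity and disjointness
  do not depend on the representative.\<close>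

definition MPT :: "(real \<Rightarrow> real) set" where
  "MPT = {S. invertible_pmp_system unit_interval_measure S}"

text \<open>\<open>\<pi>\<close> is the factor map onto the space \<open>Mbar\<close> of ergodic components, \<open>\<mu> xbar\<close> the component
  over \<open>xbar\<close>. The components are carried by the fibres of \<open>\<pi>\<close>, which are disjoint invariant sets.
  Preimages under \<open>\<pi>\<close> are invariant because \<open>\<pi> (T x) = \<pi> x\<close>, and the condition on invariant sets
  says that modulo null sets there are no others, so \<open>Mbar\<close> is the factor corresponding to the
  \<open>\<sigma>\<close>-algebra of invariant sets. The integral formula is \<open>Mbar \<bind> \<mu> = M\<close>.\<close>

definition ergodic_decomposition ::
  "'a measure \<Rightarrow> ('a \<Rightarrow> 'a) \<Rightarrow> 'b measure \<Rightarrow> ('a \<Rightarrow> 'b) \<Rightarrow> ('b \<Rightarrow> 'a measure) \<Rightarrow> bool" where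
  "ergodic_decomposition M T Mbar \<pi> \<mu> \<longleftrightarrow>
     standard_prob_space Mbar \<and> \<pi> \<in> measurable M Mbar \<and> distr M Mbar \<pi> = Mbar \<and>
     (\<forall>x \<in> space M. \<pi> (T x) = \<pi> x) \<and>
     (\<forall>A. invariant_set M T A \<longrightarrow>
        (\<exists>B \<in> sets Mbar. sym_diff A (\<pi> -` B \<inter> space M) \<in> null_sets M)) \<and>
     \<mu> \<in> measurable Mbar (prob_algebra M) \<and>
     (\<forall>xbar \<in> space Mbar.
        ergodic_system (\<mu> xbar) T \<and> emeasure (\<mu> xbar) (\<pi> -` {xbar} \<inter> space M) = 1) \<and>
     Mbar \<bind> \<mu> = M"

definition disjoint_pairs ::
  "('a \<Rightarrow> 'a) \<Rightarrow> 'b measure \<Rightarrow> ('b \<Rightarrow> 'a measure) \<Rightarrow> ('b \<times> 'b) set" where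
  "disjoint_pairs T Mbar \<mu> =
     {(x1, x2) \<in> space Mbar \<times> space Mbar. disjoint_systems (\<mu> x1) T (\<mu> x2) T}"

definition measure_atom :: "'a measure \<Rightarrow> 'a set \<Rightarrow> bool" where
  "measure_atom M A \<longleftrightarrow>
     A \<in> sets M \<and> emeasure M A > 0 \<and>
     (\<forall>B \<in> sets M. B \<subseteq> A \<longrightarrow> emeasure M B = 0 \<or> emeasure M (A - B) = 0)"

end

theory Submission
  imports Defs
begin

text \<open>(1) Multiply a component \<open>T\<^bsub>y\<^esub>\<close> by a Bernoulli shift: the product is ergodic and atomless, hence isomorphic
  to an element of \<open>MPT\<close>, so \<open>T\<close> is disjoint from every \<open>T\<^bsub>y\<^esub>\<close>. The pairs \<open>(x, y)\<close> that
  are not disjoint are covered by countably many measurable sets, defined through approximate joinings with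
  values in finite grids. If a section of such a set at some \<open>y\<close> had positive measure, then integrating
  the approximate joinings over \<open>x\<close> and passing to a limit would give a joining of \<open>T\<close> and \<open>T\<^bsub>y\<^esub>\<close>
  different from the product.

  (2) Given a joining of \<open>T\<close> and \<open>S\<close>, form the self-joining of \<open>T\<close> that is relatively independent over
  the natural extension of \<open>S\<close>. Invariant sets of \<open>T\<close> are independent of \<open>S\<close> because \<open>S\<close> is ergodic, so
  this self-joining projects to the product measure on pairs of ergodic components and disintegrates into
  joinings of \<open>T\<^bsub>x\<^esub>\<close> and \<open>T\<^bsub>y\<^esub>\<close> for almost all \<open>(x, y)\<close>. These are products, hence so is the
  self-joining, and the conditional expectations on \<open>S\<close> of functions on \<open>T\<close> are constant.\<close>

section \<open>Standard spaces as Borel retracts of the line\<close>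

text \<open>Joinings are rarely written down directly. In both directions they arise as families of
  numbers \<open>q A B\<close>, limits of inner products or of averaged matrices, and such limits
  keep only finite additivity in each argument. What restores \<sigma>-additivity is that the
  marginals are genuine measures on standard spaces: a bimeasure of this kind on generating algebras
  extends to a measure. Hence the countable algebras closed under preimages, and hence the coding of
  points by reals through a Borel map with a Borel left inverse. A pair belongs to the set D if no
  joining but the product exists, a condition whose Borel measurability is unclear. In (1) the
  quantifier over joinings is replaced, for each accuracy, by a quantifier over a finite grid; this
  yields Borel sets and lets approximate joinings be chosen measurably, by least index. In (2) the
  self-joining is disintegrated through densities of countably many set functions, whose identities
  hold simultaneously outside one null set. The auxiliary factor in (1) is a Bernoulli shift because
  the product of a mixing system with any ergodic system is ergodic.\<close>

definition measurable_retract :: "'a measure \<Rightarrow> 'b measure \<Rightarrow> bool" where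
  "measurable_retract M N \<longleftrightarrow>
     (\<exists>e \<in> measurable M N. \<exists>r \<in> measurable N M. \<forall>x \<in> space M. r (e x) = x)"

lemma measurable_retractI:
  "e \<in> measurable M N \<Longrightarrow> r \<in> measurable N M \<Longrightarrow> (\<And>x. x \<in> space M \<Longrightarrow> r (e x) = x) \<Longrightarrow>
   measurable_retract M N"
  unfolding measurable_retract_def by blast

lemma measurable_retract_trans:
  assumes "measurable_retract M N" "measurable_retract N K"
  shows "measurable_retract M K"
proof -
  obtain e r where 1: "e \<in> measurable M N" "r \<in> measurable N M" "\<And>x. x \<in> space M \<Longrightarrow> r (e x) = x"
    using assms(1) unfolding measurable_retract_def by blast
  obtain e' r' where 2: "e' \<in> measurable N K" "r' \<in> measurable K N" "\<And>x. x \<in> space N \<Longrightarrow> r' (e' x) = x"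
    using assms(2) unfolding measurable_retract_def by blast
  show ?thesis
    by (rule measurable_retractI[of "e' \<circ> e" _ _ "r \<circ> r'"])
       (use 1 2 measurable_space[OF 1(1)] in \<open>auto intro: measurable_comp\<close>)
qed

lemma measurable_retract_PiM:
  assumes "measurable_retract M N"
  shows "measurable_retract (Pi\<^sub>M (UNIV :: 'i set) (\<lambda>_. M)) (Pi\<^sub>M (UNIV :: 'i set) (\<lambda>_. N))"
proof -
  obtain e r where [measurable]: "e \<in> measurable M N" "r \<in> measurable N M"
    and 1: "\<And>x. x \<in> space M \<Longrightarrow> r (e x) = x"
    using assms(1) unfolding measurable_retract_def by blast
  show ?thesis
  proof (rule measurable_retractI[of "\<lambda>f i. e (f i)" _ _ "\<lambda>f i. r (f i)"])
    show "(\<lambda>f i. e (f i)) \<in> Pi\<^sub>M UNIV (\<lambda>_. M) \<rightarrow>\<^sub>M Pi\<^sub>M UNIV (\<lambda>_. N)"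
      by (rule measurable_PiM_single') (auto simp: space_PiM PiE_UNIV_domain intro!: measurable_space[of e M N] measurable_space[of r N M])
    show "(\<lambda>f i. r (f i)) \<in> Pi\<^sub>M UNIV (\<lambda>_. N) \<rightarrow>\<^sub>M Pi\<^sub>M UNIV (\<lambda>_. M)"
      by (rule measurable_PiM_single') (auto simp: space_PiM PiE_UNIV_domain intro!: measurable_space[of e M N] measurable_space[of r N M])
  qed (auto simp: 1 space_PiM PiE_UNIV_domain Pi_iff)
qed

abbreviation cantor_space :: "(nat \<Rightarrow> bool) measure" where
  "cantor_space \<equiv> Pi\<^sub>M UNIV (\<lambda>_. count_space UNIV)"

text \<open>A real is the infimum of the rationals above it. The infimum is taken in the extended
  reals, so that decoding is total and measurable also on sequences that code no real.\<close>

lemma measurable_retract_real_cantor: "measurable_retract (borel :: real measure) cantor_space"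
proof (rule measurable_retractI)
  let ?q = "\<lambda>n. real_of_rat (from_nat n)"
  let ?r = "\<lambda>b. real_of_ereal (INF n. if b n then ereal (?q n) else \<infinity>)"
  show "(\<lambda>x n. x < ?q n) \<in> borel \<rightarrow>\<^sub>M cantor_space"
    by (rule measurable_PiM_single') (auto simp: space_PiM)
  show "?r \<in> cantor_space \<rightarrow>\<^sub>M borel"
    by measurable
  show "?r (\<lambda>n. x < ?q n) = x" for x :: real
  proof -
    have "(INF n. if x < ?q n then ereal (?q n) else \<infinity>) = ereal x"
    proof (rule antisym)
      show "ereal x \<le> (INF n. if x < ?q n then ereal (?q n) else \<infinity>)"
        by (rule INF_greatest) auto
      show "(INF n. if x < ?q n then ereal (?q n) else \<infinity>) \<le> ereal x"
      proof (rule dense_ge)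
        fix z assume "ereal x < z"
        then obtain r where r: "ereal x < ereal r" "ereal r < z"
          using ereal_dense2 by blast
        then obtain q where q: "x < of_rat q" "of_rat q < r"
          using of_rat_dense by auto
        have "(INF n. if x < ?q n then ereal (?q n) else \<infinity>) \<le> (if x < ?q (to_nat q) then ereal (?q (to_nat q)) else \<infinity>)"
          by (rule INF_lower) auto
        also have "\<dots> \<le> z" using q r by (auto simp: less_imp_le) (metis ereal_less_le less_ereal.simps(1) less_imp_le order.trans)
        finally show "(INF n. if x < ?q n then ereal (?q n) else \<infinity>) \<le> z" .
      qed
    qed
    then show ?thesis by simp
  qed
qed

lemma measurable_retract_bool_reindex:
  fixes g :: "'i \<Rightarrow> 'j"
  assumes "\<And>i. h (g i) = i"
  shows "measurable_retract (Pi\<^sub>M UNIV (\<lambda>_::'i. count_space UNIV) :: ('i \<Rightarrow> bool) measure)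
     (Pi\<^sub>M UNIV (\<lambda>_::'j. count_space UNIV) :: ('j \<Rightarrow> bool) measure)"
proof (rule measurable_retractI[of "\<lambda>(f :: _ \<Rightarrow> bool) j. f (h j)" _ _ "\<lambda>(f :: _ \<Rightarrow> bool) i. f (g i)"])
qed (auto simp: assms space_PiM intro!: measurable_PiM_single' measurable_component_singleton)

lemma measurable_retract_sequences_cantor:
  assumes "measurable_retract M cantor_space"
  shows "measurable_retract (Pi\<^sub>M (UNIV :: nat set) (\<lambda>_. M)) cantor_space"
proof (rule measurable_retract_trans[OF measurable_retract_PiM[OF assms]])
  show "measurable_retract (Pi\<^sub>M (UNIV :: nat set) (\<lambda>_. cantor_space)) cantor_space"
  proof (rule measurable_retractI[of "\<lambda>f n. case prod_decode n of (i, j) \<Rightarrow> f i j" _ _ "\<lambda>b i j. b (prod_encode (i, j))"])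
    show "(\<lambda>f n. case prod_decode n of (i, j) \<Rightarrow> f i j) \<in> Pi\<^sub>M UNIV (\<lambda>_. cantor_space) \<rightarrow>\<^sub>M cantor_space"
    proof (rule measurable_PiM_single')
      fix n :: nat
      obtain i j where "prod_decode n = (i, j)" by force
      then show "(\<lambda>f. case prod_decode n of (i, j) \<Rightarrow> f i j) \<in> (Pi\<^sub>M UNIV (\<lambda>_. cantor_space)) \<rightarrow>\<^sub>M count_space UNIV"
        using measurable_compose[OF measurable_component_singleton[of i UNIV "\<lambda>_. cantor_space"]
            measurable_component_singleton[of j UNIV "\<lambda>_. count_space UNIV"]] by simp
    qed (auto simp: space_PiM)
    show "(\<lambda>b i j. b (prod_encode (i, j))) \<in> cantor_space \<rightarrow>\<^sub>M Pi\<^sub>M UNIV (\<lambda>_. cantor_space)"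
      by (intro measurable_PiM_single') (auto simp: space_PiM PiE_UNIV_domain)
  qed auto
qed

text \<open>A 0-1-sequence is encoded by its expansion in base 3; the digits are read off with
  the shift map of the middle-third Cantor set, moved so that the digits are 0 and 1.\<close>

lemma measurable_retract_cantor_real:
  obtains e r where "e \<in> borel_measurable cantor_space" "r \<in> measurable (borel :: real measure) cantor_space"
    "\<And>b. r (e b) = b" "\<And>b. e b \<in> {0..1}"
proof
  define e :: "(nat \<Rightarrow> bool) \<Rightarrow> real" where "e b = (\<Sum>n. of_bool (b n) * (1/3) ^ Suc n)" for b
  define f :: "real \<Rightarrow> real" where "f t = (if t \<ge> 1/3 then 3 * t - 1 else 3 * t)" for t
  define r :: "real \<Rightarrow> nat \<Rightarrow> bool" where "r t n = ((f ^^ n) t \<ge> 1/3)" for t n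
  have s0: "summable (\<lambda>n. (1/3 :: real) ^ Suc n)"
    by (simp add: summable_geometric)
  have s: "summable (\<lambda>n. of_bool (b n) * (1/3 :: real) ^ Suc n)" for b
    by (rule summable_comparison_test'[OF s0, of 0]) (auto simp: of_bool_def)
  have e0: "0 \<le> e b" for b unfolding e_def by (rule suminf_nonneg[OF s]) auto
  have "(\<Sum>n. (1/3 :: real) ^ Suc n) = 1/2"
    using suminf_geometric[of "1/3::real"] suminf_divide[of "\<lambda>n. (1/3::real) ^ n" 3] by (simp add: summable_geometric)
  then have e1: "e b \<le> 1/2" for b
    unfolding e_def using suminf_le[OF _ s s0, of b] by (force simp: of_bool_def)
  have rec: "e b = (of_bool (b 0) + e (\<lambda>n. b (Suc n))) / 3" for b
  proof -
    have "e b = of_bool (b 0) / 3 + (\<Sum>n. of_bool (b (Suc n)) * (1/3) ^ Suc (Suc n))"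
      unfolding e_def using suminf_split_head[OF s[of b]] by simp
    also have "(\<Sum>n. of_bool (b (Suc n)) * (1/3::real) ^ Suc (Suc n)) = (1/3) * e (\<lambda>n. b (Suc n))"
      unfolding e_def by (subst suminf_mult[OF s, symmetric]) (simp add: algebra_simps)
    finally show ?thesis by simp
  qed
  \<comment> \<open>All codes lie in \<open>[0, 1/2]\<close>, so a code with first digit 0 is at
    most 1/6 and the threshold 1/3 reads off the first digit. In base 2 the two ranges would
    touch.\<close>
  have hd: "e b \<ge> 1/3 \<longleftrightarrow> b 0" for b
    using rec[of b] e0[of "\<lambda>n. b (Suc n)"] e1[of "\<lambda>n. b (Suc n)"] by auto
  have fe: "f (e b) = e (\<lambda>n. b (Suc n))" for b
    unfolding f_def using hd[of b] rec[of b] by auto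
  have it: "(f ^^ n) (e b) = e (\<lambda>k. b (k + n))" for n b
    by (induction n) (auto simp: fe)
  show "e \<in> borel_measurable cantor_space"
    unfolding e_def by measurable
  have [measurable]: "f \<in> borel_measurable borel"
    unfolding f_def by measurable
  have [measurable]: "(f ^^ n) \<in> borel_measurable borel" for n
    by (induction n) auto
  show "r \<in> measurable borel cantor_space"
  proof (rule measurable_PiM_single')
    show "(\<lambda>t. r t n) \<in> borel \<rightarrow>\<^sub>M count_space UNIV" for n
      unfolding r_def by measurable
  qed (auto simp: space_PiM)
  show "r (e b) = b" for b
    by (rule ext) (use hd[of "\<lambda>k. b (k + n)" for n] in \<open>simp add: r_def it\<close>)
  show "e b \<in> {0..1}" for b
    using e0[of b] e1[of b] by simp
qed

lemma measurable_retract_unit_interval: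
  assumes "measurable_retract M cantor_space"
  obtains e r where "e \<in> borel_measurable M" "r \<in> measurable (borel :: real measure) M"
    "\<And>x. x \<in> space M \<Longrightarrow> r (e x) = x" "\<And>x. e x \<in> {0..1}"
proof -
  obtain e r where 1: "e \<in> measurable M cantor_space" "r \<in> measurable cantor_space M" "\<And>x. x \<in> space M \<Longrightarrow> r (e x) = x"
    using assms(1) unfolding measurable_retract_def by blast
  obtain e' r' where 2: "e' \<in> borel_measurable cantor_space" "r' \<in> measurable (borel :: real measure) cantor_space"
    "\<And>b. r' (e' b) = b" "\<And>b. e' b \<in> {0..1}"
    using measurable_retract_cantor_real by blast
  show ?thesis
    by (rule that[of "e' \<circ> e" "r \<circ> r'"])
       (use 1 2 in \<open>auto intro: measurable_comp\<close>)
qed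

lemma measurable_retract_pair:
  assumes "measurable_retract M cantor_space" "measurable_retract N cantor_space"
  shows "measurable_retract (M \<Otimes>\<^sub>M N) cantor_space"
proof -
  obtain e r where 1[measurable]: "e \<in> measurable M cantor_space" "r \<in> measurable cantor_space M" "\<And>x. x \<in> space M \<Longrightarrow> r (e x) = x"
    using assms(1) unfolding measurable_retract_def by blast
  obtain e' r' where 2[measurable]: "e' \<in> measurable N cantor_space" "r' \<in> measurable cantor_space N" "\<And>x. x \<in> space N \<Longrightarrow> r' (e' x) = x"
    using assms(2) unfolding measurable_retract_def by blast
  have "measurable_retract (M \<Otimes>\<^sub>M N) (Pi\<^sub>M (UNIV :: nat set) (\<lambda>_. cantor_space))"
  proof (rule measurable_retractI[of "\<lambda>(x, y) (n :: nat). if n = 0 then e x else e' y" _ _ "\<lambda>f. (r (f 0), r' (f 1))"])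
    show "(\<lambda>(x, y) (n :: nat). if n = 0 then e x else e' y) \<in> M \<Otimes>\<^sub>M N \<rightarrow>\<^sub>M Pi\<^sub>M UNIV (\<lambda>_. cantor_space)"
    proof (rule measurable_PiM_single')
      fix n :: nat
      show "(\<lambda>z. (case z of (x, y) \<Rightarrow> \<lambda>n :: nat. if n = 0 then e x else e' y) n) \<in> M \<Otimes>\<^sub>M N \<rightarrow>\<^sub>M cantor_space"
        by (cases "n = 0") (auto simp: split_beta')
    qed (auto simp: space_PiM PiE_UNIV_domain)
    show "(\<lambda>f. (r (f 0), r' (f 1))) \<in> Pi\<^sub>M UNIV (\<lambda>_. cantor_space) \<rightarrow>\<^sub>M M \<Otimes>\<^sub>M N"
      by measurable
  qed (auto simp: 1 2 space_pair_measure)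
  then show ?thesis
    by (rule measurable_retract_trans)
       (rule measurable_retract_sequences_cantor, rule measurable_retractI[of id _ _ id], auto)
qed

text \<open>A point is coded by its distances to a dense sequence \<open>s\<close>. Decoding picks,
  at each precision \<open>(1/2) ^ j\<close>, the first member of \<open>s\<close> that the code
  claims to be that close, and takes the limit of these members, which exists by
  completeness.\<close>

lemma standard_prob_space_retract:
  assumes "standard_prob_space M"
  shows "measurable_retract M cantor_space"
proof -
  interpret prob_space M using assms unfolding standard_prob_space_def by simp
  obtain X where X: "completely_metrizable_space X" "separable_space X" "topspace X = space M"
    "sets M = sigma_sets (topspace X) {U. openin X U}"
    using assms unfolding standard_prob_space_def Polish_topology_def by blast
  obtain E d where Ed: "Metric_space E d" "Metric_space.mcomplete E d" "X = Metric_space.mtopology E d"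
    using X(1) unfolding completely_metrizable_space_def by blast
  interpret Metric_space E d by fact
  have E: "E = space M" using X(3) Ed(3) by simp
  obtain D where D: "countable D" "D \<subseteq> E" "mtopology closure_of D = E"
    using X(2) Ed(3) unfolding separable_space_def by auto
  have dense: "\<exists>y\<in>D. d x y < \<epsilon>" if "x \<in> E" "\<epsilon> > 0" for x \<epsilon>
    using that D(3) unfolding metric_closure_of by (auto simp: in_mball)
  obtain x0 where x0: "x0 \<in> E" using not_empty E by blast
  have "D \<noteq> {}" using dense[OF x0, of 1] by auto
  define s where "s = from_nat_into D"
  have s: "s n \<in> E" for n
    using from_nat_into[OF \<open>D \<noteq> {}\<close>] D(2) unfolding s_def by blast
  have dense: "\<exists>n. d x (s n) < \<epsilon>" if "x \<in> E" "\<epsilon> > 0" for x \<epsilon>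
    using dense[OF that] from_nat_into_surj[OF D(1)] unfolding s_def by metis
  have open_sets: "U \<in> sets M" if "openin mtopology U" for U
    using that X(4) Ed(3) by auto
  have ball: "mball y \<epsilon> \<in> sets M" for y \<epsilon>
    by (rule open_sets) simp
  have dist_meas: "(\<lambda>x. d x y) \<in> borel_measurable M" if "y \<in> E" for y
  proof (subst borel_measurable_iff_less, rule allI)
    fix a
    have "{w \<in> space M. d w y < a} = mball y a"
      using that unfolding E[symmetric] by (auto simp: in_mball commute)
    then show "{w \<in> space M. d w y < a} \<in> sets M" using ball by simp
  qed
  define e where "e x n = d x (s n)" for x n
  define k where "k a j = (LEAST n. a n < (1/2) ^ j)" for a :: "nat \<Rightarrow> real" and j :: nat
  \<comment> \<open>For a true code these bounds are the triangle inequality through the coded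
    point. Imposed on an arbitrary real sequence they are countably many measurable conditions that
    force the Cauchy property; where they fail, \<open>r\<close> takes the default value
    \<open>x0\<close>.\<close>
  define good where "good a \<longleftrightarrow> (\<forall>i j. d (s (k a i)) (s (k a j)) \<le> (1/2) ^ i + (1/2) ^ j)" for a
  define r where "r a = (if good a then (SOME x. limitin mtopology (\<lambda>j. s (k a j)) x sequentially) else x0)" for a
  have lim: "limitin mtopology (\<lambda>j. s (k a j)) (r a) sequentially" if "good a" for a
  proof -
    have "MCauchy (\<lambda>j. s (k a j))"
      unfolding MCauchy_def
    proof safe
      fix \<epsilon> :: real assume "\<epsilon> > 0"
      then obtain n where n: "(1/2) ^ n < \<epsilon> / 2"
        using real_arch_pow_inv[of "\<epsilon>/2" "1/2"] by auto
      show "\<exists>N. \<forall>i j. N \<le> i \<longrightarrow> N \<le> j \<longrightarrow> d (s (k a i)) (s (k a j)) < \<epsilon>"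
      proof (intro exI allI impI)
        fix i j assume "n \<le> i" "n \<le> j"
        then have "(1/2 :: real) ^ i \<le> (1/2) ^ n" "(1/2 :: real) ^ j \<le> (1/2) ^ n"
          by (simp_all add: power_decreasing)
        moreover have "d (s (k a i)) (s (k a j)) \<le> (1/2) ^ i + (1/2) ^ j"
          using that unfolding good_def by blast
        ultimately show "d (s (k a i)) (s (k a j)) < \<epsilon>" using n by linarith
      qed
    qed (use s in auto)
    then have ex: "\<exists>x. limitin mtopology (\<lambda>j. s (k a j)) x sequentially"
      using Ed(2) unfolding mcomplete_def by blast
    from someI_ex[OF ex] show ?thesis unfolding r_def using that by simp
  qed
  have rE: "r a \<in> E" for a
    using lim[of a] x0 limitin_mspace by (cases "good a") (auto simp: r_def)
  have re: "r (e x) = x" if "x \<in> E" for x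
  proof -
    have k: "d x (s (k (e x) j)) < (1/2) ^ j" for j
      using LeastI_ex[OF dense[OF that, of "(1/2)^j"]] unfolding k_def e_def by simp
    have "d (s (k (e x) i)) (s (k (e x) j)) \<le> (1/2) ^ i + (1/2) ^ j" for i j
      using triangle[of "s (k (e x) i)" x "s (k (e x) j)"] s that k[of i] k[of j] commute[of x]
      by (simp add: less_eq_real_def) linarith
    then have good: "good (e x)" unfolding good_def by blast
    have "limitin mtopology (\<lambda>j. s (k (e x) j)) x sequentially"
      unfolding limitin_metric_dist_null
    proof (intro conjI)
      show "(\<lambda>j. d (s (k (e x) j)) x) \<longlonglongrightarrow> 0"
      proof (rule tendsto_sandwich[OF _ _ tendsto_const LIMSEQ_power_zero[of "1/2::real"]])
        show "\<forall>\<^sub>F j in sequentially. d (s (k (e x) j)) x \<le> (1/2) ^ j"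
          using k commute by (simp add: less_imp_le)
      qed auto
    qed (use that s in auto)
    then show ?thesis
      using lim[OF good] limitin_metric_unique trivial_limit_sequentially by blast
  qed
  let ?P = "Pi\<^sub>M (UNIV :: nat set) (\<lambda>_. borel :: real measure)"
  have k_meas[measurable]: "(\<lambda>a. k a j) \<in> ?P \<rightarrow>\<^sub>M count_space UNIV" for j
    unfolding k_def by measurable
  have good_meas[measurable]: "Measurable.pred ?P good"
  proof -
    have "Measurable.pred ?P (\<lambda>a. d (s (k a i)) (s (k a j)) \<le> (1/2) ^ i + (1/2) ^ j)" for i j
      using measurable_compose[OF measurable_Pair[OF k_meas[of i] k_meas[of j]], of "\<lambda>(m, n). d (s m) (s n) \<le> (1/2) ^ i + (1/2) ^ j" "count_space UNIV"]
      by (simp add: pair_measure_countable)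
    then show ?thesis unfolding good_def[abs_def] by measurable
  qed
  \<comment> \<open>On good sequences the distance to \<open>s n\<close> is the limit of
    \<open>d (s (k a j)) (s n)\<close>, which depends on \<open>a\<close> only through a measurable
    index in the naturals.\<close>
  have rd: "(\<lambda>a. d (r a) (s n)) \<in> borel_measurable ?P" for n
  proof -
    have "(\<lambda>a. if good a then d (s (k a j)) (s n) else d x0 (s n)) \<in> borel_measurable ?P" for j
      by (rule measurable_If) (use good_meas in \<open>auto intro: measurable_compose[OF k_meas]\<close>)
    moreover have "(\<lambda>j. if good a then d (s (k a j)) (s n) else d x0 (s n)) \<longlonglongrightarrow> d (r a) (s n)" for a
    proof (cases "good a")
      case True
      have 1: "(\<lambda>j. d (s (k a j)) (r a)) \<longlonglongrightarrow> 0"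
        using lim[OF True] unfolding limitin_metric_dist_null by blast
      have "(\<lambda>j. d (s (k a j)) (s n) - d (r a) (s n)) \<longlonglongrightarrow> 0"
      proof (rule tendsto_rabs_zero_cancel, rule tendsto_sandwich[OF _ _ tendsto_const 1])
        show "\<forall>\<^sub>F j in sequentially. \<bar>d (s (k a j)) (s n) - d (r a) (s n)\<bar> \<le> d (s (k a j)) (r a)"
          using triangle[of "s (k a j)" "r a" "s n" for j] triangle[of "r a" "s (k a j)" "s n" for j] s rE
            commute[of "r a"]
          by (auto simp: abs_le_iff intro!: eventuallyI) (smt (verit))+
      qed auto
      then show ?thesis using True LIM_zero_cancel by force
    qed (simp add: r_def)
    ultimately show ?thesis by (rule borel_measurable_LIMSEQ_real[rotated])
  qed
  have r_meas: "r \<in> ?P \<rightarrow>\<^sub>M M"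
  proof (rule measurable_sigma_sets[of M "topspace X" "{U. openin X U}"])
    fix U assume "U \<in> {U. openin X U}"
    then have U: "openin mtopology U" using Ed(3) by simp
    \<comment> \<open>Separability writes an open set as a countable union of balls centred in
      \<open>s\<close>; the preimages of these balls are controlled by \<open>rd\<close>.\<close>
    have eq: "U = (\<Union>n. \<Union>m \<in> {m :: nat. mball (s n) (1 / Suc m) \<subseteq> U}. mball (s n) (1 / Suc m))"
    proof safe
      fix x assume x: "x \<in> U"
      then have xE: "x \<in> E" using openin_subset[OF U] by auto
      obtain \<rho> where \<rho>: "\<rho> > 0" "mball x \<rho> \<subseteq> U" using U x unfolding openin_mtopology by blast
      obtain m :: nat where m: "1 / Suc m < \<rho> / 2" using nat_approx_posE[of "\<rho>/2"] \<rho> by auto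
      obtain n where n: "d x (s n) < 1 / Suc m" using dense[OF xE, of "1 / Suc m"] by auto
      have "mball (s n) (1 / Suc m) \<subseteq> mball x \<rho>"
      proof
        fix y assume "y \<in> mball (s n) (1 / Suc m)"
        then have y: "y \<in> E" "d (s n) y < 1 / Suc m" by (auto simp: in_mball)
        then show "y \<in> mball x \<rho>"
          using triangle[OF xE s[of n] y(1)] n m xE by (simp add: in_mball)
      qed
      then have "mball (s n) (1 / Suc m) \<subseteq> U" using \<rho> by blast
      moreover have "x \<in> mball (s n) (1 / Suc m)" using n xE s commute by (simp add: in_mball)
      ultimately show "x \<in> (\<Union>n. \<Union>m \<in> {m :: nat. mball (s n) (1 / Suc m) \<subseteq> U}. mball (s n) (1 / Suc m))" by blast
    qed blast
    have "r -` mball (s n) \<epsilon> \<inter> space ?P \<in> sets ?P" for n \<epsilon>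
    proof -
      have "r -` mball (s n) \<epsilon> \<inter> space ?P = {a \<in> space ?P. d (r a) (s n) < \<epsilon>}"
        using rE s commute by (auto simp: in_mball)
      also have "\<dots> \<in> sets ?P"
        using rd[of n] by measurable
      finally show ?thesis .
    qed
    then have *: "(\<Union>n. \<Union>m \<in> {m :: nat. mball (s n) (1 / Suc m) \<subseteq> U}. r -` mball (s n) (1 / Suc m) \<inter> space ?P) \<in> sets ?P"
      by (intro sets.countable_UN'' countableI_type) auto
    have "r -` U \<inter> space ?P = (\<Union>n. \<Union>m \<in> {m :: nat. mball (s n) (1 / Suc m) \<subseteq> U}. r -` mball (s n) (1 / Suc m) \<inter> space ?P)"
      by (subst eq) blast
    then show "r -` U \<inter> space ?P \<in> sets ?P" using * by simp
  qed (use X openin_subset[of X] rE E in \<open>auto simp: subset_eq\<close>)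
  have e_meas: "e \<in> M \<rightarrow>\<^sub>M ?P"
    unfolding e_def[abs_def] by (rule measurable_PiM_single') (auto simp: space_PiM dist_meas s)
  have "measurable_retract M ?P"
    by (rule measurable_retractI[OF e_meas r_meas]) (simp add: re E)
  then show ?thesis
    by (rule measurable_retract_trans) (rule measurable_retract_sequences_cantor[OF measurable_retract_real_cantor])
qed

section \<open>Dominated measures and invariant measures of ergodic systems\<close>

text \<open>Domination implies absolute continuity and bounds the density by 1 almost everywhere.
  Truncation gives a version with values in \<open>[0, 1]\<close> at every point, so that
  integrability and sign conditions are immediate later on.\<close>

lemma dominated_density:
  assumes "finite_measure M" "sets m = sets M"
    and le: "\<And>A. A \<in> sets M \<Longrightarrow> emeasure m A \<le> emeasure M A"
  obtains d :: "'a \<Rightarrow> real" where "d \<in> borel_measurable M" "\<And>x. 0 \<le> d x" "\<And>x. d x \<le> 1"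
    "\<And>A. A \<in> sets M \<Longrightarrow> emeasure m A = (\<integral>\<^sup>+x. ennreal (d x) * indicator A x \<partial>M)"
    "\<And>A. A \<in> sets M \<Longrightarrow> measure m A = (\<integral>x. indicator A x * d x \<partial>M)"
proof -
  interpret finite_measure M by fact
  have "absolutely_continuous M m"
    unfolding absolutely_continuous_def using le assms(2) by (auto simp: null_sets_def) (metis le_zero_eq)
  from Radon_Nikodym[OF this assms(2)] obtain f where
    f[measurable]: "f \<in> borel_measurable M" and fm: "density M f = m" by blast
  have em: "emeasure m A = (\<integral>\<^sup>+x. f x * indicator A x \<partial>M)" if "A \<in> sets M" for A
    using that by (simp add: fm[symmetric] emeasure_density)
  \<comment> \<open>Over the set where \<open>f\<close> exceeds 1, domination leaves no room for a
    positive integral of \<open>f - 1\<close>.\<close>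
  have f1: "AE x in M. f x \<le> 1"
  proof -
    define A where "A = {x \<in> space M. f x > 1}"
    have A[measurable]: "A \<in> sets M" unfolding A_def by measurable
    have "(\<integral>\<^sup>+x. (f x - 1) * indicator A x \<partial>M) + emeasure M A =
      (\<integral>\<^sup>+x. (f x - 1) * indicator A x \<partial>M) + (\<integral>\<^sup>+x. indicator A x \<partial>M)" by simp
    also have "\<dots> = (\<integral>\<^sup>+x. (f x - 1) * indicator A x + indicator A x \<partial>M)"
      by (subst nn_integral_add) auto
    also have "\<dots> = (\<integral>\<^sup>+x. f x * indicator A x \<partial>M)"
      by (rule nn_integral_cong) (auto simp: A_def indicator_def diff_add_cancel_ennreal less_imp_le)
    also have "\<dots> \<le> 0 + emeasure M A" using le[OF A] em[OF A] by simp
    finally have "(\<integral>\<^sup>+x. (f x - 1) * indicator A x \<partial>M) \<le> 0"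
      by (metis add.commute emeasure_finite ennreal_add_left_cancel_le infinity_ennreal_def)
    then have "AE x in M. (f x - 1) * indicator A x = 0"
      by (subst nn_integral_0_iff_AE[symmetric]) auto
    then show ?thesis
      using AE_space by eventually_elim (auto simp: A_def indicator_def diff_eq_0_iff_ennreal split: if_splits)
  qed
  define d where "d x = enn2real (min (f x) 1)" for x
  have d[measurable]: "d \<in> borel_measurable M" unfolding d_def by measurable
  have d0: "0 \<le> d x" for x unfolding d_def by simp
  have ed: "ennreal (d x) = min (f x) 1" for x
    unfolding d_def by (subst ennreal_enn2real) (auto simp: min_def top.not_eq_extremum intro: le_less_trans)
  have d1: "d x \<le> 1" for x
    using ed[of x] by (metis ennreal_le_1 min.cobounded2)
  have dm: "emeasure m A = (\<integral>\<^sup>+x. ennreal (d x) * indicator A x \<partial>M)" if "A \<in> sets M" for A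
    unfolding em[OF that] using f1 by (intro nn_integral_cong_AE) (auto simp: ed min_absorb1)
  have dr: "measure m A = (\<integral>x. indicator A x * d x \<partial>M)" if A[measurable]: "A \<in> sets M" for A
  proof -
    have "emeasure m A = (\<integral>\<^sup>+x. ennreal (indicator A x * d x) \<partial>M)"
      unfolding dm[OF that] by (rule nn_integral_cong) (auto simp: indicator_def)
    then show ?thesis
      unfolding measure_def by (simp add: integral_eq_nn_integral d0)
  qed
  show thesis by (rule that[OF d d0 d1 dm dr])
qed

text \<open>Domination by a measure makes a finitely additive function continuous at the empty set;
  applied to \<open>f\<close> and to \<open>M - f\<close>, the Caratheodory extension also shows that domination persists.\<close>

lemma dominated_extension:
  assumes "finite_measure M" and alg: "algebra (space M) \<A>" and gen: "sets M = sigma_sets (space M) \<A>"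
    and f0: "\<And>A. A \<in> \<A> \<Longrightarrow> 0 \<le> f A" and f1: "\<And>A. A \<in> \<A> \<Longrightarrow> f A \<le> measure M A"
    and add: "\<And>A B. A \<in> \<A> \<Longrightarrow> B \<in> \<A> \<Longrightarrow> A \<inter> B = {} \<Longrightarrow> f (A \<union> B) = f A + f B"
  obtains m where "sets m = sets M" "\<And>A. A \<in> \<A> \<Longrightarrow> emeasure m A = ennreal (f A)"
    "\<And>A. A \<in> sets M \<Longrightarrow> emeasure m A \<le> emeasure M A"
proof -
  interpret finite_measure M by fact
  interpret algebra "space M" \<A> by fact
  have sub: "A \<in> sets M" if "A \<in> \<A>" for A using that gen by auto
  have ext: "\<exists>m. sets m = sets M \<and> (\<forall>A\<in>\<A>. emeasure m A = ennreal (g A))"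
    if g0: "\<And>A. A \<in> \<A> \<Longrightarrow> 0 \<le> g A" and g1: "\<And>A. A \<in> \<A> \<Longrightarrow> g A \<le> measure M A"
    and add: "\<And>A B. A \<in> \<A> \<Longrightarrow> B \<in> \<A> \<Longrightarrow> A \<inter> B = {} \<Longrightarrow> g (A \<union> B) = g A + g B" for g
  proof -
    have "g {} = 0" using add[of "{}" "{}"] by auto
    have "\<exists>\<mu>. (\<forall>s\<in>\<A>. \<mu> s = ennreal (g s)) \<and> measure_space (space M) (sigma_sets (space M) \<A>) \<mu>"
    proof (rule caratheodory_empty_continuous)
      show "positive \<A> (\<lambda>s. ennreal (g s))" unfolding positive_def using \<open>g {} = 0\<close> by simp
      show "additive \<A> (\<lambda>s. ennreal (g s))"
        unfolding additive_def using add g0 by (auto simp: ennreal_plus)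
      fix A :: "nat \<Rightarrow> 'a set" assume A: "range A \<subseteq> \<A>" "decseq A" "(\<Inter>i. A i) = {}"
      have "(\<lambda>i. measure M (A i)) \<longlonglongrightarrow> measure M (\<Inter>i. A i)"
        by (rule finite_Lim_measure_decseq) (use A sub in auto)
      then have "(\<lambda>i. measure M (A i)) \<longlonglongrightarrow> 0" using A by simp
      then have "(\<lambda>i. g (A i)) \<longlonglongrightarrow> 0"
        by (rule tendsto_sandwich[OF _ _ tendsto_const, rotated 2])
           (use A g0 g1 in \<open>auto intro!: always_eventually\<close>)
      then show "(\<lambda>i. ennreal (g (A i))) \<longlonglongrightarrow> 0"
        using tendsto_ennrealI ennreal_0 by metis
    qed auto
    then obtain \<mu> where \<mu>: "\<And>s. s \<in> \<A> \<Longrightarrow> \<mu> s = ennreal (g s)"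
      and ms: "measure_space (space M) (sigma_sets (space M) \<A>) \<mu>" by blast
    have pow: "\<A> \<subseteq> Pow (space M)" using space_closed .
    have "sets (measure_of (space M) \<A> \<mu>) = sets M" using pow gen by (simp add: sets_measure_of)
    moreover have "emeasure (measure_of (space M) \<A> \<mu>) A = ennreal (g A)" if "A \<in> \<A>" for A
      using ms that \<mu> pow unfolding measure_space_def by (subst emeasure_measure_of[OF refl]) auto
    ultimately show ?thesis by blast
  qed
  obtain m where m: "sets m = sets M" "\<And>A. A \<in> \<A> \<Longrightarrow> emeasure m A = ennreal (f A)"
    using ext[OF f0 f1 add] by blast
  have "\<exists>m. sets m = sets M \<and> (\<forall>A\<in>\<A>. emeasure m A = ennreal (measure M A - f A))"
  proof (rule ext)
    fix A B assume "A \<in> \<A>" "B \<in> \<A>" "A \<inter> B = {}"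
    then show "measure M (A \<union> B) - f (A \<union> B) = measure M A - f A + (measure M B - f B)"
      using add[of A B] by (simp add: finite_measure_Union sub)
  qed (use f0 f1 in auto)
  then obtain m' where m': "sets m' = sets M" "\<And>A. A \<in> \<A> \<Longrightarrow> emeasure m' A = ennreal (measure M A - f A)"
    by blast
  have top: "space M \<in> \<A>" by auto
  have sp: "space m = space M" "space m' = space M" using m m' sets_eq_imp_space_eq by blast+
  interpret m: finite_measure m by (rule finite_measureI) (simp add: sp m top)
  interpret m': finite_measure m' by (rule finite_measureI) (simp add: sp m' top)
  have base: "emeasure m A + emeasure m' A = emeasure M A" if "A \<in> \<A>" for A
    using that f0[OF that] f1[OF that] by (simp add: m m' emeasure_eq_measure flip: ennreal_plus)
  have "emeasure m A + emeasure m' A = emeasure M A" if "A \<in> sets M" for A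
  proof -
    have "Int_stable \<A>" by (auto simp: Int_stable_def)
    from this space_closed that[unfolded gen] show ?thesis
    proof (induction rule: sigma_sets_induct_disjoint)
      case (basic A) then show ?case by (rule base)
    next
      case empty then show ?case by simp
    next
      case (compl A)
      then have A: "A \<in> sets M" using gen by simp
      have "measure m A + measure m' A = measure M A"
        using compl.IH by (simp add: m.emeasure_eq_measure m'.emeasure_eq_measure emeasure_eq_measure flip: ennreal_plus)
      moreover have "measure m (space M) + measure m' (space M) = measure M (space M)"
        using base[OF top] by (simp add: m.emeasure_eq_measure m'.emeasure_eq_measure emeasure_eq_measure flip: ennreal_plus)
      ultimately have "measure m (space M - A) + measure m' (space M - A) = measure M (space M - A)"
        using A m.finite_measure_compl[of A] m'.finite_measure_compl[of A] finite_measure_compl[of A] sp m(1) m'(1)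
        by simp
      then show ?case
        by (simp add: m.emeasure_eq_measure m'.emeasure_eq_measure emeasure_eq_measure flip: ennreal_plus)
    next
      case (union A)
      then have A: "range A \<subseteq> sets M" using gen by auto
      have "emeasure m (\<Union>i. A i) + emeasure m' (\<Union>i. A i) = (\<Sum>i. emeasure m (A i)) + (\<Sum>i. emeasure m' (A i))"
        using A union(1) m m' by (subst (1 2) suminf_emeasure) auto
      also have "\<dots> = (\<Sum>i. emeasure m (A i) + emeasure m' (A i))"
        by (rule suminf_add) (auto intro: summableI)
      also have "\<dots> = (\<Sum>i. emeasure M (A i))"
        using union(3) by simp
      also have "\<dots> = emeasure M (\<Union>i. A i)"
        by (rule suminf_emeasure[OF A union(1)])
      finally show ?case .
    qed
  qed
  then have "emeasure m A \<le> emeasure M A" if "A \<in> sets M" for A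
    using that by (metis le_iff_add)
  then show thesis using that[OF m] by blast
qed

text \<open>\<open>ergodic_system\<close> speaks of strictly invariant sets. The limit superior of
  the preimages of \<open>A\<close> is strictly invariant, and it differs from \<open>A\<close> by a
  null set because consecutive preimages do.\<close>

lemma ergodic_almost_invariant:
  assumes "ergodic_system N S" and A: "A \<in> sets N"
    and inv: "emeasure N (A - S -` A \<inter> space N) = 0" "emeasure N (S -` A \<inter> space N - A) = 0"
  shows "emeasure N A = 0 \<or> emeasure N A = 1"
proof -
  have pm: "prob_space N" and S[measurable]: "S \<in> measurable N N" and dS: "distr N N S = N"
    and erg: "\<And>A. invariant_set N S A \<Longrightarrow> emeasure N A = 0 \<or> emeasure N A = 1"
    using assms(1) unfolding ergodic_system_def pmp_system_def by auto
  interpret prob_space N by fact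
  define P where "P n = (S ^^ n) -` A \<inter> space N" for n
  have Sn[measurable]: "S ^^ n \<in> measurable N N" for n
    by (induction n) auto
  have P[measurable]: "P n \<in> sets N" for n unfolding P_def using A by measurable
  have PS: "S -` P n \<inter> space N = P (Suc n)" for n
    unfolding P_def using measurable_space[OF S] by (auto simp: funpow_swap1)
  have pres: "emeasure N (S -` B \<inter> space N) = emeasure N B" if "B \<in> sets N" for B
    using emeasure_distr[OF S, of B] that dS by simp
  have nul: "emeasure N (P n - P (Suc n)) = 0 \<and> emeasure N (P (Suc n) - P n) = 0" for n
  proof (induction n)
    case 0
    have "P 0 = A" using sets.sets_into_space[OF A] by (auto simp: P_def)
    then show ?case using inv PS[of 0] by auto
  next
    case (Suc n)
    have "S -` (P n - P (Suc n)) \<inter> space N = P (Suc n) - P (Suc (Suc n))"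
      "S -` (P (Suc n) - P n) \<inter> space N = P (Suc (Suc n)) - P (Suc n)"
      by (simp_all add: PS vimage_Diff Diff_Int_distrib2)
    then show ?case using Suc pres[of "P n - P (Suc n)"] pres[of "P (Suc n) - P n"] by auto
  qed
  have ae: "AE x in N. \<forall>n. x \<in> P n \<longleftrightarrow> x \<in> P (Suc n)"
  proof (subst AE_all_countable, rule allI)
    fix n
    have "AE x in N. x \<notin> P n - P (Suc n)" "AE x in N. x \<notin> P (Suc n) - P n"
      using nul[of n] by - (intro AE_not_in null_setsI; simp)+
    then show "AE x in N. x \<in> P n \<longleftrightarrow> x \<in> P (Suc n)" by eventually_elim auto
  qed
  define B where "B = (\<Inter>n. \<Union>k\<in>{n..}. P k)"
  have B[measurable]: "B \<in> sets N" unfolding B_def by measurable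
  have "S -` B \<inter> space N = B"
  proof -
    have "S -` B \<inter> space N = (\<Inter>n. \<Union>k\<in>{n..}. S -` P k \<inter> space N)" unfolding B_def by auto
    also have "\<dots> = (\<Inter>n. \<Union>k\<in>{n..}. P (Suc k))" by (simp only: PS)
    also have "\<dots> = B"
    proof (rule set_eqI)
      fix x
      have "(\<forall>n. \<exists>k\<ge>n. x \<in> P (Suc k)) \<longleftrightarrow> (\<forall>n. \<exists>k\<ge>n. x \<in> P k)"
        by (metis Suc_le_D Suc_le_mono le_SucI)
      then show "(x \<in> (\<Inter>n. \<Union>k\<in>{n..}. P (Suc k))) = (x \<in> B)" unfolding B_def by auto
    qed
    finally show ?thesis .
  qed
  then have "emeasure N B = 0 \<or> emeasure N B = 1"
    by (intro erg) (auto simp: invariant_set_def)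
  moreover have "emeasure N A = emeasure N B"
  proof (rule emeasure_eq_AE)
    show "AE x in N. x \<in> A \<longleftrightarrow> x \<in> B"
      using ae
    proof eventually_elim
      case (elim x)
      have "x \<in> P n \<longleftrightarrow> x \<in> P 0" for n by (induction n) (use elim in auto)
      moreover have "P 0 = A" using sets.sets_into_space[OF A] by (auto simp: P_def)
      ultimately show ?case unfolding B_def by auto
    qed
  qed (use A in auto)
  ultimately show ?thesis by simp
qed

text \<open>For a density \<open>d\<close> of the invariant measure, \<open>\<integral> (d - c)\<close> has the same value over \<open>{d > c}\<close>
  and over its preimage, which forces the level sets to be almost invariant.\<close>

lemma ergodic_invariant_dominated:
  assumes erg: "ergodic_system N S" and "sets m = sets N"
    and le: "\<And>A. A \<in> sets N \<Longrightarrow> emeasure m A \<le> emeasure N A"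
    and inv: "\<And>A. A \<in> sets N \<Longrightarrow> emeasure m (S -` A \<inter> space N) = emeasure m A"
    and B: "B \<in> sets N"
  shows "measure m B = measure m (space N) * measure N B"
proof -
  have pm: "prob_space N" and S[measurable]: "S \<in> measurable N N" and dS: "distr N N S = N"
    using erg unfolding ergodic_system_def pmp_system_def by auto
  interpret prob_space N by fact
  have fin: "finite_measure N" by standard auto
  obtain d where d[measurable]: "d \<in> borel_measurable N" and d0: "\<And>x. 0 \<le> d x" and d1: "\<And>x. d x \<le> 1"
    and dm: "\<And>A. A \<in> sets N \<Longrightarrow> measure m A = (\<integral>x. indicator A x * d x \<partial>N)"
    using dominated_density[OF fin assms(2) le] by metis
  have int: "integrable N (\<lambda>x. indicator A x * d x)" if "A \<in> sets N" for A
    by (rule integrable_const_bound[of _ 1]) (use that d0 d1 in \<open>auto simp: indicator_def\<close>)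
  have pres: "measure N (S -` A \<inter> space N) = measure N A" if "A \<in> sets N" for A
    using measure_distr[OF S, of A] that dS by simp
  have lev: "emeasure N {x \<in> space N. d x > c} = 0 \<or> emeasure N {x \<in> space N. d x > c} = 1" for c
  proof -
    define A where "A = {x \<in> space N. d x > c}"
    have A[measurable]: "A \<in> sets N" unfolding A_def by measurable
    define A' where "A' = S -` A \<inter> space N"
    have A'[measurable]: "A' \<in> sets N" unfolding A'_def by measurable
    have I: "(\<integral>x. indicator C x * (d x - c) \<partial>N) = measure m C - c * measure N C" if "C \<in> sets N" for C
    proof -
      have "(\<integral>x. indicator C x * (d x - c) \<partial>N) = (\<integral>x. indicator C x * d x - indicator C x * c \<partial>N)"
        by (simp add: right_diff_distrib)
      also have "\<dots> = measure m C - c * measure N C"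
        using that int[OF that] by (subst Bochner_Integration.integral_diff) (auto simp: dm intro!: integrable_mult_left integrable_real_indicator simp: less_top[symmetric])
      finally show ?thesis .
    qed
    have eq: "(\<integral>x. indicator A x * (d x - c) \<partial>N) = (\<integral>x. indicator A' x * (d x - c) \<partial>N)"
      using inv[OF A] pres[OF A] by (simp add: I A'_def measure_def)
    have int': "integrable N (\<lambda>x. indicator C x * (d x - c))" if "C \<in> sets N" for C
      unfolding right_diff_distrib
      by (intro Bochner_Integration.integrable_diff int integrable_mult_left integrable_real_indicator)
        (use that in \<open>auto simp: less_top[symmetric]\<close>)
    have spl: "(\<integral>x. indicator C x * (d x - c) \<partial>N) =
       (\<integral>x. indicator (C - C') x * (d x - c) \<partial>N) + (\<integral>x. indicator (C \<inter> C') x * (d x - c) \<partial>N)"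
      if "C \<in> sets N" "C' \<in> sets N" for C C'
      using that by (subst Bochner_Integration.integral_add[symmetric])
        (auto intro!: int' sets.Diff sets.Int intro: Bochner_Integration.integral_cong split: split_indicator)
    \<comment> \<open>The contributions of \<open>A \<inter> A'\<close> cancel. The remaining
      integrand is positive on \<open>A - A'\<close> and at most 0 on \<open>A' - A\<close>, so
      \<open>A - A'\<close> is null, and then so is \<open>A' - A\<close>, because \<open>A\<close>
      and \<open>A'\<close> have equal measure.\<close>
    have "(\<integral>x. indicator (A - A') x * (d x - c) \<partial>N) = (\<integral>x. indicator (A' - A) x * (d x - c) \<partial>N)"
      using eq spl[OF A A'] spl[OF A' A] by (simp add: Int_commute)
    also have "\<dots> \<le> 0"
    proof -
      have "0 \<le> (\<integral>x. - (indicator (A' - A) x * (d x - c)) \<partial>N)"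
        by (rule integral_nonneg_AE) (auto simp: A_def A'_def indicator_def)
      then show ?thesis by simp
    qed
    finally have "(\<integral>x. indicator (A - A') x * (d x - c) \<partial>N) \<le> 0" .
    moreover have nn: "AE x in N. 0 \<le> indicator (A - A') x * (d x - c)"
      by (auto simp: A_def indicator_def)
    ultimately have "(\<integral>x. indicator (A - A') x * (d x - c) \<partial>N) = 0"
      using integral_nonneg_AE[OF nn] by simp
    then have "AE x in N. indicator (A - A') x * (d x - c) = 0"
      using integral_nonneg_eq_0_iff_AE[OF int' nn] by simp
    then have "AE x in N. x \<notin> A - A'"
      by eventually_elim (auto simp: A_def indicator_def)
    then have n1: "measure N (A - A') = 0"
      by (simp add: prob_eq_0)
    have "measure N A = measure N (A - A') + measure N (A \<inter> A')"
      by (subst finite_measure_Union[symmetric]) (auto intro!: arg_cong[where f = "measure N"])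
    moreover have "measure N A' = measure N (A' - A) + measure N (A \<inter> A')"
      by (subst finite_measure_Union[symmetric]) (auto intro!: arg_cong[where f = "measure N"])
    ultimately have "measure N (A' - A) = 0"
      using n1 pres[OF A] by (simp add: A'_def)
    then show ?thesis
      using ergodic_almost_invariant[OF erg A] n1 unfolding A_def[symmetric] A'_def
      by (simp add: emeasure_eq_measure)
  qed
  define c where "c = (\<integral>x. d x \<partial>N)"
  have idd: "integrable N d"
    by (rule integrable_const_bound[of _ 1]) (use d0 d1 in auto)
  have "AE x in N. d x = c"
  proof -
    \<comment> \<open>A density cannot exceed its own mean \<open>c\<close> almost everywhere; by
      \<open>lev\<close> the only alternative is that it exceeds \<open>c\<close> on a null
      set.\<close>
    have nz: "emeasure N {x \<in> space N. d x > c} = 0"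
    proof (rule ccontr)
      assume "emeasure N {x \<in> space N. d x > c} \<noteq> 0"
      then have "prob {x \<in> space N. d x > c} = 1" using lev[of c] by (auto simp: emeasure_eq_measure)
      then have "AE x in N. d x > c" by (simp add: prob_eq_1)
      then have "(\<integral>x. d x - c \<partial>N) > 0"
        using idd by (intro integral_less_AE_space[of "\<lambda>_. 0", simplified]) (auto simp: emeasure_space_1)
      then show False using idd by (simp add: c_def prob_space)
    qed
    then have le: "AE x in N. d x \<le> c"
      by (subst AE_iff_measurable[OF _ refl]) (auto simp: not_le)
    then have "AE x in N. c - d x = 0"
      using idd by (subst integral_nonneg_eq_0_iff_AE[symmetric]) (auto simp: c_def prob_space)
    then show ?thesis by eventually_elim simp
  qed
  then have "(\<integral>x. indicator B x * d x \<partial>N) = (\<integral>x. indicator B x * c \<partial>N)" if "B \<in> sets N" for B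
    using that by (intro integral_cong_AE) auto
  then show ?thesis using B dm[of "space N"] by (simp add: dm prob_space)
qed

section \<open>Bimeasures on standard spaces\<close>

text \<open>Uniqueness of measures on an intersection-stable generator, applied to the measures with
  densities \<open>f\<close> and \<open>g\<close>. Monotonicity, additivity, invariance and
  marginals of densities are obtained through it below.\<close>

lemma AE_eq_from_generator:
  fixes f g :: "'a \<Rightarrow> real"
  assumes "finite_measure M" "Int_stable E" "E \<subseteq> Pow (space M)" "sets M = sigma_sets (space M) E" "space M \<in> E"
    and f[measurable]: "f \<in> borel_measurable M" and g[measurable]: "g \<in> borel_measurable M"
    and f0: "\<And>x. 0 \<le> f x" and g0: "\<And>x. 0 \<le> g x"
    and fi: "integrable M f" and gi: "integrable M g"
    and eq: "\<And>A. A \<in> E \<Longrightarrow> (\<integral>x. indicator A x * f x \<partial>M) = (\<integral>x. indicator A x * g x \<partial>M)"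
  shows "AE x in M. f x = g x"
proof -
  interpret finite_measure M by fact
  have em: "emeasure (density M (\<lambda>x. ennreal (h x))) A = ennreal (\<integral>x. indicator A x * h x \<partial>M)"
    if h[measurable]: "h \<in> borel_measurable M" and "integrable M h" "\<And>x. 0 \<le> h x" and A[measurable]: "A \<in> sets M" for h :: "'a \<Rightarrow> real" and A
  proof -
    have "integrable M (\<lambda>x. indicator A x * h x)"
      using that by (simp add: integrable_real_mult_indicator mult.commute)
    then have "ennreal (\<integral>x. indicator A x * h x \<partial>M) = (\<integral>\<^sup>+x. ennreal (indicator A x * h x) \<partial>M)"
      using that by (subst nn_integral_eq_integral) auto
    also have "\<dots> = (\<integral>\<^sup>+x. ennreal (h x) * indicator A x \<partial>M)"
      by (rule nn_integral_cong) (auto simp: indicator_def)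
    finally show ?thesis by (simp add: emeasure_density)
  qed
  have sub: "A \<in> sets M" if "A \<in> E" for A using that assms(4) by auto
  have "density M (\<lambda>x. ennreal (f x)) = density M (\<lambda>x. ennreal (g x))"
  proof (rule measure_eqI_generator_eq[of E "space M" _ _ "\<lambda>_. space M"])
    fix X assume "X \<in> E"
    then show "emeasure (density M (\<lambda>x. ennreal (f x))) X = emeasure (density M (\<lambda>x. ennreal (g x))) X"
      using em[OF f fi f0 sub] em[OF g gi g0 sub] eq by simp
  next
    show "emeasure (density M (\<lambda>x. ennreal (f x))) (space M) \<noteq> \<infinity>"
      by (subst em[OF f fi f0]) auto
  qed (use assms in auto)
  then have "AE x in M. ennreal (f x) = ennreal (g x)"
    by (subst density_unique_iff[symmetric]) auto
  then show ?thesis by eventually_elim (simp add: f0 g0)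
qed

lemma algebra_generator:
  assumes "algebra \<Omega> \<A>"
  shows "Int_stable \<A>" "\<A> \<subseteq> Pow \<Omega>" "\<Omega> \<in> \<A>"
proof -
  interpret algebra \<Omega> \<A> by fact
  show "Int_stable \<A>" "\<A> \<subseteq> Pow \<Omega>" "\<Omega> \<in> \<A>" using space_closed by (auto simp: Int_stable_def)
qed

text \<open>The densities of \<open>q(\<cdot>, {e < t})\<close> are conditional distribution functions of the second
  coordinate given the first, and the measure is obtained by applying the conditional quantile
  function \<open>G\<close> to an independent uniform variable.\<close>

lemma joint_extension:
  fixes q :: "'a set \<Rightarrow> 'b set \<Rightarrow> real"
  assumes pM1: "prob_space M1" and alg1: "algebra (space M1) \<A>" and gen1: "sets M1 = sigma_sets (space M1) \<A>"
    and pM2: "prob_space M2" and alg2: "algebra (space M2) \<B>" and gen2: "sets M2 = sigma_sets (space M2) \<B>"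
    and e[measurable]: "e \<in> borel_measurable M2" and e01: "\<And>x. e x \<in> {0..1::real}"
    and r[measurable]: "r \<in> measurable borel M2" and re: "\<And>x. x \<in> space M2 \<Longrightarrow> r (e x) = x"
    and half: "\<And>t. t \<in> \<rat> \<Longrightarrow> {x \<in> space M2. e x < t} \<in> \<B>"
    and q0: "\<And>A B. A \<in> \<A> \<Longrightarrow> B \<in> \<B> \<Longrightarrow> 0 \<le> q A B"
    and addl: "\<And>A A' B. A \<in> \<A> \<Longrightarrow> A' \<in> \<A> \<Longrightarrow> B \<in> \<B> \<Longrightarrow> A \<inter> A' = {} \<Longrightarrow> q (A \<union> A') B = q A B + q A' B"
    and addr: "\<And>A B B'. A \<in> \<A> \<Longrightarrow> B \<in> \<B> \<Longrightarrow> B' \<in> \<B> \<Longrightarrow> B \<inter> B' = {} \<Longrightarrow> q A (B \<union> B') = q A B + q A B'"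
    and margl: "\<And>A. A \<in> \<A> \<Longrightarrow> q A (space M2) = measure M1 A"
    and margr: "\<And>B. B \<in> \<B> \<Longrightarrow> q (space M1) B = measure M2 B"
  obtains L where "sets L = sets (M1 \<Otimes>\<^sub>M M2)" "prob_space L"
    "\<And>A B. A \<in> \<A> \<Longrightarrow> B \<in> \<B> \<Longrightarrow> measure L (A \<times> B) = q A B"
proof -
  interpret M1: prob_space M1 by fact
  interpret M2: prob_space M2 by fact
  interpret A1: algebra "space M1" \<A> by fact
  interpret A2: algebra "space M2" \<B> by fact
  have fin1: "finite_measure M1" and fin2: "finite_measure M2"
    by (rule M1.finite_measure_axioms, rule M2.finite_measure_axioms)
  have subA[measurable]: "A \<in> sets M1" if "A \<in> \<A>" for A using that gen1 by auto
  have subB[measurable]: "B \<in> sets M2" if "B \<in> \<B>" for B using that gen2 by auto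
  have q1: "q A B \<le> measure M1 A" if "A \<in> \<A>" "B \<in> \<B>" for A B
    using addr[of A B "space M2 - B"] margl[of A] q0[of A "space M2 - B"] that A2.compl_sets sets.sets_into_space[OF subB[of B]]
    by (simp add: Un_absorb1)
  have q2: "q A B \<le> measure M2 B" if "A \<in> \<A>" "B \<in> \<B>" for A B
    using addl[of A "space M1 - A" B] margr[of B] q0[of "space M1 - A" B] that A1.compl_sets sets.sets_into_space[OF subA[of A]]
    by (simp add: Un_absorb1)

  \<comment> \<open>Sections of \<open>q\<close> as measures on the second space and as densities on
    the first\<close>
  have "\<exists>m. sets m = sets M2 \<and> (\<forall>B\<in>\<B>. emeasure m B = ennreal (q A B))" if "A \<in> \<A>" for A
    by (rule dominated_extension[OF fin2 alg2 gen2, of "q A"]) (use that q0 q2 addr in auto)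
  then obtain m where m: "\<And>A. A \<in> \<A> \<Longrightarrow> sets (m A) = sets M2"
    "\<And>A B. A \<in> \<A> \<Longrightarrow> B \<in> \<B> \<Longrightarrow> emeasure (m A) B = ennreal (q A B)" by metis
  have "\<exists>k. k \<in> borel_measurable M1 \<and> (\<forall>x. 0 \<le> k x \<and> k x \<le> 1) \<and>
      (\<forall>A\<in>\<A>. q A B = (\<integral>x. indicator A x * k x \<partial>M1))" if B: "B \<in> \<B>" for B
  proof -
    obtain n where n: "sets n = sets M1" "\<And>A. A \<in> \<A> \<Longrightarrow> emeasure n A = ennreal (q A B)"
      "\<And>A. A \<in> sets M1 \<Longrightarrow> emeasure n A \<le> emeasure M1 A"
      by (rule dominated_extension[OF fin1 alg1 gen1, of "\<lambda>A. q A B"]) (use B q0 q1 addl in auto)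
    obtain d :: "'a \<Rightarrow> real" where d: "d \<in> borel_measurable M1" "\<And>x. 0 \<le> d x" "\<And>x. d x \<le> 1"
      "\<And>A. A \<in> sets M1 \<Longrightarrow> measure n A = (\<integral>x. indicator A x * d x \<partial>M1)"
      using dominated_density[OF fin1 n(1,3)] by metis
    have "q A B = (\<integral>x. indicator A x * d x \<partial>M1)" if "A \<in> \<A>" for A
      using d(4)[OF subA[OF that]] n(2)[OF that] q0[OF that B] by (simp add: measure_def)
    with d show ?thesis by blast
  qed
  then obtain k where k[measurable]: "\<And>B. B \<in> \<B> \<Longrightarrow> k B \<in> borel_measurable M1"
    and k01: "\<And>B x. B \<in> \<B> \<Longrightarrow> 0 \<le> k B x" "\<And>B x. B \<in> \<B> \<Longrightarrow> k B x \<le> 1"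
    and kq: "\<And>A B. A \<in> \<A> \<Longrightarrow> B \<in> \<B> \<Longrightarrow> q A B = (\<integral>x. indicator A x * k B x \<partial>M1)"
    by metis
  have ki: "integrable M1 (k B)" if "B \<in> \<B>" for B
    by (rule M1.integrable_const_bound[of _ 1]) (use that k01 in auto)
  have kiA: "integrable M1 (\<lambda>x. indicator A x * k B x)" if "A \<in> \<A>" "B \<in> \<B>" for A B
    by (rule M1.integrable_const_bound[of _ 1]) (use that k01 in \<open>auto simp: indicator_def\<close>)
  \<comment> \<open>The densities are chosen separately for each \<open>B\<close>, so the
    conditional distribution function is monotone only almost everywhere. Restricting to rational
    thresholds keeps the exceptional set null.\<close>
  have kmono: "AE x in M1. k B x \<le> k C x" if BC: "B \<in> \<B>" "C \<in> \<B>" "B \<subseteq> C" for B C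
  proof -
    have CB: "C - B \<in> \<B>" using BC by auto
    have "AE x in M1. k C x = k B x + k (C - B) x"
    proof (rule AE_eq_from_generator[OF fin1 algebra_generator(1,2)[OF alg1] gen1])
      fix A assume A: "A \<in> \<A>"
      have "q A C = q A B + q A (C - B)"
        using addr[OF A BC(1) CB] BC(3) by (simp add: Un_absorb1)
      then show "(\<integral>x. indicator A x * k C x \<partial>M1) = (\<integral>x. indicator A x * (k B x + k (C - B) x) \<partial>M1)"
        using A BC CB kiA[OF A BC(1)] kiA[OF A CB] by (simp add: kq distrib_left)
    qed (use BC CB k01 ki in \<open>auto intro!: add_nonneg_nonneg\<close>)
    then show ?thesis by eventually_elim (use k01(1)[OF CB] in simp)
  qed

  \<comment> \<open>The conditional quantile function\<close>
  define L where "L t = {x \<in> space M2. e x < t}" for t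
  have LB: "L t \<in> \<B>" if "t \<in> \<rat>" for t using half that unfolding L_def by simp
  have Lmono: "L s \<subseteq> L t" if "s \<le> t" for s t using that unfolding L_def by auto
  have Lm[measurable]: "L t \<in> sets M2" for t unfolding L_def by measurable
  define U where "U = restrict_space lborel {0..1::real}"
  have spU: "space U = {0..1}"
    unfolding U_def by (simp add: space_restrict_space)
  have emU: "emeasure U {u \<in> {0..1}. u < c} = ennreal c" if "0 \<le> c" "c \<le> 1" for c
  proof -
    have "{u \<in> {0..1}. u < c} = {0..<c}" using that by auto
    then have "emeasure U {u \<in> {0..1}. u < c} = emeasure U {0..<c}" by (rule arg_cong)
    also have "\<dots> = emeasure lborel {0..<c}"
      unfolding U_def by (rule emeasure_restrict_space) (use that in auto)
    also have "\<dots> = ennreal c" using that by simp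
    finally show ?thesis .
  qed
  interpret U: prob_space U
  proof (rule prob_spaceI)
    have "emeasure U {0..1} = 1" unfolding U_def by (subst emeasure_restrict_space) auto
    then show "emeasure U (space U) = 1" by (simp add: spU)
  qed
  have idU[measurable]: "(\<lambda>u. u) \<in> borel_measurable U"
    unfolding U_def by (intro measurable_restrict_space1) auto
  interpret Z: pair_prob_space M1 U ..
  let ?Z = "M1 \<Otimes>\<^sub>M U"
  have kt[measurable]: "k (L (real_of_rat t)) \<in> borel_measurable M1" for t
    by (rule k) (simp add: LB)
  \<comment> \<open>The infimum of the rational levels \<open>t\<close> whose conditional
    probability \<open>k (L t)\<close> exceeds the uniform variable. The lower bound 0 and the
    default 2 keep the infimum in \<open>[0, 2]\<close>, hence real; the default lies beyond all
    values of \<open>e\<close>.\<close>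
  define G where "G z = real_of_ereal (INF t. if snd z < k (L (real_of_rat t)) (fst z) then ereal (max 0 (real_of_rat t)) else 2)" for z
  have snd[measurable]: "snd \<in> borel_measurable ?Z"
    using measurable_compose[OF measurable_snd idU] by simp
  have G[measurable]: "G \<in> borel_measurable ?Z"
    unfolding G_def by measurable
  have Gless: "G z < s \<longleftrightarrow> 2 < s \<or> (0 < s \<and> (\<exists>t. snd z < k (L (real_of_rat t)) (fst z) \<and> real_of_rat t < s))" for z s
  proof -
    let ?I = "INF t. if snd z < k (L (real_of_rat t)) (fst z) then ereal (max 0 (real_of_rat t)) else 2"
    have "?I \<le> 2"
    proof (rule order_trans[OF INF_lower[of "0"]])
      show "(if snd z < k (L (real_of_rat 0)) (fst z) then ereal (max 0 (real_of_rat 0)) else 2) \<le> 2" by auto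
    qed auto
    moreover have "0 \<le> ?I" by (rule INF_greatest) (auto simp: le_max_iff_disj)
    ultimately obtain g where g: "?I = ereal g" by (cases ?I) auto
    have "G z < s \<longleftrightarrow> ?I < ereal s" unfolding G_def by (simp only: g real_of_ereal.simps less_ereal.simps)
    also have "\<dots> \<longleftrightarrow> (\<exists>t. (if snd z < k (L (real_of_rat t)) (fst z) then ereal (max 0 (real_of_rat t)) else 2) < ereal s)"
      by (simp only: INF_less_iff bex_UNIV)
    also have "\<dots> \<longleftrightarrow> 2 < s \<or> (0 < s \<and> (\<exists>t. snd z < k (L (real_of_rat t)) (fst z) \<and> real_of_rat t < s))"
    proof -
      have two: "(2 :: ereal) < ereal s \<longleftrightarrow> 2 < s"
        by (metis less_ereal.simps(1) numeral_eq_ereal)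
      show ?thesis
      proof
        assume "\<exists>t. (if snd z < k (L (real_of_rat t)) (fst z) then ereal (max 0 (real_of_rat t)) else 2) < ereal s"
        then obtain t where "(if snd z < k (L (real_of_rat t)) (fst z) then ereal (max 0 (real_of_rat t)) else 2) < ereal s" ..
        then show "2 < s \<or> (0 < s \<and> (\<exists>t. snd z < k (L (real_of_rat t)) (fst z) \<and> real_of_rat t < s))"
          using two by (cases "snd z < k (L (real_of_rat t)) (fst z)") auto
      next
        assume "2 < s \<or> (0 < s \<and> (\<exists>t. snd z < k (L (real_of_rat t)) (fst z) \<and> real_of_rat t < s))"
        then show "\<exists>t. (if snd z < k (L (real_of_rat t)) (fst z) then ereal (max 0 (real_of_rat t)) else 2) < ereal s"
        proof (elim disjE conjE exE)
          assume "2 < s"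
          then show ?thesis using two by (intro exI[of _ 0]) auto
        next
          fix t assume "0 < s" "snd z < k (L (real_of_rat t)) (fst z)" "real_of_rat t < s"
          then show ?thesis by (intro exI[of _ t]) auto
        qed
      qed
    qed
    finally show ?thesis .
  qed

  \<comment> \<open>The law of the quantile function\<close>
  have Vm: "emeasure ?Z {z \<in> A \<times> {0..1}. \<exists>t. real_of_rat t \<le> \<tau> \<and> snd z < k (L (real_of_rat t)) (fst z)} = emeasure (m A) (L \<tau>)"
    (is "emeasure ?Z ?V = _") if A: "A \<in> \<A>" and \<tau>: "\<tau> \<in> \<rat>" for A \<tau>
  proof -
    have [measurable]: "A \<in> sets M1" using A by simp
    have kL[measurable]: "k (L \<tau>) \<in> borel_measurable M1" by (rule k[OF LB[OF \<tau>]])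
    have "{z \<in> space ?Z. fst z \<in> A \<and> (\<exists>t\<in>{t. real_of_rat t \<le> \<tau>}. snd z < k (L (real_of_rat t)) (fst z))} \<in> sets ?Z"
      by measurable
    also have "{z \<in> space ?Z. fst z \<in> A \<and> (\<exists>t\<in>{t. real_of_rat t \<le> \<tau>}. snd z < k (L (real_of_rat t)) (fst z))} = ?V"
      using sets.sets_into_space[OF subA[OF A]] by (auto simp: space_pair_measure spU)
    finally have V: "?V \<in> sets ?Z" .
    \<comment> \<open>By almost sure monotonicity the condition at the level \<tau> is the weakest
      among those at levels up to \<tau>, so the union over these levels collapses to a single
      half-open interval in each fibre.\<close>
    have ae: "AE x in M1. \<forall>t\<in>{t. real_of_rat t \<le> \<tau>}. k (L (real_of_rat t)) x \<le> k (L \<tau>) x"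
      by (subst AE_ball_countable) (auto intro!: kmono LB Lmono \<tau>)
    have "emeasure ?Z ?V = (\<integral>\<^sup>+x. emeasure U (Pair x -` ?V) \<partial>M1)"
      by (rule U.emeasure_pair_measure_alt[OF V])
    also have "\<dots> = (\<integral>\<^sup>+x. ennreal (indicator A x * k (L \<tau>) x) \<partial>M1)"
    proof (rule nn_integral_cong_AE)
      show "AE x in M1. emeasure U (Pair x -` ?V) = ennreal (indicator A x * k (L \<tau>) x)"
        using ae
      proof eventually_elim
        case (elim x)
        show ?case
        proof (cases "x \<in> A")
          case True
          obtain t0 where t0: "\<tau> = real_of_rat t0" using \<tau> by (auto elim: Rats_cases)
          have "Pair x -` ?V = {u \<in> {0..1}. u < k (L \<tau>) x}"
            using elim True t0 by force
          then have "emeasure U (Pair x -` ?V) = emeasure U {u \<in> {0..1}. u < k (L \<tau>) x}" by (rule arg_cong)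
          also have "\<dots> = ennreal (k (L \<tau>) x)" by (rule emU) (simp_all add: k01 LB \<tau>)
          finally show ?thesis using True by simp
        qed auto
      qed
    qed
    also have "\<dots> = ennreal (q A (L \<tau>))"
      using kiA[OF A LB[OF \<tau>]] A \<tau> k01 by (subst nn_integral_eq_integral) (auto simp: kq LB)
    also have "\<dots> = emeasure (m A) (L \<tau>)" using m A LB \<tau> by simp
    finally show ?thesis .
  qed
  have Gm: "emeasure ?Z {z \<in> A \<times> {0..1}. G z < s} = emeasure (m A) (L s)" if A: "A \<in> \<A>" for A s
  proof -
    have [measurable]: "A \<in> sets M1" using A by simp
    consider "s \<le> 0" | "0 < s" "s \<le> 2" | "2 < s" by linarith
    then show ?thesis
    proof cases
      case 1
      then have "L s = {}" unfolding L_def using e01 by (auto simp: not_less) (meson order.trans)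
      moreover have "{z \<in> A \<times> {0..1}. G z < s} = {}" using 1 Gless by auto
      ultimately show ?thesis by (simp only: emeasure_empty)
    next
      case 3
      have "e x < s" for x using e01[of x] 3 by auto
      then have "L s = space M2" unfolding L_def by auto
      moreover have "{z \<in> A \<times> {0..1}. G z < s} = A \<times> space U" using 3 Gless by (auto simp: spU)
      ultimately show ?thesis
        using m(2)[OF A, of "space M2"] A
        by (simp add: U.emeasure_pair_measure_Times U.emeasure_space_1 margl M1.emeasure_eq_measure)
    next
      case 2
      \<comment> \<open>The largest multiple of \<open>1 / 2 ^ n\<close> strictly below
        \<open>s\<close>. These points are rational, so densities are available for them, and they
        increase to \<open>s\<close>, so the sets \<open>L (\<tau> n)\<close> exhaust
        \<open>L s\<close>.\<close>
      define \<tau> :: "nat \<Rightarrow> real" where "\<tau> n = of_int (\<lceil>2 ^ n * s\<rceil> - 1) / 2 ^ n" for n :: nat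
      have \<tau>Q: "\<tau> n \<in> \<rat>" for n unfolding \<tau>_def by auto
      have \<tau>s: "\<tau> n < s" for n
        unfolding \<tau>_def using ceiling_correct[of "2 ^ n * s"] by (simp add: field_simps)
      have \<tau>inc: "\<tau> n \<le> \<tau> (Suc n)" for n
      proof -
        have "of_int (\<lceil>2 ^ n * s\<rceil> - 1) < 2 ^ n * s" using ceiling_correct[of "2 ^ n * s"] by simp
        then have "of_int (2 * (\<lceil>2 ^ n * s\<rceil> - 1)) < 2 ^ Suc n * s" by simp
        then have "2 * (\<lceil>2 ^ n * s\<rceil> - 1) < \<lceil>2 ^ Suc n * s\<rceil>" by (simp only: less_ceiling_iff)
        then have "of_int (2 * (\<lceil>2 ^ n * s\<rceil> - 1)) \<le> (of_int (\<lceil>2 ^ Suc n * s\<rceil> - 1) :: real)"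
          by (simp only: of_int_le_iff)
        then have "of_int (2 * (\<lceil>2 ^ n * s\<rceil> - 1)) / 2 ^ Suc n \<le> \<tau> (Suc n)"
          unfolding \<tau>_def by (rule divide_right_mono) simp
        moreover have "\<tau> n = of_int (2 * (\<lceil>2 ^ n * s\<rceil> - 1)) / 2 ^ Suc n"
          unfolding \<tau>_def by (simp add: field_simps)
        ultimately show ?thesis by simp
      qed
      then have inc: "incseq \<tau>" by (rule incseq_SucI)
      have \<tau>lim: "\<exists>n. t \<le> \<tau> n" if "t < s" for t
      proof -
        have "\<exists>n. (1/2) ^ n < s - t" by (rule real_arch_pow_inv) (use that in auto)
        then obtain n where n: "(1/2) ^ n < s - t" ..
        have "2 ^ n * s - 1 \<le> of_int (\<lceil>2 ^ n * s\<rceil> - 1)" by (simp add: le_of_int_ceiling)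
        then have "s - (1/2) ^ n \<le> \<tau> n" unfolding \<tau>_def by (simp add: field_simps power_one_over)
        with n show ?thesis by (intro exI[of _ n]) simp
      qed
      define V where "V n = {z \<in> A \<times> {0..1}. \<exists>t. real_of_rat t \<le> \<tau> n \<and> snd z < k (L (real_of_rat t)) (fst z)}" for n
      have "{z \<in> A \<times> {0..1}. G z < s} = (\<Union>n. V n)"
      proof (rule set_eqI)
        fix z
        have "G z < s \<longleftrightarrow> (\<exists>t. snd z < k (L (real_of_rat t)) (fst z) \<and> real_of_rat t < s)"
          unfolding Gless using 2 by simp
        also have "\<dots> \<longleftrightarrow> (\<exists>n t. real_of_rat t \<le> \<tau> n \<and> snd z < k (L (real_of_rat t)) (fst z))"
          using \<tau>lim \<tau>s le_less_trans by blast
        finally show "z \<in> {z \<in> A \<times> {0..1}. G z < s} \<longleftrightarrow> z \<in> (\<Union>n. V n)" unfolding V_def by auto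
      qed
      moreover have VS: "range V \<subseteq> sets ?Z"
      proof safe
        fix n
        have "{z \<in> space ?Z. fst z \<in> A \<and> (\<exists>t\<in>{t. real_of_rat t \<le> \<tau> n}. snd z < k (L (real_of_rat t)) (fst z))} \<in> sets ?Z"
          by measurable
        also have "{z \<in> space ?Z. fst z \<in> A \<and> (\<exists>t\<in>{t. real_of_rat t \<le> \<tau> n}. snd z < k (L (real_of_rat t)) (fst z))} = V n"
          using sets.sets_into_space[OF subA[OF A]] by (auto simp: space_pair_measure spU V_def)
        finally show "V n \<in> sets ?Z" .
      qed
      moreover have "incseq V"
      proof (rule incseq_SucI, rule subsetI)
        fix n z assume "z \<in> V n"
        then obtain t where "z \<in> A \<times> {0..1}" "real_of_rat t \<le> \<tau> n" "snd z < k (L (real_of_rat t)) (fst z)"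
          unfolding V_def by blast
        moreover from this(2) have "real_of_rat t \<le> \<tau> (Suc n)" using \<tau>inc[of n] by (rule order_trans)
        ultimately show "z \<in> V (Suc n)" unfolding V_def by blast
      qed
      ultimately have "emeasure ?Z {z \<in> A \<times> {0..1}. G z < s} = (SUP n. emeasure ?Z (V n))"
        by (simp add: SUP_emeasure_incseq)
      also have "\<dots> = (SUP n. emeasure (m A) (L (\<tau> n)))"
        unfolding V_def using Vm[OF A \<tau>Q] by simp
      also have "\<dots> = emeasure (m A) (\<Union>n. L (\<tau> n))"
        by (rule SUP_emeasure_incseq) (use m A inc Lmono in \<open>auto simp: incseq_def\<close>)
      also have "(\<Union>n. L (\<tau> n)) = L s"
      proof
        show "(\<Union>n. L (\<tau> n)) \<subseteq> L s" using \<tau>s Lmono less_imp_le by blast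
        show "L s \<subseteq> (\<Union>n. L (\<tau> n))"
        proof
          fix x assume "x \<in> L s"
          then have x: "x \<in> space M2" "e x < s" unfolding L_def by auto
          then obtain t where "e x < t" "t < s" using dense by blast
          moreover obtain n where "t \<le> \<tau> n" using \<tau>lim[OF \<open>t < s\<close>] by blast
          ultimately have "x \<in> L (\<tau> n)" using x unfolding L_def by simp
          then show "x \<in> (\<Union>n. L (\<tau> n))" by blast
        qed
      qed
      finally show ?thesis .
    qed
  qed
  have main: "emeasure ?Z {z \<in> A \<times> {0..1}. G z \<in> B} = emeasure (m A) (e -` B \<inter> space M2)"
    if A: "A \<in> \<A>" and B: "B \<in> sets borel" for A B
  proof -
    have [measurable]: "A \<in> sets M1" using A by simp
    have AU: "A \<times> {0..1} \<in> sets ?Z" using sets.top[of U] by (auto simp: spU)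
    have em[measurable]: "e \<in> borel_measurable (m A)" using m(1)[OF A] e measurable_cong_sets by blast
    have spm: "space (m A) = space M2" using sets_eq_imp_space_eq[OF m(1)[OF A]] .
    define D where "D = distr (density ?Z (indicator (A \<times> {0..1}))) borel G"
    have D: "emeasure D B = emeasure ?Z {z \<in> A \<times> {0..1}. G z \<in> B}" if [measurable]: "B \<in> sets borel" for B
    proof -
      have "emeasure D B = emeasure (density ?Z (indicator (A \<times> {0..1}))) (G -` B \<inter> space ?Z)"
        unfolding D_def by (subst emeasure_distr) auto
      also have "\<dots> = emeasure ?Z ((G -` B \<inter> space ?Z) \<inter> (A \<times> {0..1}))"
        using AU by (subst emeasure_density) (auto simp: indicator_inter_arith[symmetric] Int_commute intro!: sets.Int)
      also have "(G -` B \<inter> space ?Z) \<inter> (A \<times> {0..1}) = {z \<in> A \<times> {0..1}. G z \<in> B}"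
        using sets.sets_into_space[OF AU] by auto
      finally show ?thesis .
    qed
    have E: "emeasure (distr (m A) borel e) B = emeasure (m A) (e -` B \<inter> space M2)" if "B \<in> sets borel" for B
      using that by (simp add: emeasure_distr spm)
    \<comment> \<open>Half-lines are an intersection-stable generator of the Borel sets of the line,
      and on them the two measures agree by \<open>Gm\<close>.\<close>
    have "D = distr (m A) borel e"
    proof (rule measure_eqI_generator_eq[of "range lessThan" UNIV _ _ "\<lambda>n. {..<real n}"])
      fix X assume "X \<in> range (lessThan :: real \<Rightarrow> _)"
      then obtain s where X: "X = {..<s}" by auto
      have "e -` {..<s} \<inter> space M2 = L s" unfolding L_def by auto
      then show "emeasure D X = emeasure (distr (m A) borel e) X"
        using Gm[OF A, of s] unfolding X by (simp add: D E)
    next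
      fix i :: nat
      show "emeasure D {..<real i} \<noteq> \<infinity>" by (simp add: D Z.P.emeasure_eq_measure)
      show "range (\<lambda>n. {..<real n}) \<subseteq> range lessThan" by auto
      show "(\<Union>n. {..<real n}) = UNIV" by (auto intro: reals_Archimedean2)
      show "Int_stable (range (lessThan :: real \<Rightarrow> _))"
      proof (clarsimp simp: Int_stable_def)
        fix a b :: real
        have "{..<a} \<inter> {..<b} = {..<min a b}" by auto
        then show "{..<a} \<inter> {..<b} \<in> range lessThan" by simp
      qed
      have "sets (borel :: real measure) = sigma_sets UNIV (range lessThan)"
        by (subst borel_Iio) (simp add: sets_measure_of)
      then show "sets D = sigma_sets UNIV (range lessThan)"
        "sets (distr (m A) borel e) = sigma_sets UNIV (range lessThan)" by (simp_all add: D_def)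
    qed auto
    then show ?thesis using D[OF B] E[OF B] by simp
  qed

  \<comment> \<open>The joint law of a point and its decoded quantile\<close>
  define L' where "L' = distr ?Z (M1 \<Otimes>\<^sub>M M2) (\<lambda>z. (fst z, r (G z)))"
  have mL[measurable]: "(\<lambda>z. (fst z, r (G z))) \<in> ?Z \<rightarrow>\<^sub>M M1 \<Otimes>\<^sub>M M2"
    by measurable
  show thesis
  proof (rule that)
    show "sets L' = sets (M1 \<Otimes>\<^sub>M M2)" by (simp add: L'_def)
    show "prob_space L'" unfolding L'_def by (rule Z.P.prob_space_distr) measurable
    fix A B assume A: "A \<in> \<A>" and B: "B \<in> \<B>"
    have [measurable]: "A \<in> sets M1" "B \<in> sets M2" using A B by simp_all
    have rB: "r -` B \<in> sets borel" using measurable_sets[OF r, of B] by simp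
    have "emeasure L' (A \<times> B) = emeasure ?Z ((\<lambda>z. (fst z, r (G z))) -` (A \<times> B) \<inter> space ?Z)"
      unfolding L'_def by (subst emeasure_distr[OF mL]) auto
    also have "(\<lambda>z. (fst z, r (G z))) -` (A \<times> B) \<inter> space ?Z = {z \<in> A \<times> {0..1}. G z \<in> r -` B}"
      using sets.sets_into_space[OF subA[OF A]] by (auto simp: space_pair_measure spU)
    also have "emeasure ?Z \<dots> = emeasure (m A) (e -` (r -` B) \<inter> space M2)"
      by (rule main[OF A rB])
    also have "e -` (r -` B) \<inter> space M2 = B"
      using re sets.sets_into_space[OF subB[OF B]] by auto
    also have "emeasure (m A) B = ennreal (q A B)" using m A B by simp
    finally show "measure L' (A \<times> B) = q A B" using q0[OF A B] by (simp add: measure_def)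
  qed
qed

section \<open>Joinings\<close>

text \<open>Terms for the closure of the rational half-lines under complement, union and preimage.
  The terms are countable, and induction over them gives measurability of the sets they
  denote.\<close>

datatype set_code = Half rat | Compl set_code | Join set_code set_code | Preim set_code

instance set_code :: countable
  by countable_datatype

primrec decode_set :: "'a measure \<Rightarrow> ('a \<Rightarrow> 'a) \<Rightarrow> ('a \<Rightarrow> real) \<Rightarrow> set_code \<Rightarrow> 'a set" where
  "decode_set M T e (Half t) = {x \<in> space M. e x < real_of_rat t}"
| "decode_set M T e (Compl c) = space M - decode_set M T e c"
| "decode_set M T e (Join c d) = decode_set M T e c \<union> decode_set M T e d"
| "decode_set M T e (Preim c) = T -` decode_set M T e c \<inter> space M"

text \<open>The Borel left inverse makes the half-lines generate: each measurable set is the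
  preimage under \<open>e\<close> of a Borel set of reals. Closure under preimages allows invariance
  to be stated inside the countable algebra.\<close>

lemma countable_invariant_algebra:
  fixes e :: "'a \<Rightarrow> real"
  assumes T[measurable]: "T \<in> measurable M M" and e[measurable]: "e \<in> borel_measurable M"
    and r: "r \<in> measurable borel M" and re: "\<And>x. x \<in> space M \<Longrightarrow> r (e x) = x"
  obtains \<A> where "countable \<A>" "algebra (space M) \<A>" "sets M = sigma_sets (space M) \<A>"
    "\<And>A. A \<in> \<A> \<Longrightarrow> T -` A \<inter> space M \<in> \<A>" "\<And>t. t \<in> \<rat> \<Longrightarrow> {x \<in> space M. e x < t} \<in> \<A>"
proof
  let ?\<A> = "range (decode_set M T e)"
  have sub: "decode_set M T e c \<in> sets M" for c by (induction c) auto
  have sp: "decode_set M T e c \<subseteq> space M" for c using sets.sets_into_space[OF sub] .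
  have un: "A \<union> B \<in> ?\<A>" if "A \<in> ?\<A>" "B \<in> ?\<A>" for A B
  proof -
    from that obtain c d where "A = decode_set M T e c" "B = decode_set M T e d" by auto
    then have "A \<union> B = decode_set M T e (Join c d)" by simp
    then show ?thesis by blast
  qed
  have co: "space M - A \<in> ?\<A>" if "A \<in> ?\<A>" for A
  proof -
    from that obtain c where "A = decode_set M T e c" by auto
    then have "space M - A = decode_set M T e (Compl c)" by simp
    then show ?thesis by blast
  qed
  have em: "{} \<in> ?\<A>"
  proof -
    let ?c = "Compl (Join (Half 0) (Compl (Half 0)))"
    have "decode_set M T e ?c = {}" by auto
    then show ?thesis by (metis rangeI)
  qed
  show half: "{x \<in> space M. e x < t} \<in> ?\<A>" if "t \<in> \<rat>" for t
  proof -
    from that obtain q where "t = real_of_rat q" by (auto elim: Rats_cases)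
    then have "{x \<in> space M. e x < t} = decode_set M T e (Half q)" by simp
    then show ?thesis by blast
  qed
  show "countable ?\<A>" by simp
  show "algebra (space M) ?\<A>"
    unfolding algebra_iff_Un using sp em co un by blast
  show "T -` A \<inter> space M \<in> ?\<A>" if "A \<in> ?\<A>" for A
  proof -
    from that obtain c where "A = decode_set M T e c" by auto
    then have "T -` A \<inter> space M = decode_set M T e (Preim c)" by simp
    then show ?thesis by blast
  qed
  show "sets M = sigma_sets (space M) ?\<A>"
  proof
    show "sigma_sets (space M) ?\<A> \<subseteq> sets M"
      by (rule sets.sigma_sets_subset) (use sub in auto)
    let ?S = "sigma (space M) ?\<A>"
    have S: "space ?S = space M" "sets ?S = sigma_sets (space M) ?\<A>"
      by (rule space_measure_of, use sp in blast, rule sets_measure_of, use sp in blast)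
    have "{x \<in> space ?S. e x < t} \<in> sets ?S" for t :: real
    proof -
      have "{x \<in> space ?S. e x < t} = (\<Union>q\<in>{q. real_of_rat q < t}. {x \<in> space M. e x < real_of_rat q})"
      proof (rule set_eqI)
        fix x
        show "x \<in> {x \<in> space ?S. e x < t} \<longleftrightarrow> x \<in> (\<Union>q\<in>{q. real_of_rat q < t}. {x \<in> space M. e x < real_of_rat q})"
          using of_rat_dense[of "e x" t] S(1) by (auto intro: less_trans)
      qed
      also have "\<dots> \<in> sets ?S"
        by (intro sets.countable_UN'' countableI_type) (use half in \<open>auto simp: S\<close>)
      finally show ?thesis .
    qed
    then have eS: "e \<in> borel_measurable ?S"
      by (subst borel_measurable_iff_less) auto
    show "sets M \<subseteq> sigma_sets (space M) ?\<A>"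
    proof
      fix B assume B: "B \<in> sets M"
      have "e -` (r -` B \<inter> space borel) \<inter> space ?S \<in> sets ?S"
        using measurable_sets[OF eS measurable_sets[OF r B]] .
      also have "e -` (r -` B \<inter> space borel) \<inter> space ?S = B"
        using re sets.sets_into_space[OF B] S(1) by auto
      finally show "B \<in> sigma_sets (space M) ?\<A>" by (simp add: S)
    qed
  qed
qed

lemma Int_stable_rectangles:
  assumes "Int_stable \<A>" "Int_stable \<B>"
  shows "Int_stable {A \<times> B |A B. A \<in> \<A> \<and> B \<in> \<B>}"
proof (rule Int_stableI)
  fix X Y assume "X \<in> {A \<times> B |A B. A \<in> \<A> \<and> B \<in> \<B>}" "Y \<in> {A \<times> B |A B. A \<in> \<A> \<and> B \<in> \<B>}"
  then obtain A B A' B' where XY: "X = A \<times> B" "Y = A' \<times> B'" "A \<in> \<A>" "A' \<in> \<A>" "B \<in> \<B>" "B' \<in> \<B>" by blast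
  then have "X \<inter> Y = (A \<inter> A') \<times> (B \<inter> B')" "A \<inter> A' \<in> \<A>" "B \<inter> B' \<in> \<B>"
    using assms unfolding Int_stable_def by auto
  then show "X \<inter> Y \<in> {A \<times> B |A B. A \<in> \<A> \<and> B \<in> \<B>}" by blast
qed

lemma pair_measure_eqI_generators:
  assumes E1: "Int_stable \<A>" "\<A> \<subseteq> Pow (space M1)" "space M1 \<in> \<A>" "sets M1 = sigma_sets (space M1) \<A>"
    and E2: "Int_stable \<B>" "\<B> \<subseteq> Pow (space M2)" "space M2 \<in> \<B>" "sets M2 = sigma_sets (space M2) \<B>"
    and L: "sets L = sets (M1 \<Otimes>\<^sub>M M2)" "sets L' = sets (M1 \<Otimes>\<^sub>M M2)" and fin: "finite_measure L" "finite_measure L'"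
    and eq: "\<And>A B. A \<in> \<A> \<Longrightarrow> B \<in> \<B> \<Longrightarrow> measure L (A \<times> B) = measure L' (A \<times> B)"
  shows "L = L'"
proof -
  interpret L: finite_measure L by fact
  interpret L': finite_measure L' by fact
  let ?E = "{A \<times> B |A B. A \<in> \<A> \<and> B \<in> \<B>}"
  have pw: "?E \<subseteq> Pow (space M1 \<times> space M2)" using E1 E2 by auto
  have "sets (M1 \<Otimes>\<^sub>M M2) = sets (sigma (space M1 \<times> space M2) ?E)"
    by (rule sets_pair_eq[where Ca = "{space M1}" and Cb = "{space M2}"]) (use E1 E2 in auto)
  also have "\<dots> = sigma_sets (space M1 \<times> space M2) ?E"
    using pw by (simp add: sets_measure_of)
  finally have gen: "sets (M1 \<Otimes>\<^sub>M M2) = sigma_sets (space M1 \<times> space M2) ?E" .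
  show ?thesis
  proof (rule measure_eqI_generator_eq[of ?E "space M1 \<times> space M2" _ _ "\<lambda>_. space M1 \<times> space M2"])
    show "Int_stable ?E" by (rule Int_stable_rectangles[OF E1(1) E2(1)])
    fix X assume "X \<in> ?E"
    then show "emeasure L X = emeasure L' X"
      using eq by (auto simp: L.emeasure_eq_measure L'.emeasure_eq_measure)
  qed (use pw gen L E1 E2 in auto)
qed

lemma pair_measure_eqI_algebras:
  assumes "algebra (space M1) \<A>" "sets M1 = sigma_sets (space M1) \<A>"
    and "algebra (space M2) \<B>" "sets M2 = sigma_sets (space M2) \<B>"
    and "sets L = sets (M1 \<Otimes>\<^sub>M M2)" "sets L' = sets (M1 \<Otimes>\<^sub>M M2)" "finite_measure L" "finite_measure L'"
    and "\<And>A B. A \<in> \<A> \<Longrightarrow> B \<in> \<B> \<Longrightarrow> measure L (A \<times> B) = measure L' (A \<times> B)"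
  shows "L = L'"
  by (rule pair_measure_eqI_generators[OF algebra_generator[OF assms(1)] assms(2) algebra_generator[OF assms(3)] assms(4-9)])

lemma joiningsI:
  assumes "sets L = sets (M \<Otimes>\<^sub>M N)" "prob_space L"
    and T[measurable]: "T \<in> measurable M M" and S[measurable]: "S \<in> measurable N N"
    and alg1: "algebra (space M) \<A>" and gen1: "sets M = sigma_sets (space M) \<A>"
    and alg2: "algebra (space N) \<B>" and gen2: "sets N = sigma_sets (space N) \<B>"
    and pM: "prob_space M" and pN: "prob_space N"
    and inv: "\<And>A B. A \<in> \<A> \<Longrightarrow> B \<in> \<B> \<Longrightarrow> measure L ((T -` A \<inter> space M) \<times> (S -` B \<inter> space N)) = measure L (A \<times> B)"
    and margl: "\<And>A. A \<in> \<A> \<Longrightarrow> measure L (A \<times> space N) = measure M A"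
    and margr: "\<And>B. B \<in> \<B> \<Longrightarrow> measure L (space M \<times> B) = measure N B"
  shows "L \<in> joinings M T N S"
proof -
  interpret L: prob_space L by fact
  interpret M: prob_space M by fact
  interpret N: prob_space N by fact
  interpret A1: algebra "space M" \<A> by fact
  interpret A2: algebra "space N" \<B> by fact
  have spL: "space L = space M \<times> space N" using sets_eq_imp_space_eq[OF assms(1)] by (simp add: space_pair_measure)
  have subA: "A \<in> sets M" if "A \<in> \<A>" for A using that gen1 by auto
  have subB: "B \<in> sets N" if "B \<in> \<B>" for B using that gen2 by auto
  have meas_cong': "measurable L L = measurable (M \<Otimes>\<^sub>M N) (M \<Otimes>\<^sub>M N)"
    by (rule measurable_cong_sets[OF assms(1) assms(1)])
  have TS: "map_prod T S \<in> measurable L L"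
    unfolding meas_cong' map_prod_def by measurable
  have f: "fst \<in> measurable L M" and s: "snd \<in> measurable L N"
    unfolding measurable_cong_sets[OF assms(1) refl] by simp_all
  have "distr L L (map_prod T S) = L"
  proof (rule pair_measure_eqI_algebras[OF alg1 gen1 alg2 gen2])
    show "finite_measure (distr L L (map_prod T S))"
      by (rule L.finite_measure_distr[OF TS])
    fix A B assume AB: "A \<in> \<A>" "B \<in> \<B>"
    have "A \<times> B \<in> sets L" using AB subA subB assms(1) by simp
    then have "measure (distr L L (map_prod T S)) (A \<times> B) = measure L (map_prod T S -` (A \<times> B) \<inter> space L)"
      using TS by (simp add: measure_distr)
    also have "map_prod T S -` (A \<times> B) \<inter> space L = (T -` A \<inter> space M) \<times> (S -` B \<inter> space N)"
      by (auto simp: spL)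
    finally show "measure (distr L L (map_prod T S)) (A \<times> B) = measure L (A \<times> B)" using inv[OF AB] by simp
  qed (use assms(1) L.finite_measure_axioms in auto)
  moreover have "distr L M fst = M"
  proof (rule measure_eqI_generator_eq[of \<A> "space M" _ _ "\<lambda>_. space M"])
    show "Int_stable \<A>" "\<A> \<subseteq> Pow (space M)" using algebra_generator[OF alg1] by auto
    fix X assume X: "X \<in> \<A>"
    have "fst -` X \<inter> space L = X \<times> space N" using sets.sets_into_space[OF subA[OF X]] by (auto simp: spL)
    then show "emeasure (distr L M fst) X = emeasure M X"
      using X subA margl f by (simp add: emeasure_distr L.emeasure_eq_measure M.emeasure_eq_measure)
  next
    show "emeasure (distr L M fst) (space M) \<noteq> \<infinity>"
      using f by (simp add: emeasure_distr)
  qed (use gen1 in auto)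
  moreover have "distr L N snd = N"
  proof (rule measure_eqI_generator_eq[of \<B> "space N" _ _ "\<lambda>_. space N"])
    show "Int_stable \<B>" "\<B> \<subseteq> Pow (space N)" using algebra_generator[OF alg2] by auto
    fix X assume X: "X \<in> \<B>"
    have "snd -` X \<inter> space L = space M \<times> X" using sets.sets_into_space[OF subB[OF X]] by (auto simp: spL)
    then show "emeasure (distr L N snd) X = emeasure N X"
      using X subB margr s by (simp add: emeasure_distr L.emeasure_eq_measure N.emeasure_eq_measure)
  next
    show "emeasure (distr L N snd) (space N) \<noteq> \<infinity>"
      using s by (simp add: emeasure_distr)
  qed (use gen2 in auto)
  ultimately show ?thesis using assms(1,2) unfolding joinings_def by simp
qed

lemma joiningsD:
  assumes "L \<in> joinings M T N S"
  shows "sets L = sets (M \<Otimes>\<^sub>M N)" "prob_space L" "space L = space M \<times> space N"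
    "\<And>A. A \<in> sets M \<Longrightarrow> measure L (A \<times> space N) = measure M A"
    "\<And>B. B \<in> sets N \<Longrightarrow> measure L (space M \<times> B) = measure N B"
    "\<And>A B. T \<in> measurable M M \<Longrightarrow> S \<in> measurable N N \<Longrightarrow> A \<in> sets M \<Longrightarrow> B \<in> sets N \<Longrightarrow>
      measure L ((T -` A \<inter> space M) \<times> (S -` B \<inter> space N)) = measure L (A \<times> B)"
proof -
  show sL: "sets L = sets (M \<Otimes>\<^sub>M N)" and "prob_space L" using assms unfolding joinings_def by auto
  show spL: "space L = space M \<times> space N" using sets_eq_imp_space_eq[OF sL] by (simp add: space_pair_measure)
  have f: "fst \<in> measurable L M" and s: "snd \<in> measurable L N"
    unfolding measurable_cong_sets[OF sL refl] by simp_all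
  have d: "distr L L (map_prod T S) = L" "distr L M fst = M" "distr L N snd = N"
    using assms unfolding joinings_def by auto
  show "measure L (A \<times> space N) = measure M A" if "A \<in> sets M" for A
  proof -
    have "measure M A = measure (distr L M fst) A" using d by simp
    also have "\<dots> = measure L (fst -` A \<inter> space L)" using that f by (simp add: measure_distr)
    also have "fst -` A \<inter> space L = A \<times> space N" using sets.sets_into_space[OF that] by (auto simp: spL)
    finally show ?thesis by simp
  qed
  show "measure L (space M \<times> B) = measure N B" if "B \<in> sets N" for B
  proof -
    have "measure N B = measure (distr L N snd) B" using d by simp
    also have "\<dots> = measure L (snd -` B \<inter> space L)" using that s by (simp add: measure_distr)
    also have "snd -` B \<inter> space L = space M \<times> B" using sets.sets_into_space[OF that] by (auto simp: spL)
    finally show ?thesis by simp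
  qed
  show "measure L ((T -` A \<inter> space M) \<times> (S -` B \<inter> space N)) = measure L (A \<times> B)"
    if [measurable]: "T \<in> measurable M M" "S \<in> measurable N N" "A \<in> sets M" "B \<in> sets N" for A B
  proof -
    have TS: "map_prod T S \<in> measurable L L"
      unfolding measurable_cong_sets[OF sL sL] map_prod_def by measurable
    have AB: "A \<times> B \<in> sets L" by (simp add: sL)
    have "measure L (A \<times> B) = measure (distr L L (map_prod T S)) (A \<times> B)" using d by simp
    also have "\<dots> = measure L (map_prod T S -` (A \<times> B) \<inter> space L)" by (rule measure_distr[OF TS AB])
    also have "map_prod T S -` (A \<times> B) \<inter> space L = (T -` A \<inter> space M) \<times> (S -` B \<inter> space N)"
      by (auto simp: spL)
    finally show ?thesis by simp
  qed
qed

lemma sets_algebra: "algebra (space M) (sets M)" "sets M = sigma_sets (space M) (sets M)"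
  by (auto simp: sets.algebra_axioms sets.sigma_sets_eq)

lemma product_joining:
  assumes "pmp_system M T" "pmp_system N S"
  shows "M \<Otimes>\<^sub>M N \<in> joinings M T N S"
proof -
  have pM: "prob_space M" and T: "T \<in> measurable M M" and dT: "distr M M T = M"
    and pN: "prob_space N" and S: "S \<in> measurable N N" and dS: "distr N N S = N"
    using assms unfolding pmp_system_def by auto
  interpret M: prob_space M by fact
  interpret N: prob_space N by fact
  interpret MN: pair_prob_space M N ..
  have mt: "measure (M \<Otimes>\<^sub>M N) (A \<times> B) = measure M A * measure N B" if "A \<in> sets M" "B \<in> sets N" for A B
    using N.emeasure_pair_measure_Times[OF that] by (simp add: measure_def enn2real_mult)
  have mT: "measure M (T -` A \<inter> space M) = measure M A" if "A \<in> sets M" for A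
    using measure_distr[OF T that] dT by simp
  have mS: "measure N (S -` A \<inter> space N) = measure N A" if "A \<in> sets N" for A
    using measure_distr[OF S that] dS by simp
  show ?thesis
    by (rule joiningsI[OF refl MN.prob_space_axioms T S sets_algebra sets_algebra pM pN])
       (use T S in \<open>auto simp: mt mT mS M.prob_space N.prob_space\<close>)
qed

text \<open>Rectangles determine a joining and the product is always one, so disjointness is
  independence of the two coordinates under every joining.\<close>

lemma disjoint_systems_iff:
  assumes "pmp_system M T" "pmp_system N S"
  shows "disjoint_systems M T N S \<longleftrightarrow>
    (\<forall>L \<in> joinings M T N S. \<forall>A\<in>sets M. \<forall>B\<in>sets N. measure L (A \<times> B) = measure M A * measure N B)"
proof -
  interpret M: prob_space M using assms unfolding pmp_system_def by auto
  interpret N: prob_space N using assms unfolding pmp_system_def by auto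
  interpret MN: pair_prob_space M N ..
  have mt: "measure (M \<Otimes>\<^sub>M N) (A \<times> B) = measure M A * measure N B" if "A \<in> sets M" "B \<in> sets N" for A B
    using N.emeasure_pair_measure_Times[OF that] by (simp add: measure_def enn2real_mult)
  have "L = M \<Otimes>\<^sub>M N" if L: "L \<in> joinings M T N S"
    "\<And>A B. A\<in>sets M \<Longrightarrow> B\<in>sets N \<Longrightarrow> measure L (A \<times> B) = measure M A * measure N B" for L
  proof (rule pair_measure_eqI_algebras[OF sets_algebra sets_algebra joiningsD(1)[OF L(1)] refl])
    show "finite_measure L" using joiningsD(2)[OF L(1)] by (simp add: prob_space_def)
  qed (use L(2) mt MN.P.finite_measure_axioms in auto)
  then have *: "\<forall>L \<in> joinings M T N S. \<forall>A\<in>sets M. \<forall>B\<in>sets N. measure L (A \<times> B) = measure M A * measure N B \<Longrightarrow>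
      joinings M T N S \<subseteq> {M \<Otimes>\<^sub>M N}" by blast
  show ?thesis
    unfolding disjoint_systems_def
  proof (intro iffI ballI)
    fix L A B assume "joinings M T N S = {M \<Otimes>\<^sub>M N}" "L \<in> joinings M T N S" "A \<in> sets M" "B \<in> sets N"
    then show "measure L (A \<times> B) = measure M A * measure N B" using mt[of A B] by simp
  qed (use * product_joining[OF assms] in auto)
qed

text \<open>The passage from set functions to joinings for both directions. Since the algebras
  generate and are closed under preimages, invariance and marginals of \<open>q\<close> are
  inherited by the extended measure.\<close>

lemma joining_extension:
  fixes q :: "'a set \<Rightarrow> 'b set \<Rightarrow> real"
  assumes pM: "prob_space M" and T: "T \<in> measurable M M"
    and alg1: "algebra (space M) \<A>" and gen1: "sets M = sigma_sets (space M) \<A>"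
    and pN: "prob_space N" and S: "S \<in> measurable N N"
    and alg2: "algebra (space N) \<B>" and gen2: "sets N = sigma_sets (space N) \<B>"
    and er: "e \<in> borel_measurable N" "\<And>x. e x \<in> {0..1::real}" "r \<in> measurable borel N"
      "\<And>x. x \<in> space N \<Longrightarrow> r (e x) = x"
      "\<And>t. t \<in> \<rat> \<Longrightarrow> {x \<in> space N. e x < t} \<in> \<B>"
    and TA: "\<And>A. A \<in> \<A> \<Longrightarrow> T -` A \<inter> space M \<in> \<A>" and SB: "\<And>B. B \<in> \<B> \<Longrightarrow> S -` B \<inter> space N \<in> \<B>"
    and q: "\<And>A B. A \<in> \<A> \<Longrightarrow> B \<in> \<B> \<Longrightarrow> 0 \<le> q A B"
      "\<And>A A' B. A \<in> \<A> \<Longrightarrow> A' \<in> \<A> \<Longrightarrow> B \<in> \<B> \<Longrightarrow> A \<inter> A' = {} \<Longrightarrow> q (A \<union> A') B = q A B + q A' B"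
      "\<And>A B B'. A \<in> \<A> \<Longrightarrow> B \<in> \<B> \<Longrightarrow> B' \<in> \<B> \<Longrightarrow> B \<inter> B' = {} \<Longrightarrow> q A (B \<union> B') = q A B + q A B'"
      "\<And>A. A \<in> \<A> \<Longrightarrow> q A (space N) = measure M A"
      "\<And>B. B \<in> \<B> \<Longrightarrow> q (space M) B = measure N B"
    and inv: "\<And>A B. A \<in> \<A> \<Longrightarrow> B \<in> \<B> \<Longrightarrow> q (T -` A \<inter> space M) (S -` B \<inter> space N) = q A B"
  obtains L where "L \<in> joinings M T N S" "\<And>A B. A \<in> \<A> \<Longrightarrow> B \<in> \<B> \<Longrightarrow> measure L (A \<times> B) = q A B"
proof -
  obtain L where L: "sets L = sets (M \<Otimes>\<^sub>M N)" "prob_space L"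
    "\<And>A B. A \<in> \<A> \<Longrightarrow> B \<in> \<B> \<Longrightarrow> measure L (A \<times> B) = q A B"
    using joint_extension[OF pM alg1 gen1 pN alg2 gen2 er q] by blast
  have "L \<in> joinings M T N S"
    by (rule joiningsI[OF L(1,2) T S alg1 gen1 alg2 gen2 pM pN])
      (use L(3) TA SB inv q(4,5) algebra_generator(3)[OF alg1] algebra_generator(3)[OF alg2] in auto)
  then show thesis using that L(3) by blast
qed

section \<open>Disjointness from ergodic systems\<close>

text \<open>\<open>Q\<close> is the self-joining of \<open>M\<close> that is relatively independent over the natural extension of
  \<open>N\<close>. As \<open>S\<close> need not be invertible, it is obtained as a limit: the norm of the conditional
  expectation of \<open>f \<circ> T ^^ n\<close> on \<open>N\<close> increases with \<open>n\<close>.\<close>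

lemma abs_mult_bound: "\<bar>x * y\<bar> \<le> c * d" if "\<bar>x\<bar> \<le> c" "\<bar>y\<bar> \<le> d" for x y c d :: real
  unfolding abs_mult using that by (intro mult_mono) (auto intro: order_trans[OF abs_ge_zero])

lemma relative_self_joining:
  assumes pM: "pmp_system M T" and pN: "pmp_system N S" and J: "K \<in> joinings M T N S"
  obtains Q :: "'a set \<Rightarrow> 'a set \<Rightarrow> real" where
    "\<And>A B. A \<in> sets M \<Longrightarrow> B \<in> sets M \<Longrightarrow> 0 \<le> Q A B"
    "\<And>A A' B. A \<in> sets M \<Longrightarrow> A' \<in> sets M \<Longrightarrow> B \<in> sets M \<Longrightarrow> A \<inter> A' = {} \<Longrightarrow> Q (A \<union> A') B = Q A B + Q A' B"
    "\<And>A B. A \<in> sets M \<Longrightarrow> B \<in> sets M \<Longrightarrow> Q A B = Q B A"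
    "\<And>A B. A \<in> sets M \<Longrightarrow> B \<in> sets M \<Longrightarrow> Q (T -` A \<inter> space M) (T -` B \<inter> space M) = Q A B"
    "\<And>A C. A \<in> sets M \<Longrightarrow> C \<in> sets M \<Longrightarrow> T -` C \<inter> space M = C \<Longrightarrow>
       (\<And>B. B \<in> sets N \<Longrightarrow> measure K (C \<times> B) = measure M C * measure N B) \<Longrightarrow>
       Q A C = measure M A * measure M C"
    "\<And>A B. A \<in> sets M \<Longrightarrow> B \<in> sets N \<Longrightarrow> Q A A \<le> (measure M A)\<^sup>2 \<Longrightarrow>
       measure K (A \<times> B) = measure M A * measure N B"
proof -
  have "prob_space M" and T[measurable]: "T \<in> measurable M M" and "prob_space N" and S[measurable]: "S \<in> measurable N N"
    using pM pN unfolding pmp_system_def by auto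
  interpret M: prob_space M by fact
  interpret N: prob_space N by fact
  note JD = joiningsD[OF J]
  interpret L: prob_space K by (rule JD(2))
  have sl[measurable_cong]: "sets K = sets (M \<Otimes>\<^sub>M N)" by (rule JD(1))
  have spl: "space K = space M \<times> space N" by (rule JD(3))
  define \<tau> where "\<tau> = map_prod T S"
  have \<tau>[measurable]: "\<tau> \<in> measurable K K" unfolding \<tau>_def map_prod_def by measurable
  have d\<tau>: "distr K K \<tau> = K" using J unfolding joinings_def \<tau>_def by simp

  \<comment> \<open>Conditional expectation on the second factor\<close>
  define F where "F = vimage_algebra (space K) snd N"
  have sF: "space F = space K" unfolding F_def by simp
  have setsF: "sets F = {snd -` B \<inter> space K | B. B \<in> sets N}"
    unfolding F_def by (rule sets_vimage_algebra2) (auto simp: spl)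
  have sub: "subalgebra K F"
    unfolding subalgebra_def
  proof safe
    fix A assume "A \<in> sets F"
    then obtain B where "A = snd -` B \<inter> space K" "B \<in> sets N" using setsF by auto
    then show "A \<in> sets K" by simp
  qed (simp_all add: sF)
  interpret F: finite_measure_subalgebra K F by standard (rule sub)
  \<comment> \<open>This makes \<open>E f\<close> composed with \<open>\<tau>\<close> again a
    function of the second coordinate.\<close>
  have \<tau>F[measurable]: "\<tau> \<in> measurable F F"
    unfolding F_def
  proof (rule measurable_vimage_algebra2)
    show "\<tau> \<in> space (vimage_algebra (space K) snd N) \<rightarrow> space K"
      using measurable_space[OF \<tau>] by auto
    have "(\<lambda>x. S (snd x)) \<in> vimage_algebra (space K) snd N \<rightarrow>\<^sub>M N"
      by (rule measurable_compose[OF measurable_vimage_algebra1 S]) (auto simp: spl)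
    then show "(\<lambda>x. snd (\<tau> x)) \<in> vimage_algebra (space K) snd N \<rightarrow>\<^sub>M N"
      by (simp add: \<tau>_def)
  qed
  define bm where "bm f \<longleftrightarrow> f \<in> borel_measurable M \<and> (\<exists>c. \<forall>x. \<bar>f x\<bar> \<le> c)" for f :: "'a \<Rightarrow> real"
  define E where "E f = real_cond_exp K F (\<lambda>z. f (fst z))" for f :: "'a \<Rightarrow> real"
  have EF[measurable]: "E f \<in> borel_measurable F" and EL[measurable]: "E f \<in> borel_measurable K" for f
    unfolding E_def by auto
  have bm_meas: "f \<in> borel_measurable M" if "bm f" for f using that unfolding bm_def by simp
  have bmI: "bm f" if "f \<in> borel_measurable M" "\<And>x. \<bar>f x\<bar> \<le> c" for f c using that unfolding bm_def by blast
  have bm_ind: "bm (indicator A)" if "A \<in> sets M" for A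
    by (rule bmI[of _ 1]) (use that in \<open>auto simp: indicator_def\<close>)
  have bm_add: "bm (\<lambda>x. f x + g x)" and bm_diff: "bm (\<lambda>x. f x - g x)" if "bm f" "bm g" for f g
  proof -
    obtain c d where c: "\<And>x. \<bar>f x\<bar> \<le> c" and d: "\<And>x. \<bar>g x\<bar> \<le> d" using \<open>bm f\<close> \<open>bm g\<close> unfolding bm_def by blast
    have b: "\<bar>f x + g x\<bar> \<le> c + d" "\<bar>f x - g x\<bar> \<le> c + d" for x using c[of x] d[of x] by auto
    have [measurable]: "f \<in> borel_measurable M" "g \<in> borel_measurable M"
      by (rule bm_meas, fact)+
    show "bm (\<lambda>x. f x + g x)" by (rule bmI[OF _ b(1)]) measurable
    show "bm (\<lambda>x. f x - g x)" by (rule bmI[OF _ b(2)]) measurable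
  qed
  have bm_comp: "bm (\<lambda>x. f (g x))" if "bm f" "g \<in> measurable M M" for f g
    using that unfolding bm_def by auto
  have fm[measurable]: "(\<lambda>z. f (fst z)) \<in> borel_measurable K" if "bm f" for f
    by (rule measurable_compose[OF _ bm_meas[OF that]]) simp
  have int1: "integrable K (\<lambda>z. f (fst z))" if f: "bm f" for f
  proof -
    obtain c where "\<And>x. \<bar>f x\<bar> \<le> c" using f unfolding bm_def by blast
    then show ?thesis by (intro L.integrable_const_bound[of _ c]) (use fm[OF f] in auto)
  qed
  have Eb: "AE z in K. \<bar>E f z\<bar> \<le> c" if f: "bm f" and c: "\<And>x. \<bar>f x\<bar> \<le> c" for f c
  proof -
    have "f x \<le> c" "- c \<le> f x" for x using c[of x] by auto
    then have "AE z in K. E f z \<le> c" "AE z in K. - c \<le> E f z"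
      unfolding E_def by (auto intro!: F.real_cond_exp_le_c F.real_cond_exp_ge_c int1 f)
    then show ?thesis by eventually_elim auto
  qed
  have Eint: "integrable K (\<lambda>z. E f z * E g z)" if f: "bm f" "bm g" for f g
  proof -
    obtain c d where c: "\<And>x. \<bar>f x\<bar> \<le> c" and d: "\<And>x. \<bar>g x\<bar> \<le> d" using f unfolding bm_def by blast
    have "AE z in K. norm (E f z * E g z) \<le> c * d"
      using Eb[OF f(1) c] Eb[OF f(2) d]
      by eventually_elim (simp only: real_norm_def abs_mult_bound)
    then show ?thesis by (rule L.integrable_const_bound) simp
  qed
  have Eadd: "AE z in K. E (\<lambda>x. f x + g x) z = E f z + E g z"
    and Ediff: "AE z in K. E (\<lambda>x. f x - g x) z = E f z - E g z" if "bm f" "bm g" for f g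
    unfolding E_def using that by (auto intro!: F.real_cond_exp_add F.real_cond_exp_diff int1)
  have Eint1: "(\<integral>z. E f z \<partial>K) = (\<integral>x. f x \<partial>M)" and Eint1': "integrable K (E f)" if f: "bm f" for f
  proof -
    have "(\<integral>z. E f z \<partial>K) = (\<integral>z. f (fst z) \<partial>K)" unfolding E_def by (rule F.real_cond_exp_int(2)[OF int1[OF f]])
    also have "\<dots> = (\<integral>x. f x \<partial>distr K M fst)" using bm_meas[OF f] by (subst integral_distr) auto
    also have "distr K M fst = M" using J unfolding joinings_def by simp
    finally show "(\<integral>z. E f z \<partial>K) = (\<integral>x. f x \<partial>M)" .
    show "integrable K (E f)" unfolding E_def by (rule F.real_cond_exp_int(1)[OF int1[OF f]])
  qed
  have int\<tau>_eq: "(\<integral>z. g (\<tau> z) \<partial>K) = (\<integral>z. g z \<partial>K)" if "g \<in> borel_measurable K" for g :: "_ \<Rightarrow> real"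
    using that by (subst (2) d\<tau>[symmetric], subst integral_distr) auto

  \<comment> \<open>Norms of conditional expectations along the orbit\<close>
  define a where "a f = (\<integral>z. E f z * E f z \<partial>K)" for f
  have a_mono: "a f \<le> a (\<lambda>x. f (T x))" if f: "bm f" for f
  proof -
    obtain c where c: "\<And>x. \<bar>f x\<bar> \<le> c" using f unfolding bm_def by blast
    have fT: "bm (\<lambda>x. f (T x))" by (rule bm_comp[OF f T])
    have "AE z in distr K K \<tau>. \<bar>E f z\<bar> \<le> c" unfolding d\<tau> by (rule Eb[OF f c])
    then have ae\<tau>: "AE z in K. \<bar>E f (\<tau> z)\<bar> \<le> c" by (subst (asm) AE_distr_iff) auto
    have int\<tau>: "integrable K (\<lambda>z. E f (\<tau> z) * E f (\<tau> z))"
    proof (rule L.integrable_const_bound)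
      show "AE z in K. norm (E f (\<tau> z) * E f (\<tau> z)) \<le> c * c"
        using ae\<tau> by eventually_elim (simp only: real_norm_def abs_mult_bound)
    qed simp
    have a\<tau>: "(\<integral>z. E f (\<tau> z) * E f (\<tau> z) \<partial>K) = a f"
      unfolding a_def by (rule int\<tau>_eq) simp
    have intf: "integrable K (\<lambda>z. E f z * f (fst z))"
    proof (rule L.integrable_const_bound)
      show "AE z in K. norm (E f z * f (fst z)) \<le> c * c"
        using Eb[OF f c] by eventually_elim (simp only: real_norm_def abs_mult_bound c)
    qed (use fm[OF f] in simp)
    have int2: "integrable K (\<lambda>z. E f (\<tau> z) * f (T (fst z)))"
    proof (rule L.integrable_const_bound)
      show "AE z in K. norm (E f (\<tau> z) * f (T (fst z))) \<le> c * c"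
        using ae\<tau> by eventually_elim (simp only: real_norm_def abs_mult_bound c)
    qed (use fm[OF fT] in simp)
    \<comment> \<open>By invariance of \<open>K\<close>, \<open>a f\<close> is the inner product of
      \<open>E f\<close> composed with \<open>\<tau>\<close> and \<open>f\<close> composed with
      \<open>T\<close>. The former is measurable for \<open>F\<close>, so the latter may be replaced
      by its conditional expectation; then \<open>2 * x * y \<le> x * x + y * y\<close> gives the
      bound.\<close>
    have "a f = (\<integral>z. E f z * f (fst z) \<partial>K)"
      unfolding a_def using F.real_cond_exp_intg(2)[OF intf EF fm[OF f]] unfolding E_def by simp
    also have "\<dots> = (\<integral>z. E f (\<tau> z) * f (T (fst z)) \<partial>K)"
      using int\<tau>_eq[OF borel_measurable_times[OF EL[of f] fm[OF f]]] by (simp add: \<tau>_def)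
    also have "\<dots> = (\<integral>z. E f (\<tau> z) * E (\<lambda>x. f (T x)) z \<partial>K)"
      unfolding E_def[of "\<lambda>x. f (T x)"]
      using F.real_cond_exp_intg(2)[OF int2 measurable_compose[OF \<tau>F EF] fm[OF fT]] by simp
    also have "\<dots> \<le> (\<integral>z. (E f (\<tau> z) * E f (\<tau> z) + E (\<lambda>x. f (T x)) z * E (\<lambda>x. f (T x)) z) / 2 \<partial>K)"
    proof (rule integral_mono)
      show "integrable K (\<lambda>z. E f (\<tau> z) * E (\<lambda>x. f (T x)) z)"
        unfolding E_def[of "\<lambda>x. f (T x)"]
        using F.real_cond_exp_intg(1)[OF int2 measurable_compose[OF \<tau>F EF] fm[OF fT]] by simp
      show "integrable K (\<lambda>z. (E f (\<tau> z) * E f (\<tau> z) + E (\<lambda>x. f (T x)) z * E (\<lambda>x. f (T x)) z) / 2)"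
        using int\<tau> Eint[OF fT fT] by simp
      fix z
      show "E f (\<tau> z) * E (\<lambda>x. f (T x)) z \<le> (E f (\<tau> z) * E f (\<tau> z) + E (\<lambda>x. f (T x)) z * E (\<lambda>x. f (T x)) z) / 2"
        using sum_squares_bound[of "E f (\<tau> z)" "E (\<lambda>x. f (T x)) z"] by (simp add: power2_eq_square)
    qed
    also have "\<dots> = (a f + a (\<lambda>x. f (T x))) / 2"
      using int\<tau> Eint[OF fT fT] by (simp add: a\<tau>) (simp add: a_def)
    finally show ?thesis by simp
  qed
  have Tn[measurable]: "(T ^^ n) \<in> measurable M M" for n by (induction n) auto
  have Tn': "(\<lambda>x. (T ^^ n) x) \<in> measurable M M" for n by (rule Tn)
  have a_conv: "convergent (\<lambda>n. a (\<lambda>x. f ((T ^^ n) x)))" if f: "bm f" for f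
  proof -
    obtain c where c: "\<And>x. \<bar>f x\<bar> \<le> c" using f unfolding bm_def by blast
    have "incseq (\<lambda>n. a (\<lambda>x. f ((T ^^ n) x)))"
    proof (rule incseq_SucI)
      fix n show "a (\<lambda>x. f ((T ^^ n) x)) \<le> a (\<lambda>x. f ((T ^^ Suc n) x))"
        using a_mono[OF bm_comp[OF f Tn'[of n]]] by (simp add: funpow_swap1)
    qed
    moreover have "a (\<lambda>x. f ((T ^^ n) x)) \<le> c * c" for n
    proof -
      have b: "bm (\<lambda>x. f ((T ^^ n) x))" by (rule bm_comp[OF f Tn'])
      have "AE z in K. E (\<lambda>x. f ((T ^^ n) x)) z * E (\<lambda>x. f ((T ^^ n) x)) z \<le> c * c"
        using Eb[OF b c]
        by eventually_elim (rule order_trans[OF abs_ge_self abs_mult_bound])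
      then have "a (\<lambda>x. f ((T ^^ n) x)) \<le> (\<integral>z. c * c \<partial>K)"
        unfolding a_def by (intro integral_mono_AE Eint b) auto
      then show ?thesis by (simp add: L.prob_space)
    qed
    ultimately show ?thesis by (meson Bseq_mono_convergent incseq_convergent incseq_def convergentI)
  qed

  \<comment> \<open>The limit bimeasure\<close>
  define I where "I n A = (\<lambda>x. indicator A ((T ^^ n) x) :: real)" for n A
  have bI: "bm (I n A)" if "A \<in> sets M" for n A
    unfolding I_def by (rule bm_comp[OF bm_ind[OF that] Tn'])
  define p where "p n A B = (\<integral>z. E (I n A) z * E (I n B) z \<partial>K)" for n A B
  have p_conv: "convergent (\<lambda>n. p n A B)" if "A \<in> sets M" "B \<in> sets M" for A B
  proof -
    note AB = that
    \<comment> \<open>Polarisation reduces the convergence of inner products to that of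
      norms.\<close>
    have "p n A B = (a (\<lambda>x. (indicator A ((T ^^ n) x) + indicator B ((T ^^ n) x))) -
        a (\<lambda>x. (indicator A ((T ^^ n) x) - indicator B ((T ^^ n) x)))) / 4" for n
    proof -
      have A: "bm (I n A)" and B: "bm (I n B)" using bI that by auto
      have "a (\<lambda>x. I n A x + I n B x) - a (\<lambda>x. I n A x - I n B x) =
         (\<integral>z. E (\<lambda>x. I n A x + I n B x) z * E (\<lambda>x. I n A x + I n B x) z - E (\<lambda>x. I n A x - I n B x) z * E (\<lambda>x. I n A x - I n B x) z \<partial>K)"
        unfolding a_def using Eint[OF bm_add[OF A B] bm_add[OF A B]] Eint[OF bm_diff[OF A B] bm_diff[OF A B]] by simp
      also have "\<dots> = (\<integral>z. 4 * (E (I n A) z * E (I n B) z) \<partial>K)"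
      proof (rule integral_cong_AE)
        show "AE z in K. E (\<lambda>x. I n A x + I n B x) z * E (\<lambda>x. I n A x + I n B x) z - E (\<lambda>x. I n A x - I n B x) z * E (\<lambda>x. I n A x - I n B x) z = 4 * (E (I n A) z * E (I n B) z)"
          using Eadd[OF A B] Ediff[OF A B]
        proof eventually_elim
          case (elim z)
          show ?case unfolding elim by (simp add: algebra_simps)
        qed
      qed measurable
      finally show ?thesis unfolding p_def I_def by simp
    qed
    then have p_eq: "(\<lambda>n. p n A B) = (\<lambda>n. (a (\<lambda>x. (indicator A ((T ^^ n) x) + indicator B ((T ^^ n) x))) -
        a (\<lambda>x. (indicator A ((T ^^ n) x) - indicator B ((T ^^ n) x)))) / 4)" by (rule ext)
    obtain l1 where l1: "(\<lambda>n. a (\<lambda>x. (indicator A ((T ^^ n) x) + indicator B ((T ^^ n) x)))) \<longlonglongrightarrow> l1"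
      using a_conv[OF bm_add[OF bm_ind[OF AB(1)] bm_ind[OF AB(2)]]] unfolding convergent_def by blast
    obtain l2 where l2: "(\<lambda>n. a (\<lambda>x. (indicator A ((T ^^ n) x) - indicator B ((T ^^ n) x)))) \<longlonglongrightarrow> l2"
      using a_conv[OF bm_diff[OF bm_ind[OF AB(1)] bm_ind[OF AB(2)]]] unfolding convergent_def by blast
    have "(\<lambda>n. p n A B) \<longlonglongrightarrow> (l1 - l2) / 4"
      unfolding p_eq by (intro tendsto_intros l1 l2) simp
    then show ?thesis by (rule convergentI)
  qed
  define Q where "Q A B = lim (\<lambda>n. p n A B)" for A B
  have Q: "(\<lambda>n. p n A B) \<longlonglongrightarrow> Q A B" if "A \<in> sets M" "B \<in> sets M" for A B
    unfolding Q_def using p_conv[OF that] by (simp add: convergent_LIMSEQ_iff)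
  have E0: "AE z in K. 0 \<le> E (I n A) z" if "A \<in> sets M" for n A
    unfolding E_def by (rule F.real_cond_exp_ge_c[OF int1[OF bI[OF that]]]) (auto simp: I_def)
  show thesis
  proof (rule that[of Q])
    fix A B assume A: "A \<in> sets M" and B: "B \<in> sets M"
    have "0 \<le> p n A B" for n
      unfolding p_def by (rule integral_nonneg_AE) (use E0[OF A, of n] E0[OF B, of n] in \<open>eventually_elim, simp\<close>)
    then show "0 \<le> Q A B" using LIMSEQ_le_const[OF Q[OF A B]] by blast
    show "Q A B = Q B A" unfolding Q_def p_def by (simp add: mult.commute)
    have Ts: "T -` A \<inter> space M \<in> sets M" "T -` B \<inter> space M \<in> sets M" using A B by auto
    \<comment> \<open>Taking preimages in both arguments moves the index \<open>n\<close> by one, so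
      the limit is invariant although the single terms are not claimed to be.\<close>
    have "p n (T -` A \<inter> space M) (T -` B \<inter> space M) = p (Suc n) A B" for n
    proof -
      have *: "AE z in K. E (I n (T -` C \<inter> space M)) z = E (I (Suc n) C) z" if C: "C \<in> sets M" for C
        unfolding E_def
      proof (rule F.real_cond_exp_cong)
        show "AE z in K. I n (T -` C \<inter> space M) (fst z) = I (Suc n) C (fst z)"
        proof (rule AE_I2)
          fix z assume "z \<in> space K"
          then have "(T ^^ n) (fst z) \<in> space M" using measurable_space[OF Tn] by (auto simp: spl)
          then show "I n (T -` C \<inter> space M) (fst z) = I (Suc n) C (fst z)" by (simp add: I_def indicator_def)
        qed
      qed (use fm[OF bI[of C "Suc n"]] fm[OF bI[of "T -` C \<inter> space M" n]] C in auto)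
      have "AE z in K. E (I n (T -` A \<inter> space M)) z * E (I n (T -` B \<inter> space M)) z = E (I (Suc n) A) z * E (I (Suc n) B) z"
        using *[OF A] *[OF B] by eventually_elim simp
      then show ?thesis unfolding p_def by (intro integral_cong_AE) measurable
    qed
    then have "(\<lambda>n. p (Suc n) A B) \<longlonglongrightarrow> Q (T -` A \<inter> space M) (T -` B \<inter> space M)"
      using Q[OF Ts] by simp
    then show "Q (T -` A \<inter> space M) (T -` B \<inter> space M) = Q A B"
      using LIMSEQ_Suc[OF Q[OF A B]] LIMSEQ_unique by blast
  next
    fix A A' B assume A: "A \<in> sets M" "A' \<in> sets M" and B: "B \<in> sets M" and disj: "A \<inter> A' = {}"
    have "p n (A \<union> A') B = p n A B + p n A' B" for n
    proof -
      have eqI: "I n (A \<union> A') = (\<lambda>x. I n A x + I n A' x)"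
        unfolding I_def using disj by (intro ext) (auto split: split_indicator)
      have "AE z in K. E (I n (A \<union> A')) z * E (I n B) z = E (I n A) z * E (I n B) z + E (I n A') z * E (I n B) z"
        using Eadd[OF bI[OF A(1), of n] bI[OF A(2), of n]] unfolding eqI by eventually_elim (simp add: distrib_right)
      then have "p n (A \<union> A') B = (\<integral>z. E (I n A) z * E (I n B) z + E (I n A') z * E (I n B) z \<partial>K)"
        unfolding p_def by (intro integral_cong_AE) measurable
      then show ?thesis unfolding p_def using Eint[OF bI bI] A B by simp
    qed
    then have "(\<lambda>n. p n (A \<union> A') B) \<longlonglongrightarrow> Q A B + Q A' B"
      using tendsto_add[OF Q[OF A(1) B] Q[OF A(2) B]] by simp
    then show "Q (A \<union> A') B = Q A B + Q A' B"
      using Q[of "A \<union> A'" B] A B LIMSEQ_unique by blast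
  next
    fix A C assume A: "A \<in> sets M" and C: "C \<in> sets M" "T -` C \<inter> space M = C"
      and prod: "\<And>B. B \<in> sets N \<Longrightarrow> measure K (C \<times> B) = measure M C * measure N B"
    have Cn: "(T ^^ n) x \<in> C \<longleftrightarrow> x \<in> C" if "x \<in> space M" for n x
    proof (induction n)
      case (Suc n)
      have "(T ^^ n) x \<in> space M" using measurable_space[OF Tn that] .
      then show ?case using Suc C(2) by auto
    qed simp
    \<comment> \<open>The indicator of a strictly invariant \<open>C\<close> is constant along
      orbits, and independence from \<open>N\<close> makes its conditional expectation the constant
      \<open>measure M C\<close>.\<close>
    have EC: "AE z in K. E (I n C) z = measure M C" for n
      unfolding E_def
    proof (rule F.real_cond_exp_charact)
      fix D assume "D \<in> sets F"
      then obtain B where B: "D = snd -` B \<inter> space K" "B \<in> sets N" using setsF by auto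
      have "(\<integral>z\<in>D. I n C (fst z) \<partial>K) = (\<integral>z. indicator (C \<times> B) z \<partial>K)"
        unfolding set_lebesgue_integral_def
        by (rule Bochner_Integration.integral_cong) (use Cn B in \<open>auto simp: I_def spl indicator_def\<close>)
      also have "\<dots> = measure K (C \<times> B)" using C B by simp
      also have "\<dots> = measure M C * measure K (space M \<times> B)" using prod[OF B(2)] JD(5)[OF B(2)] by simp
      also have "space M \<times> B = D" using B sets.sets_into_space[OF B(2)] by (auto simp: spl)
      also have "measure M C * measure K D = (\<integral>z\<in>D. measure M C \<partial>K)"
        using B by (simp add: set_lebesgue_integral_def)
      finally show "(\<integral>z\<in>D. I n C (fst z) \<partial>K) = (\<integral>z\<in>D. measure M C \<partial>K)" .
    qed (use int1[OF bI[OF C(1)]] in auto)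
    have "p n A C = measure M A * measure M C" for n
    proof -
      have "p n A C = (\<integral>z. E (I n A) z * measure M C \<partial>K)"
      proof -
        have "AE z in K. E (I n A) z * E (I n C) z = E (I n A) z * measure M C"
          using EC[of n] by eventually_elim simp
        then show ?thesis unfolding p_def by (intro integral_cong_AE) measurable
      qed
      also have "\<dots> = (\<integral>x. I n A x \<partial>M) * measure M C" using Eint1[OF bI[OF A]] by simp
      also have "(\<integral>x. I n A x \<partial>M) = measure M A"
      proof (induction n)
        case 0 then show ?case using A by (simp add: I_def)
      next
        case (Suc n)
        have "(\<integral>x. I (Suc n) A x \<partial>M) = (\<integral>x. I n A (T x) \<partial>M)" by (simp add: I_def funpow_swap1)
        also have "\<dots> = (\<integral>x. I n A x \<partial>distr M M T)"
          using bm_meas[OF bI[OF A, of n]] by (subst integral_distr) auto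
        also have "distr M M T = M" using pM unfolding pmp_system_def by simp
        finally show ?case using Suc by simp
      qed
      finally show ?thesis .
    qed
    then show "Q A C = measure M A * measure M C" unfolding Q_def by simp
  next
    fix A B assume A: "A \<in> sets M" and B: "B \<in> sets N" and le: "Q A A \<le> (measure M A)\<^sup>2"
    \<comment> \<open>The norms increase to \<open>Q A A\<close>, so the hypothesis already bounds
      the term at \<open>n = 0\<close>: the conditional expectation of \<open>A\<close> has second
      moment at most the square of its mean, hence variance 0.\<close>
    have inc: "incseq (\<lambda>n. p n A A)"
    proof (rule incseq_SucI)
      fix n show "p n A A \<le> p (Suc n) A A"
        using a_mono[OF bI[OF A, of n]] by (simp add: p_def a_def I_def funpow_swap1)
    qed
    have p0: "p 0 A A \<le> (measure M A)\<^sup>2"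
      using incseq_le[OF inc Q[OF A A], of 0] le by simp
    let ?h = "E (I 0 A)"
    have I0: "(\<integral>x. I 0 A x \<partial>M) = measure M A" using A by (simp add: I_def)
    have hi: "integrable K ?h" "integrable K (\<lambda>z. ?h z * ?h z)" "(\<integral>z. ?h z \<partial>K) = measure M A"
      using Eint1'[OF bI[OF A]] Eint[OF bI[OF A] bI[OF A]] Eint1[OF bI[OF A, of 0]] I0 A by auto
    have "(\<integral>z. (?h z - measure M A)\<^sup>2 \<partial>K) = (\<integral>z. ?h z * ?h z - 2 * measure M A * ?h z + (measure M A)\<^sup>2 \<partial>K)"
      by (rule Bochner_Integration.integral_cong) (auto simp: power2_eq_square algebra_simps)
    also have "\<dots> = p 0 A A - 2 * measure M A * measure M A + (measure M A)\<^sup>2"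
      using hi by (simp add: p_def L.prob_space)
    also have "\<dots> \<le> 0" using p0 by (simp add: power2_eq_square)
    finally have "(\<integral>z. (?h z - measure M A)\<^sup>2 \<partial>K) = 0"
      by (intro antisym) (simp_all add: integral_nonneg_AE)
    moreover have "integrable K (\<lambda>z. (?h z - measure M A)\<^sup>2)"
    proof -
      have "integrable K (\<lambda>z. ?h z * ?h z - 2 * measure M A * ?h z + (measure M A)\<^sup>2)"
        using hi by simp
      then show ?thesis
        by (rule Bochner_Integration.integrable_cong[THEN iffD1, rotated 2]) (auto simp: power2_eq_square algebra_simps)
    qed
    ultimately have "AE z in K. (?h z - measure M A)\<^sup>2 = 0"
      by (subst (asm) integral_nonneg_eq_0_iff_AE) auto
    then have hc: "AE z in K. ?h z = measure M A" by eventually_elim simp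
    define D where "D = snd -` B \<inter> space K"
    have DF: "D \<in> sets F" and DL[measurable]: "D \<in> sets K" using setsF B unfolding D_def by auto
    have DD: "D = space M \<times> B" using sets.sets_into_space[OF B] by (auto simp: spl D_def)
    have "measure K (A \<times> B) = (\<integral>z. indicator (A \<times> B) z \<partial>K)" using A B by simp
    also have "\<dots> = (\<integral>z\<in>D. I 0 A (fst z) \<partial>K)"
      unfolding set_lebesgue_integral_def
      by (rule Bochner_Integration.integral_cong) (auto simp: I_def spl indicator_def D_def)
    also have "\<dots> = (\<integral>z\<in>D. ?h z \<partial>K)"
      unfolding E_def by (rule F.real_cond_exp_intA[OF int1[OF bI[OF A]] DF])
    also have "\<dots> = (\<integral>z\<in>D. measure M A \<partial>K)"
      unfolding set_lebesgue_integral_def 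
    proof (rule integral_cong_AE)
      show "AE z in K. indicator D z *\<^sub>R ?h z = indicator D z *\<^sub>R measure M A"
        using hc by eventually_elim simp
    qed measurable
    also have "\<dots> = measure M A * measure K D" by (simp add: set_lebesgue_integral_def)
    finally show "measure K (A \<times> B) = measure M A * measure N B" using JD(5)[OF B] DD by simp
  qed
qed

lemma ergodic_decompositionD:
  assumes M: "pmp_system M T" and dec: "ergodic_decomposition M T Mbar \<pi> \<mu>"
  shows "prob_space Mbar" "\<pi> \<in> measurable M Mbar" "\<And>x. x \<in> space M \<Longrightarrow> \<pi> (T x) = \<pi> x"
    "\<And>C. C \<in> sets Mbar \<Longrightarrow> measure M (\<pi> -` C \<inter> space M) = measure Mbar C"
    "\<mu> \<in> measurable Mbar (prob_algebra M)"
    "\<And>x. x \<in> space Mbar \<Longrightarrow> sets (\<mu> x) = sets M"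
    "\<And>x. x \<in> space Mbar \<Longrightarrow> space (\<mu> x) = space M"
    "\<And>x. x \<in> space Mbar \<Longrightarrow> prob_space (\<mu> x)"
    "\<And>x. x \<in> space Mbar \<Longrightarrow> pmp_system (\<mu> x) T"
    "\<And>x. x \<in> space Mbar \<Longrightarrow> ergodic_system (\<mu> x) T"
    "\<And>A. A \<in> sets M \<Longrightarrow> (\<lambda>x. measure (\<mu> x) A) \<in> borel_measurable Mbar"
    "\<And>A C. A \<in> sets M \<Longrightarrow> C \<in> sets Mbar \<Longrightarrow>
       (\<integral>x. indicator C x * measure (\<mu> x) A \<partial>Mbar) = measure M (A \<inter> \<pi> -` C)"
proof -
  show pM: "prob_space Mbar" and \<pi>[measurable]: "\<pi> \<in> measurable M Mbar"
    and "\<And>x. x \<in> space M \<Longrightarrow> \<pi> (T x) = \<pi> x" and \<mu>[measurable]: "\<mu> \<in> measurable Mbar (prob_algebra M)"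
    using dec unfolding ergodic_decomposition_def standard_prob_space_def by auto
  interpret B: prob_space Mbar by fact
  interpret M: prob_space M using M unfolding pmp_system_def by simp
  have dM: "distr M Mbar \<pi> = Mbar" and bind: "Mbar \<bind> \<mu> = M"
    and fib: "\<And>x. x \<in> space Mbar \<Longrightarrow> emeasure (\<mu> x) (\<pi> -` {x} \<inter> space M) = 1"
    using dec unfolding ergodic_decomposition_def by auto
  show "measure M (\<pi> -` C \<inter> space M) = measure Mbar C" if "C \<in> sets Mbar" for C
    using measure_distr[OF \<pi> that] dM by simp
  show sets: "sets (\<mu> x) = sets M" and pr: "prob_space (\<mu> x)" if "x \<in> space Mbar" for x
    using measurable_space[OF \<mu> that] by (auto simp: space_prob_algebra)
  show sp: "space (\<mu> x) = space M" if "x \<in> space Mbar" for x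
    using sets_eq_imp_space_eq[OF sets[OF that]] .
  show erg: "ergodic_system (\<mu> x) T" if "x \<in> space Mbar" for x
    using dec that unfolding ergodic_decomposition_def by auto
  then show "pmp_system (\<mu> x) T" if "x \<in> space Mbar" for x
    using that unfolding ergodic_system_def by simp
  show mm[measurable]: "(\<lambda>x. measure (\<mu> x) A) \<in> borel_measurable Mbar" if "A \<in> sets M" for A
    using that by measurable
  show "(\<integral>x. indicator C x * measure (\<mu> x) A \<partial>Mbar) = measure M (A \<inter> \<pi> -` C)"
    if A[measurable]: "A \<in> sets M" and C[measurable]: "C \<in> sets Mbar" for A C
  proof -
    have AC: "A \<inter> \<pi> -` C = A \<inter> (\<pi> -` C \<inter> space M)" using sets.sets_into_space[OF A] by auto
    have AC'[measurable]: "A \<inter> \<pi> -` C \<in> sets M" unfolding AC by measurable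
    have "emeasure M (A \<inter> \<pi> -` C) = emeasure (Mbar \<bind> \<mu>) (A \<inter> \<pi> -` C)" by (simp add: bind)
    also have "\<dots> = (\<integral>\<^sup>+x. emeasure (\<mu> x) (A \<inter> \<pi> -` C) \<partial>Mbar)"
      by (rule emeasure_bind[OF B.not_empty measurable_prob_algebraD[OF \<mu>] AC'])
    \<comment> \<open>The component over \<open>x\<close> is carried by the fibre over
      \<open>x\<close>, so cutting \<open>A\<close> down to the points whose component lies in
      \<open>C\<close> changes nothing if \<open>x\<close> lies in \<open>C\<close>, and leaves a
      null set otherwise.\<close>
    also have "\<dots> = (\<integral>\<^sup>+x. ennreal (indicator C x * measure (\<mu> x) A) \<partial>Mbar)"
    proof (rule nn_integral_cong)
      fix x assume x: "x \<in> space Mbar"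
      interpret X: prob_space "\<mu> x" by (rule pr[OF x])
      have fS: "\<pi> -` {x} \<inter> space M \<in> sets (\<mu> x)"
        using fib[OF x] by (metis emeasure_notin_sets zero_neq_one)
      have ae: "AE z in \<mu> x. z \<in> \<pi> -` {x} \<inter> space M"
        using fib[OF x] fS by (subst X.AE_in_set_eq_1) (auto simp: X.emeasure_eq_measure)
      show "emeasure (\<mu> x) (A \<inter> \<pi> -` C) = ennreal (indicator C x * measure (\<mu> x) A)"
      proof (cases "x \<in> C")
        case True
        have "emeasure (\<mu> x) (A \<inter> \<pi> -` C) = emeasure (\<mu> x) A"
          by (rule emeasure_eq_AE) (use ae True AC' sets[OF x] in \<open>auto elim!: eventually_mono\<close>)
        then show ?thesis using True by (simp add: X.emeasure_eq_measure)
      next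
        case False
        have "emeasure (\<mu> x) (A \<inter> \<pi> -` C) = emeasure (\<mu> x) {}"
          by (rule emeasure_eq_AE) (use ae False AC' sets[OF x] in \<open>auto elim!: eventually_mono\<close>)
        then show ?thesis using False by simp
      qed
    qed
    finally have *: "emeasure M (A \<inter> \<pi> -` C) = (\<integral>\<^sup>+x. ennreal (indicator C x * measure (\<mu> x) A) \<partial>Mbar)" .
    show ?thesis
      unfolding measure_def[of M] * by (subst integral_eq_nn_integral) auto
  qed
qed

text \<open>The self-joining \<open>L\<close> is known only globally, whereas a joining is wanted
  over almost every pair of components. For each rectangle \<open>A \<times> B\<close>, its part
  over a set of pairs is dominated by the product of the decomposition measure with itself, which
  gives a density \<open>d A B\<close>. On the countable algebra the axioms of a joining are
  countably many almost sure identities between these densities, so they hold simultaneously at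
  almost every pair.\<close>

lemma disjoint_from_ergodic:
  assumes std: "standard_prob_space M" and pM: "pmp_system M T"
    and dec: "ergodic_decomposition M T Mbar \<pi> \<mu>"
    and D1: "emeasure (completion (Mbar \<Otimes>\<^sub>M Mbar)) (disjoint_pairs T Mbar \<mu>) = 1"
    and erg: "ergodic_system N S"
  shows "disjoint_systems M T N S"
proof -
  have pN: "pmp_system N S" using erg unfolding ergodic_system_def by simp
  have "prob_space M" and T[measurable]: "T \<in> measurable M M" and "prob_space N" and S[measurable]: "S \<in> measurable N N"
    using pM pN unfolding pmp_system_def by auto
  interpret M: prob_space M by fact
  interpret N: prob_space N by fact
  note ED = ergodic_decompositionD[OF pM dec]
  have \<pi>[measurable]: "\<pi> \<in> measurable M Mbar" by (rule ED(2))
  interpret Mbar: prob_space Mbar by (rule ED(1))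
  interpret BB: pair_prob_space Mbar Mbar ..
  let ?BB = "Mbar \<Otimes>\<^sub>M Mbar"
  have finBB: "finite_measure ?BB" by (rule BB.finite_measure_axioms)
  obtain e r where er: "e \<in> borel_measurable M" "r \<in> measurable (borel :: real measure) M"
    "\<And>x. x \<in> space M \<Longrightarrow> r (e x) = x" "\<And>x. e x \<in> {0..1}"
    using measurable_retract_unit_interval[OF standard_prob_space_retract[OF std]] by blast
  obtain \<A> where \<A>: "countable \<A>" "algebra (space M) \<A>" "sets M = sigma_sets (space M) \<A>"
    "\<And>A. A \<in> \<A> \<Longrightarrow> T -` A \<inter> space M \<in> \<A>" "\<And>t. t \<in> \<rat> \<Longrightarrow> {x \<in> space M. e x < t} \<in> \<A>"
    using countable_invariant_algebra[OF T er(1-3)] by blast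
  interpret \<A>: algebra "space M" \<A> by (rule \<A>(2))
  have sub[measurable]: "A \<in> sets M" if "A \<in> \<A>" for A using that \<A>(3) by auto
  define D where "D = disjoint_pairs T Mbar \<mu>"
  have aeD: "AE z in ?BB. z \<in> D"
  proof -
    interpret CB: prob_space "completion ?BB" by (rule BB.prob_space_completion)
    \<comment> \<open>Sets outside the \<sigma>-algebra have measure 0 by convention, so measure 1
      already contains the measurability of \<open>D\<close> for the completion.\<close>
    have "D \<in> sets (completion ?BB)"
      using D1 unfolding D_def[symmetric] by (metis emeasure_notin_sets zero_neq_one)
    then have "AE z in completion ?BB. z \<in> D"
      using D1 unfolding D_def[symmetric] by (subst CB.AE_in_set_eq_1) (auto simp: CB.emeasure_eq_measure)
    then show ?thesis by (simp add: AE_completion_iff)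
  qed
  define pp where "pp = map_prod \<pi> \<pi>"
  have main: "measure K (A \<times> B) = measure M A * measure N B"
    if J: "K \<in> joinings M T N S" and A: "A \<in> sets M" and B: "B \<in> sets N" for K A B
  proof -
    note JD = joiningsD[OF J]
    interpret K: prob_space K by (rule JD(2))
    have sK[measurable_cong]: "sets K = sets (M \<Otimes>\<^sub>M N)" by (rule JD(1))
    obtain Q :: "'a set \<Rightarrow> 'a set \<Rightarrow> real" where
      Q0: "\<And>A B. A \<in> sets M \<Longrightarrow> B \<in> sets M \<Longrightarrow> 0 \<le> Q A B" and
      Qadd: "\<And>A A' B. A \<in> sets M \<Longrightarrow> A' \<in> sets M \<Longrightarrow> B \<in> sets M \<Longrightarrow> A \<inter> A' = {} \<Longrightarrow> Q (A \<union> A') B = Q A B + Q A' B" and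
      Qsym: "\<And>A B. A \<in> sets M \<Longrightarrow> B \<in> sets M \<Longrightarrow> Q A B = Q B A" and
      Qinv: "\<And>A B. A \<in> sets M \<Longrightarrow> B \<in> sets M \<Longrightarrow> Q (T -` A \<inter> space M) (T -` B \<inter> space M) = Q A B" and
      Qprod: "\<And>A C. A \<in> sets M \<Longrightarrow> C \<in> sets M \<Longrightarrow> T -` C \<inter> space M = C \<Longrightarrow>
         (\<And>B. B \<in> sets N \<Longrightarrow> measure K (C \<times> B) = measure M C * measure N B) \<Longrightarrow>
         Q A C = measure M A * measure M C" and
      Qfin: "\<And>A B. A \<in> sets M \<Longrightarrow> B \<in> sets N \<Longrightarrow> Q A A \<le> (measure M A)\<^sup>2 \<Longrightarrow>
         measure K (A \<times> B) = measure M A * measure N B"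
      using relative_self_joining[OF pM pN J] by blast

    \<comment> \<open>Invariant sets are independent of the ergodic factor\<close>
    have prodC: "measure K (C \<times> B) = measure M C * measure N B"
      if C[measurable]: "C \<in> sets M" and inv: "T -` C \<inter> space M = C" and B: "B \<in> sets N" for C B
    proof -
      \<comment> \<open>Cutting the joining down to an invariant set \<open>C\<close> leaves an
        \<open>S\<close>-invariant measure dominated by \<open>N\<close>, which by ergodicity is a
        multiple of \<open>N\<close>.\<close>
      define m where "m = distr (density K (indicator (C \<times> space N))) N snd"
      have CN: "C \<times> space N \<in> sets K" by simp
      have em: "emeasure m B = emeasure K (C \<times> B)" if [measurable]: "B \<in> sets N" for B
      proof -
        have "emeasure m B = emeasure (density K (indicator (C \<times> space N))) (snd -` B \<inter> space K)"
          unfolding m_def by (subst emeasure_distr) auto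
        also have "\<dots> = emeasure K ((C \<times> space N) \<inter> (snd -` B \<inter> space K))"
          using CN by (subst emeasure_density) (auto simp: indicator_inter_arith[symmetric])
        also have "(C \<times> space N) \<inter> (snd -` B \<inter> space K) = C \<times> B"
          using sets.sets_into_space[OF C] sets.sets_into_space[OF that] by (auto simp: JD(3))
        finally show ?thesis .
      qed
      have "measure m B = measure m (space N) * measure N B"
      proof (rule ergodic_invariant_dominated[OF erg _ _ _ B])
        show "sets m = sets N" unfolding m_def by simp
        fix B assume B[measurable]: "B \<in> sets N"
        have "emeasure m B \<le> emeasure K (space M \<times> B)"
          unfolding em[OF B] by (rule emeasure_mono) (use sets.sets_into_space[OF C] in auto)
        also have "\<dots> = emeasure N B" using JD(5)[OF B] by (simp add: K.emeasure_eq_measure N.emeasure_eq_measure)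
        finally show "emeasure m B \<le> emeasure N B" .
        have "emeasure m (S -` B \<inter> space N) = emeasure K ((T -` C \<inter> space M) \<times> (S -` B \<inter> space N))"
          by (simp add: em inv)
        also have "\<dots> = emeasure K (C \<times> B)"
          using JD(6)[OF T S C B] by (simp add: K.emeasure_eq_measure)
        finally show "emeasure m (S -` B \<inter> space N) = emeasure m B" by (simp add: em)
      qed
      then show ?thesis
        using em[OF B] em[OF sets.top] JD(4)[OF C] by (simp add: measure_def)
    qed
    have C': "\<pi> -` C \<inter> space M \<in> sets M" "T -` (\<pi> -` C \<inter> space M) \<inter> space M = \<pi> -` C \<inter> space M" if "C \<in> sets Mbar" for C
      using that measurable_space[OF T] ED(3) by auto
    have QC: "Q A (\<pi> -` C \<inter> space M) = measure M A * measure Mbar C" if "A \<in> sets M" "C \<in> sets Mbar" for A C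
      using Qprod[OF that(1) C'(1)[OF that(2)] C'(2)[OF that(2)] prodC[OF C'(1)[OF that(2)] C'(2)[OF that(2)]]] ED(4)[OF that(2)]
      by simp
    have Q1: "Q A (space M) = measure M A" if "A \<in> sets M" for A
    proof -
      have "\<pi> -` space Mbar \<inter> space M = space M" using measurable_space[OF \<pi>] by auto
      then show ?thesis using QC[OF that sets.top] by (simp add: Mbar.prob_space)
    qed
    have half: "{x \<in> space M. e x < t} \<in> sets M" for t using er(1) by measurable

    \<comment> \<open>The self-joining as a measure and its projection to pairs of
      components\<close>
    obtain L where L: "L \<in> joinings M T M T" "\<And>A B. A \<in> sets M \<Longrightarrow> B \<in> sets M \<Longrightarrow> measure L (A \<times> B) = Q A B"
    proof (rule joining_extension[OF M.prob_space_axioms T sets_algebra M.prob_space_axioms T sets_algebra er(1,4,2,3), of Q])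
      fix A B B' assume AB: "A \<in> sets M" "B \<in> sets M" "B' \<in> sets M" "B \<inter> B' = {}"
      show "Q A (B \<union> B') = Q A B + Q A B'"
        using Qadd[OF AB(2,3,1,4)] Qsym AB by (metis sets.Un)
    next
      fix B assume B: "B \<in> sets M"
      show "Q (space M) B = measure M B" using Q1[OF B] Qsym[OF B sets.top] by simp
    qed (use Q0 Qadd Qinv Q1 half in auto)
    note LD = joiningsD[OF L(1)]
    interpret L: prob_space L by (rule LD(2))
    have sL[measurable_cong]: "sets L = sets (M \<Otimes>\<^sub>M M)" by (rule LD(1))
    have spL: "space L = space M \<times> space M" by (rule LD(3))
    have pp[measurable]: "pp \<in> measurable L ?BB" unfolding pp_def map_prod_def by measurable
    have ppC: "pp -` (C1 \<times> C2) \<inter> space L = (\<pi> -` C1 \<inter> space M) \<times> (\<pi> -` C2 \<inter> space M)" for C1 C2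
      by (auto simp: spL pp_def)
    have pr2: "measure ?BB (C1 \<times> C2) = measure Mbar C1 * measure Mbar C2" if "C1 \<in> sets Mbar" "C2 \<in> sets Mbar" for C1 C2
      using Mbar.emeasure_pair_measure_Times[OF that] by (simp add: measure_def enn2real_mult)
    \<comment> \<open>Preimages of sets of components are invariant, so \<open>QC\<close> factorises
      the measure of such rectangles. Almost every pair for the product measure, as in the
      hypothesis on \<open>disjoint_pairs\<close>, is therefore almost every pair for
      \<open>L\<close>.\<close>
    have dpp: "distr L ?BB pp = ?BB"
    proof (rule pair_measure_eqI_algebras[OF sets_algebra sets_algebra])
      show "finite_measure (distr L ?BB pp)" by (rule L.finite_measure_distr) measurable
      fix C1 C2 assume C: "C1 \<in> sets Mbar" "C2 \<in> sets Mbar"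
      have "measure (distr L ?BB pp) (C1 \<times> C2) = measure L ((\<pi> -` C1 \<inter> space M) \<times> (\<pi> -` C2 \<inter> space M))"
        using C by (simp add: measure_distr ppC)
      also have "\<dots> = measure Mbar C1 * measure Mbar C2"
        using L(2)[OF C'(1)[OF C(1)] C'(1)[OF C(2)]] QC[OF C'(1)[OF C(1)] C(2)] ED(4)[OF C(1)] by simp
      finally show "measure (distr L ?BB pp) (C1 \<times> C2) = measure ?BB (C1 \<times> C2)" using pr2[OF C] by simp
    qed (use finBB in auto)

    \<comment> \<open>Disintegration over pairs of components\<close>
    define W where "W A B C = (A \<times> B) \<inter> (pp -` C \<inter> space L)" for A B C
    have W[measurable]: "W A B C \<in> sets L" if "A \<in> sets M" "B \<in> sets M" "C \<in> sets ?BB" for A B C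
      using that unfolding W_def by measurable
    define density_of where "density_of A B d \<longleftrightarrow> d \<in> borel_measurable ?BB \<and> (\<forall>z. 0 \<le> d z \<and> d z \<le> 1) \<and>
        (\<forall>C\<in>sets ?BB. measure L (W A B C) = (\<integral>z. indicator C z * d z \<partial>?BB))" for A B and d :: "'b \<times> 'b \<Rightarrow> real"
    have ex: "\<exists>d. density_of A B d"
      if AB[measurable]: "A \<in> sets M" "B \<in> sets M" for A B
    proof -
      define m where "m = distr (density L (indicator (A \<times> B))) ?BB pp"
      have em: "emeasure m C = emeasure L (W A B C)" if [measurable]: "C \<in> sets ?BB" for C
      proof -
        have "emeasure m C = emeasure (density L (indicator (A \<times> B))) (pp -` C \<inter> space L)"
          unfolding m_def by (subst emeasure_distr) auto
        also have "\<dots> = emeasure L (W A B C)"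
          unfolding W_def by (subst emeasure_density) (auto simp: indicator_inter_arith[symmetric])
        finally show ?thesis .
      qed
      have le: "emeasure m C \<le> emeasure ?BB C" if C[measurable]: "C \<in> sets ?BB" for C
      proof -
        have "emeasure m C \<le> emeasure L (pp -` C \<inter> space L)"
          unfolding em[OF C] W_def by (rule emeasure_mono) auto
        also have "\<dots> = emeasure (distr L ?BB pp) C" by (simp add: emeasure_distr)
        finally show ?thesis by (simp add: dpp)
      qed
      have sm: "sets m = sets ?BB" unfolding m_def by simp
      obtain d :: "'b \<times> 'b \<Rightarrow> real" where d: "d \<in> borel_measurable ?BB" "\<And>x. 0 \<le> d x" "\<And>x. d x \<le> 1"
        "\<And>C. C \<in> sets ?BB \<Longrightarrow> emeasure m C = (\<integral>\<^sup>+z. ennreal (d z) * indicator C z \<partial>?BB)"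
        "\<And>C. C \<in> sets ?BB \<Longrightarrow> measure m C = (\<integral>z. indicator C z * d z \<partial>?BB)"
        by (rule dominated_density[OF finBB sm le], assumption, rule that)
      show ?thesis
        unfolding density_of_def
      proof (intro exI[of _ d] conjI allI ballI)
        fix C assume "C \<in> sets ?BB"
        then show "measure L (W A B C) = (\<integral>z. indicator C z * d z \<partial>?BB)"
          using em[of C] d(5)[of C] by (simp add: measure_def)
      qed (use d in auto)
    qed
    define d where "d A B = (SOME d. density_of A B d)" for A B
    have d: "density_of A B (d A B)" if "A \<in> sets M" "B \<in> sets M" for A B
      unfolding d_def by (rule someI_ex[OF ex[OF that]])
    have dm[measurable]: "d A B \<in> borel_measurable ?BB" and d01: "0 \<le> d A B z" "d A B z \<le> 1"
      and dW: "\<And>C. C \<in> sets ?BB \<Longrightarrow> measure L (W A B C) = (\<integral>z. indicator C z * d A B z \<partial>?BB)"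
      if "A \<in> sets M" "B \<in> sets M" for A B z
      using d[OF that] unfolding density_of_def by blast+
    have di: "integrable ?BB (d A B)" if "A \<in> sets M" "B \<in> sets M" for A B
      by (rule BB.integrable_const_bound[of _ 1]) (use that d01 in auto)
    have diC: "integrable ?BB (\<lambda>z. indicator C z * d A B z)" if "A \<in> sets M" "B \<in> sets M" "C \<in> sets ?BB" for A B C
      by (rule BB.integrable_const_bound[of _ 1]) (use that d01 in \<open>auto simp: indicator_def\<close>)
    note AEeq = AE_eq_from_generator[OF finBB algebra_generator(1,2)[OF sets_algebra(1)] sets_algebra(2) algebra_generator(3)[OF sets_algebra(1)]]
    have addl: "AE z in ?BB. d (A \<union> A') B z = d A B z + d A' B z"
      if AB[measurable]: "A \<in> sets M" "A' \<in> sets M" "B \<in> sets M" and disj: "A \<inter> A' = {}" for A A' B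
    proof (rule AEeq)
      fix C assume C: "C \<in> sets ?BB"
      have "W (A \<union> A') B C = W A B C \<union> W A' B C" "W A B C \<inter> W A' B C = {}" using disj unfolding W_def by auto
      then have "measure L (W (A \<union> A') B C) = measure L (W A B C) + measure L (W A' B C)"
        using AB C by (simp add: L.finite_measure_Union)
      then show "(\<integral>z. indicator C z * d (A \<union> A') B z \<partial>?BB) = (\<integral>z. indicator C z * (d A B z + d A' B z) \<partial>?BB)"
        using AB C diC[of A B C] diC[of A' B C] by (simp add: dW distrib_left)
    qed (use AB di d01 in \<open>auto intro!: add_nonneg_nonneg\<close>)
    have addr: "AE z in ?BB. d B (A \<union> A') z = d B A z + d B A' z"
      if AB[measurable]: "A \<in> sets M" "A' \<in> sets M" "B \<in> sets M" and disj: "A \<inter> A' = {}" for A A' B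
    proof (rule AEeq)
      fix C assume C: "C \<in> sets ?BB"
      have "W B (A \<union> A') C = W B A C \<union> W B A' C" "W B A C \<inter> W B A' C = {}" using disj unfolding W_def by auto
      then have "measure L (W B (A \<union> A') C) = measure L (W B A C) + measure L (W B A' C)"
        using AB C by (simp add: L.finite_measure_Union)
      then show "(\<integral>z. indicator C z * d B (A \<union> A') z \<partial>?BB) = (\<integral>z. indicator C z * (d B A z + d B A' z) \<partial>?BB)"
        using AB C diC[of B A C] diC[of B A' C] by (simp add: dW distrib_left)
    qed (use AB di d01 in \<open>auto intro!: add_nonneg_nonneg\<close>)
    have inv: "AE z in ?BB. d (T -` A \<inter> space M) (T -` B \<inter> space M) z = d A B z"
      if AB[measurable]: "A \<in> sets M" "B \<in> sets M" for A B
    proof (rule AEeq)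
      fix C assume C[measurable]: "C \<in> sets ?BB"
      have TT[measurable]: "map_prod T T \<in> measurable L L" unfolding map_prod_def by measurable
      have dTT: "distr L L (map_prod T T) = L" using L(1) unfolding joinings_def by simp
      \<comment> \<open>\<open>\<pi>\<close> is constant along orbits, so the restriction to pairs
        in \<open>C\<close> is unaffected by \<open>map_prod T T\<close>.\<close>
      have "W (T -` A \<inter> space M) (T -` B \<inter> space M) C = map_prod T T -` W A B C \<inter> space L"
        unfolding W_def using ED(3) measurable_space[OF T] by (auto simp: spL pp_def)
      also have "measure L \<dots> = measure (distr L L (map_prod T T)) (W A B C)"
        by (subst measure_distr) auto
      finally have "measure L (W (T -` A \<inter> space M) (T -` B \<inter> space M) C) = measure L (W A B C)" by (simp add: dTT)
      then show "(\<integral>z. indicator C z * d (T -` A \<inter> space M) (T -` B \<inter> space M) z \<partial>?BB) = (\<integral>z. indicator C z * d A B z \<partial>?BB)"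
        by (simp add: dW)
    qed (use AB di d01 in auto)
    let ?R = "{C1 \<times> C2 |C1 C2. C1 \<in> sets Mbar \<and> C2 \<in> sets Mbar}"
    have gen: "Int_stable ?R" "?R \<subseteq> Pow (space ?BB)" "sets ?BB = sigma_sets (space ?BB) ?R" "space ?BB \<in> ?R"
    proof -
      show "Int_stable ?R" by (rule Int_stable_pair_measure_generator)
      show "?R \<subseteq> Pow (space ?BB)" using sets.space_closed by (fastforce simp: space_pair_measure)
      show "sets ?BB = sigma_sets (space ?BB) ?R" by (simp add: sets_pair_measure space_pair_measure)
      show "space ?BB \<in> ?R" by (auto simp: space_pair_measure)
    qed
    have \<mu>i: "integrable Mbar (\<lambda>x. indicator C x * measure (\<mu> x) A)" if "A \<in> sets M" "C \<in> sets Mbar" for A C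
    proof (rule Mbar.integrable_const_bound[of _ 1])
      show "AE x in Mbar. norm (indicator C x * measure (\<mu> x) A) \<le> 1"
        by (rule AE_I2) (auto simp: indicator_def prob_space.prob_le_1[OF ED(8)])
    qed (use that ED(11)[OF that(1)] in auto)
    have \<mu>1: "measure (\<mu> x) A \<le> 1" if "x \<in> space Mbar" for x A
      by (rule prob_space.prob_le_1[OF ED(8)[OF that]])
    have rect: "(\<integral>z. indicator (C1 \<times> C2) z * (measure (\<mu> (fst z)) A * measure (\<mu> (snd z)) B) \<partial>?BB)
        = measure M (A \<inter> \<pi> -` C1) * measure M (B \<inter> \<pi> -` C2)"
      and recti: "integrable ?BB (\<lambda>z. measure (\<mu> (fst z)) A * measure (\<mu> (snd z)) B)"
      if AB[measurable]: "A \<in> sets M" "B \<in> sets M" and C[measurable]: "C1 \<in> sets Mbar" "C2 \<in> sets Mbar" for A B C1 C2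
    proof -
      have [measurable]: "(\<lambda>x. measure (\<mu> x) A) \<in> borel_measurable Mbar" "(\<lambda>x. measure (\<mu> x) B) \<in> borel_measurable Mbar"
        using ED(11) AB by auto
      show "integrable ?BB (\<lambda>z. measure (\<mu> (fst z)) A * measure (\<mu> (snd z)) B)"
        by (rule BB.integrable_const_bound[of _ 1]) (auto intro!: AE_I2 mult_le_one \<mu>1 simp: space_pair_measure)
      have i: "integrable ?BB (\<lambda>z. indicator (C1 \<times> C2) z * (measure (\<mu> (fst z)) A * measure (\<mu> (snd z)) B))"
        by (rule BB.integrable_const_bound[of _ 1]) (auto intro!: AE_I2 mult_le_one \<mu>1 simp: space_pair_measure indicator_def)
      have "(\<integral>z. indicator (C1 \<times> C2) z * (measure (\<mu> (fst z)) A * measure (\<mu> (snd z)) B) \<partial>?BB) =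
        (\<integral>x. (\<integral>y. (indicator C1 x * measure (\<mu> x) A) * (indicator C2 y * measure (\<mu> y) B) \<partial>Mbar) \<partial>Mbar)"
        by (subst BB.integral_fst'[symmetric, OF i], intro Bochner_Integration.integral_cong refl)
          (simp add: indicator_times ac_simps)
      then show "(\<integral>z. indicator (C1 \<times> C2) z * (measure (\<mu> (fst z)) A * measure (\<mu> (snd z)) B) \<partial>?BB)
        = measure M (A \<inter> \<pi> -` C1) * measure M (B \<inter> \<pi> -` C2)"
        by (simp only: integral_mult_right_zero integral_mult_left_zero ED(12)[OF AB(1) C(1)] ED(12)[OF AB(2) C(2)])
    qed
    have WL: "measure L (W A B (C1 \<times> C2)) = Q (A \<inter> (\<pi> -` C1 \<inter> space M)) (B \<inter> (\<pi> -` C2 \<inter> space M))"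
      if [measurable]: "A \<in> sets M" "B \<in> sets M" "C1 \<in> sets Mbar" "C2 \<in> sets Mbar" for A B C1 C2
    proof -
      have "W A B (C1 \<times> C2) = (A \<inter> (\<pi> -` C1 \<inter> space M)) \<times> (B \<inter> (\<pi> -` C2 \<inter> space M))"
        unfolding W_def ppC by auto
      then show ?thesis by (simp add: L(2))
    qed
    have int_sp: "A \<inter> (\<pi> -` C \<inter> space M) = A \<inter> \<pi> -` C" if "A \<in> sets M" for A C
      using sets.sets_into_space[OF that] by auto
    have sp1: "measure (\<mu> x) (space M) = 1" if "x \<in> space Mbar" for x
      using prob_space.prob_space[OF ED(8)[OF that]] ED(7)[OF that] by simp
    have spM\<pi>: "measure M (space M \<inter> \<pi> -` C) = measure Mbar C" if "C \<in> sets Mbar" for C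
      using ED(4)[OF that] by (simp add: Int_commute)
    \<comment> \<open>The factor \<open>measure (\<mu> (snd z)) (space M)\<close> equals 1; writing
      it out gives the right-hand side the product form that \<open>rect\<close> integrates.\<close>
    have margl: "AE z in ?BB. d A (space M) z = measure (\<mu> (fst z)) A * measure (\<mu> (snd z)) (space M)" if A[measurable]: "A \<in> sets M" for A
    proof (rule AE_eq_from_generator[OF finBB gen])
      fix R assume "R \<in> ?R"
      then obtain C1 C2 where C[measurable]: "R = C1 \<times> C2" "C1 \<in> sets Mbar" "C2 \<in> sets Mbar" by auto
      have "(\<integral>z. indicator R z * d A (space M) z \<partial>?BB) = measure L (W A (space M) (C1 \<times> C2))" using C by (simp add: dW)
      also have "\<dots> = Q (A \<inter> (\<pi> -` C1 \<inter> space M)) (\<pi> -` C2 \<inter> space M)"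
        using C by (simp add: WL Int_absorb1)
      also have "\<dots> = measure M (A \<inter> (\<pi> -` C1 \<inter> space M)) * measure Mbar C2"
        using C by (intro QC) auto
      finally show "(\<integral>z. indicator R z * d A (space M) z \<partial>?BB) = (\<integral>z. indicator R z * (measure (\<mu> (fst z)) A * measure (\<mu> (snd z)) (space M)) \<partial>?BB)"
        using C rect[OF A sets.top C(2,3)] by (simp add: int_sp[OF A] spM\<pi>)
    qed (use A di d01 recti[OF A sets.top sets.empty_sets sets.empty_sets] in \<open>auto\<close>)
    have margr: "AE z in ?BB. d (space M) A z = measure (\<mu> (fst z)) (space M) * measure (\<mu> (snd z)) A" if A[measurable]: "A \<in> sets M" for A
    proof (rule AE_eq_from_generator[OF finBB gen])
      fix R assume "R \<in> ?R"
      then obtain C1 C2 where C[measurable]: "R = C1 \<times> C2" "C1 \<in> sets Mbar" "C2 \<in> sets Mbar" by auto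
      have "(\<integral>z. indicator R z * d (space M) A z \<partial>?BB) = measure L (W (space M) A (C1 \<times> C2))" using C by (simp add: dW)
      also have "\<dots> = Q (\<pi> -` C1 \<inter> space M) (A \<inter> (\<pi> -` C2 \<inter> space M))"
        using C by (simp add: WL Int_absorb1)
      also have "\<dots> = Q (A \<inter> (\<pi> -` C2 \<inter> space M)) (\<pi> -` C1 \<inter> space M)"
        using C by (intro Qsym) auto
      also have "\<dots> = measure M (A \<inter> (\<pi> -` C2 \<inter> space M)) * measure Mbar C1"
        using C by (intro QC) auto
      finally show "(\<integral>z. indicator R z * d (space M) A z \<partial>?BB) = (\<integral>z. indicator R z * (measure (\<mu> (fst z)) (space M) * measure (\<mu> (snd z)) A) \<partial>?BB)"
        using C rect[OF sets.top A C(2,3)] by (simp add: int_sp[OF A] spM\<pi>)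
    qed (use A di d01 recti[OF sets.top A sets.empty_sets sets.empty_sets] in \<open>auto\<close>)

    \<comment> \<open>Joinings of almost every pair of components\<close>
    have "AE z in ?BB. \<forall>A\<in>\<A>. \<forall>B\<in>\<A>. d A B z = measure (\<mu> (fst z)) A * measure (\<mu> (snd z)) B"
    proof -
      have a1: "AE z in ?BB. \<forall>A\<in>\<A>. \<forall>A'\<in>\<A>. \<forall>B\<in>\<A>. A \<inter> A' = {} \<longrightarrow> d (A \<union> A') B z = d A B z + d A' B z"
        unfolding AE_ball_countable[OF \<A>(1)] using addl sub by (auto simp: AE_impI)
      have a2: "AE z in ?BB. \<forall>A\<in>\<A>. \<forall>A'\<in>\<A>. \<forall>B\<in>\<A>. A \<inter> A' = {} \<longrightarrow> d B (A \<union> A') z = d B A z + d B A' z"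
        unfolding AE_ball_countable[OF \<A>(1)] using addr sub by (auto simp: AE_impI)
      have a3: "AE z in ?BB. \<forall>A\<in>\<A>. \<forall>B\<in>\<A>. d (T -` A \<inter> space M) (T -` B \<inter> space M) z = d A B z"
        unfolding AE_ball_countable[OF \<A>(1)] using inv sub by auto
      have a4: "AE z in ?BB. \<forall>A\<in>\<A>. d A (space M) z = measure (\<mu> (fst z)) A * measure (\<mu> (snd z)) (space M)"
        unfolding AE_ball_countable[OF \<A>(1)] using margl sub by auto
      have a5: "AE z in ?BB. \<forall>A\<in>\<A>. d (space M) A z = measure (\<mu> (fst z)) (space M) * measure (\<mu> (snd z)) A"
        unfolding AE_ball_countable[OF \<A>(1)] using margr sub by auto
      show ?thesis
        using a1 a2 a3 a4 a5 aeD
      proof eventually_elim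
        case (elim z)
        obtain x1 x2 where z: "z = (x1, x2)" by force
        with elim(6) have x: "x1 \<in> space Mbar" "x2 \<in> space Mbar" and disj: "disjoint_systems (\<mu> x1) T (\<mu> x2) T"
          unfolding D_def disjoint_pairs_def by auto
        have T1: "T \<in> measurable (\<mu> x) (\<mu> x)" if "x \<in> space Mbar" for x
          using T measurable_cong_sets[OF ED(6)[OF that] ED(6)[OF that]] by simp
        have e2: "e \<in> borel_measurable (\<mu> x2)" "r \<in> measurable borel (\<mu> x2)"
          unfolding measurable_cong_sets[OF ED(6)[OF x(2)] refl] measurable_cong_sets[OF refl ED(6)[OF x(2)]]
          by (rule er)+
        \<comment> \<open>At a pair where all identities hold, the numbers \<open>d A B z\<close>
          extend to a joining of the two components, and disjointness forces it to be their
          product.\<close>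
        obtain J where J: "J \<in> joinings (\<mu> x1) T (\<mu> x2) T" "\<And>A B. A \<in> \<A> \<Longrightarrow> B \<in> \<A> \<Longrightarrow> measure J (A \<times> B) = d A B z"
        proof (rule joining_extension[OF ED(8)[OF x(1)] T1[OF x(1)] _ _ ED(8)[OF x(2)] T1[OF x(2)] _ _ e2(1) er(4) e2(2), of \<A> \<A> "\<lambda>A B. d A B z"])
          show "algebra (space (\<mu> x1)) \<A>" "algebra (space (\<mu> x2)) \<A>" using \<A>(2) x ED(7) by auto
          show "sets (\<mu> x1) = sigma_sets (space (\<mu> x1)) \<A>" "sets (\<mu> x2) = sigma_sets (space (\<mu> x2)) \<A>"
            using \<A>(3) x ED(6,7) by auto
          show "r (e y) = y" if "y \<in> space (\<mu> x2)" for y using er(3) that x ED(7) by auto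
          show "{y \<in> space (\<mu> x2). e y < t} \<in> \<A>" if "t \<in> \<rat>" for t using \<A>(5) that x ED(7) by auto
          show "T -` A \<inter> space (\<mu> x1) \<in> \<A>" "T -` A \<inter> space (\<mu> x2) \<in> \<A>" if "A \<in> \<A>" for A
            using \<A>(4) that x ED(7) by auto
          show "0 \<le> d A B z" if "A \<in> \<A>" "B \<in> \<A>" for A B using d01 sub that by auto
          show "d (A \<union> A') B z = d A B z + d A' B z" if "A \<in> \<A>" "A' \<in> \<A>" "B \<in> \<A>" "A \<inter> A' = {}" for A A' B
            using elim(1) that by auto
          show "d B (A \<union> A') z = d B A z + d B A' z" if "B \<in> \<A>" "A \<in> \<A>" "A' \<in> \<A>" "A \<inter> A' = {}" for A A' B
            using elim(2) that by auto
          show "d A (space (\<mu> x2)) z = measure (\<mu> x1) A" if "A \<in> \<A>" for A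
            using elim(4) that x ED(7) sp1 by (auto simp: z)
          show "d (space (\<mu> x1)) A z = measure (\<mu> x2) A" if "A \<in> \<A>" for A
            using elim(5) that x ED(7) sp1 by (auto simp: z)
          show "d (T -` A \<inter> space (\<mu> x1)) (T -` B \<inter> space (\<mu> x2)) z = d A B z" if "A \<in> \<A>" "B \<in> \<A>" for A B
            using elim(3) that x ED(7) by auto
        qed (rule that, assumption, blast)
        show "\<forall>A\<in>\<A>. \<forall>B\<in>\<A>. d A B z = measure (\<mu> (fst z)) A * measure (\<mu> (snd z)) B"
        proof (intro ballI)
          fix A B assume AB: "A \<in> \<A>" "B \<in> \<A>"
          have "measure J (A \<times> B) = measure (\<mu> x1) A * measure (\<mu> x2) B"
            using disj J(1) AB sub x ED(6) unfolding disjoint_systems_iff[OF ED(9)[OF x(1)] ED(9)[OF x(2)]] by auto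
          then show "d A B z = measure (\<mu> (fst z)) A * measure (\<mu> (snd z)) B"
            using J(2)[OF AB] by (simp add: z)
        qed
      qed
    qed
    note ae = this

    \<comment> \<open>The self-joining is the product\<close>
    have "L = M \<Otimes>\<^sub>M M"
    proof (rule pair_measure_eqI_algebras[OF \<A>(2,3) \<A>(2,3) sL refl L.finite_measure_axioms])
      interpret MM: pair_prob_space M M ..
      show "finite_measure (M \<Otimes>\<^sub>M M)" by (rule MM.P.finite_measure_axioms)
      fix A B assume AB: "A \<in> \<A>" "B \<in> \<A>"
      then have AB'[measurable]: "A \<in> sets M" "B \<in> sets M" using sub by auto
      have W1: "W A B (space Mbar \<times> space Mbar) = A \<times> B"
        using sets.sets_into_space[OF AB'(1)] sets.sets_into_space[OF AB'(2)] measurable_space[OF \<pi>]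
        unfolding W_def by (auto simp: spL pp_def subset_eq)
      have "measure L (A \<times> B) = (\<integral>z. indicator (space Mbar \<times> space Mbar) z * d A B z \<partial>?BB)"
        using dW[of A B "space Mbar \<times> space Mbar"] by (simp add: W1)
      also have "\<dots> = (\<integral>z. indicator (space Mbar \<times> space Mbar) z * (measure (\<mu> (fst z)) A * measure (\<mu> (snd z)) B) \<partial>?BB)"
      proof (rule integral_cong_AE)
        show "AE z in ?BB. indicator (space Mbar \<times> space Mbar) z * d A B z = indicator (space Mbar \<times> space Mbar) z * (measure (\<mu> (fst z)) A * measure (\<mu> (snd z)) B)"
          using ae by eventually_elim (use AB in auto)
        have [measurable]: "(\<lambda>z. measure (\<mu> (fst z)) A * measure (\<mu> (snd z)) B) \<in> borel_measurable ?BB"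
          using recti[OF AB' sets.empty_sets sets.empty_sets] by simp
        show "(\<lambda>z. indicator (space Mbar \<times> space Mbar) z * (measure (\<mu> (fst z)) A * measure (\<mu> (snd z)) B)) \<in> borel_measurable ?BB" by measurable
      qed simp
      also have "\<dots> = measure M (A \<inter> \<pi> -` space Mbar) * measure M (B \<inter> \<pi> -` space Mbar)"
        by (rule rect) auto
      also have "\<dots> = measure M A * measure M B"
      proof -
        have "A \<inter> \<pi> -` space Mbar = A" "B \<inter> \<pi> -` space Mbar = B"
          using sets.sets_into_space[OF AB'(1)] sets.sets_into_space[OF AB'(2)] measurable_space[OF \<pi>] by auto
        then show ?thesis by simp
      qed
      finally show "measure L (A \<times> B) = measure (M \<Otimes>\<^sub>M M) (A \<times> B)"
        using M.emeasure_pair_measure_Times[OF AB'] by (simp add: measure_def enn2real_mult)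
    qed
    \<comment> \<open>This is the extremal case of \<open>relative_self_joining\<close>, in which
      the conditional expectation of \<open>A\<close> on \<open>N\<close> is constant.\<close>
    then have "Q A A = measure M A * measure M A"
      using L(2)[OF A A] M.emeasure_pair_measure_Times[OF A A] by (simp add: measure_def enn2real_mult)
    then show ?thesis using Qfin[OF A B] by (simp add: power2_eq_square)
  qed
  then show ?thesis using disjoint_systems_iff[OF pM pN] by blast
qed

section \<open>Products with a Bernoulli shift\<close>

definition coin_flips :: "(int \<Rightarrow> bool) measure" where
  "coin_flips = Pi\<^sub>M UNIV (\<lambda>_. measure_pmf (pmf_of_set UNIV))"

definition shift :: "(int \<Rightarrow> bool) \<Rightarrow> int \<Rightarrow> bool" where
  "shift w = (\<lambda>i. w (i + 1))"

text \<open>Free coordinates carry the constraint \<open>UNIV\<close>, so that intersections and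
  shifts of cylinders are pointwise operations on \<open>X\<close>.\<close>

definition cylinder :: "(int \<Rightarrow> bool set) \<Rightarrow> (int \<Rightarrow> bool) set" where
  "cylinder X = {w. \<forall>i. w i \<in> X i}"

definition cylinders :: "(int \<Rightarrow> bool) set set" where
  "cylinders = {cylinder X | X. finite {i. X i \<noteq> UNIV}}"

lemma space_coin_flips [simp]: "space coin_flips = UNIV"
  unfolding coin_flips_def by (simp add: space_PiM)

lemma prob_space_coin_flips: "prob_space coin_flips"
  unfolding coin_flips_def by (rule prob_space_PiM) (rule prob_space_measure_pmf)

lemma sets_coin_flips: "sets coin_flips = sets (Pi\<^sub>M UNIV (\<lambda>_. count_space UNIV))"
  unfolding coin_flips_def by (rule sets_PiM_cong) auto

lemma measurable_retract_coin_flips: "measurable_retract coin_flips cantor_space"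
proof -
  have "measurable_retract (Pi\<^sub>M UNIV (\<lambda>_::int. count_space UNIV) :: (int \<Rightarrow> bool) measure) cantor_space"
    by (rule measurable_retract_bool_reindex[of int_decode int_encode]) simp
  then show ?thesis
    unfolding measurable_retract_def measurable_cong_sets[OF sets_coin_flips refl]
      measurable_cong_sets[OF refl sets_coin_flips]
    by (simp add: space_PiM)
qed

text \<open>The set \<open>J\<close> may contain free coordinates, whose factor is 1; this allows
  cylinders to be evaluated over a common index set.\<close>

lemma measure_cylinder:
  assumes "finite J" "\<And>i. i \<notin> J \<Longrightarrow> X i = UNIV"
  shows "cylinder X \<in> sets coin_flips"
    "measure coin_flips (cylinder X) = (\<Prod>i\<in>J. measure (measure_pmf (pmf_of_set UNIV)) (X i))"
proof -
  interpret P: product_prob_space "\<lambda>_::int. measure_pmf (pmf_of_set (UNIV :: bool set))" UNIV ..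
  have eq: "cylinder X = {w \<in> space coin_flips. \<forall>i\<in>J. w i \<in> X i}"
    unfolding cylinder_def using assms(2) by auto
  show "cylinder X \<in> sets coin_flips"
    unfolding eq coin_flips_def using assms(1) by measurable
  have "emeasure coin_flips (cylinder X) = (\<Prod>i\<in>J. emeasure (measure_pmf (pmf_of_set UNIV)) (X i))"
    unfolding eq coin_flips_def by (rule P.emeasure_PiM_Collect) (use assms(1) in auto)
  then show "measure coin_flips (cylinder X) = (\<Prod>i\<in>J. measure (measure_pmf (pmf_of_set UNIV)) (X i))"
    by (simp add: measure_def[of coin_flips] measure_pmf.emeasure_eq_measure prod_ennreal prod_nonneg)
qed

lemma cylinders_sets: "C \<in> cylinders \<Longrightarrow> C \<in> sets coin_flips"
  unfolding cylinders_def by (auto intro!: measure_cylinder(1))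

lemma cylinders_generator:
  "Int_stable cylinders" "cylinders \<subseteq> Pow (space coin_flips)" "space coin_flips \<in> cylinders"
  "sets coin_flips = sigma_sets (space coin_flips) cylinders"
proof -
  show "Int_stable cylinders"
  proof (rule Int_stableI)
    fix A B assume "A \<in> cylinders" "B \<in> cylinders"
    then obtain X Y where X: "A = cylinder X" "finite {i. X i \<noteq> UNIV}" and Y: "B = cylinder Y" "finite {i. Y i \<noteq> UNIV}"
      unfolding cylinders_def by auto
    have "A \<inter> B = cylinder (\<lambda>i. X i \<inter> Y i)" unfolding X Y cylinder_def by auto
    moreover have "finite {i. X i \<inter> Y i \<noteq> UNIV}"
      by (rule finite_subset[OF _ finite_UnI[OF X(2) Y(2)]]) auto
    ultimately show "A \<inter> B \<in> cylinders" unfolding cylinders_def by blast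
  qed
  show "cylinders \<subseteq> Pow (space coin_flips)" by simp
  have "cylinder (\<lambda>_. UNIV) \<in> cylinders" unfolding cylinders_def by (intro CollectI exI[of _ "\<lambda>_. UNIV"]) simp
  then show "space coin_flips \<in> cylinders" by (simp add: cylinder_def)
  show "sets coin_flips = sigma_sets (space coin_flips) cylinders"
  proof
    show "sigma_sets (space coin_flips) cylinders \<subseteq> sets coin_flips"
      by (rule sets.sigma_sets_subset) (use cylinders_sets in auto)
    have "{{f. f i \<in> A} | i A. True} \<subseteq> cylinders"
    proof safe
      fix i :: int and A :: "bool set"
      have "{f. f i \<in> A} = cylinder ((\<lambda>_. UNIV)(i := A))" unfolding cylinder_def by auto
      moreover have "finite {j. ((\<lambda>_. UNIV)(i := A)) j \<noteq> UNIV}"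
        by (rule finite_subset[of _ "{i}"]) auto
      ultimately show "{f. f i \<in> A} \<in> cylinders" unfolding cylinders_def by blast
    qed
    then have "sigma_sets UNIV {{f. f i \<in> A} | i A. True} \<subseteq> sigma_sets UNIV cylinders"
      by (rule sigma_sets_mono')
    then show "sets coin_flips \<subseteq> sigma_sets (space coin_flips) cylinders"
      unfolding coin_flips_def sets_PiM_single by (simp add: space_PiM)
  qed
qed

lemma shift_funpow: "(shift ^^ n) w = (\<lambda>i. w (i + int n))"
  by (induction n) (auto simp: shift_def add.assoc)

lemma vimage_shift_cylinder: "(shift ^^ n) -` cylinder X = cylinder (\<lambda>i. X (i - int n))"
  unfolding cylinder_def shift_funpow by (auto, metis diff_add_cancel, metis add_diff_cancel)

lemma measure_shift_cylinder:
  assumes "C \<in> cylinders"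
  shows "measure coin_flips ((shift ^^ n) -` C) = measure coin_flips C"
proof -
  obtain X where X: "C = cylinder X" "finite {i. X i \<noteq> UNIV}" using assms unfolding cylinders_def by auto
  let ?J = "{i. X i \<noteq> UNIV}"
  have "measure coin_flips ((shift ^^ n) -` C) = (\<Prod>i\<in>(\<lambda>i. i + int n) ` ?J. measure (measure_pmf (pmf_of_set UNIV)) (X (i - int n)))"
    unfolding X vimage_shift_cylinder
  proof (rule measure_cylinder(2))
    fix i assume "i \<notin> (\<lambda>i. i + int n) ` ?J"
    then show "X (i - int n) = UNIV" by (metis (mono_tags, lifting) diff_add_cancel image_eqI mem_Collect_eq)
  qed (use X in simp)
  also have "\<dots> = (\<Prod>i\<in>?J. measure (measure_pmf (pmf_of_set UNIV)) (X i))"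
    by (subst prod.reindex) (auto simp: inj_on_def)
  also have "\<dots> = measure coin_flips C"
    unfolding X(1) by (rule measure_cylinder(2)[symmetric]) (use X in auto)
  finally show ?thesis .
qed

text \<open>A cylinder depends on finitely many coordinates. Once the shift has moved those of
  \<open>C'\<close> away from those of \<open>C\<close>, independence is exact, so equality holds
  eventually and not merely in the limit.\<close>

lemma shift_mixing:
  assumes "C \<in> cylinders" "C' \<in> cylinders"
  shows "\<forall>\<^sub>F n in sequentially. measure coin_flips ((shift ^^ n) -` C' \<inter> C) = measure coin_flips C' * measure coin_flips C"
proof -
  obtain X where X: "C = cylinder X" "finite {i. X i \<noteq> UNIV}" using assms unfolding cylinders_def by auto
  obtain Y where Y: "C' = cylinder Y" "finite {i. Y i \<noteq> UNIV}" using assms unfolding cylinders_def by auto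
  let ?J = "{i. X i \<noteq> UNIV}" and ?K = "{i. Y i \<noteq> UNIV}"
  let ?m = "measure (measure_pmf (pmf_of_set (UNIV :: bool set)))"
  \<comment> \<open>All constrained coordinates have absolute value at most \<open>b\<close>, so a
    shift by more than \<open>2 * b\<close> separates them.\<close>
  define b where "b = Max ((\<lambda>i. nat \<bar>i\<bar>) ` (?J \<union> ?K))"
  have b: "\<bar>i\<bar> \<le> int b" if "i \<in> ?J \<union> ?K" for i
  proof -
    have "nat \<bar>i\<bar> \<le> b"
      unfolding b_def by (rule Max_ge) (use X(2) Y(2) in simp, rule imageI[OF that])
    then show ?thesis by linarith
  qed
  have "measure coin_flips ((shift ^^ n) -` C' \<inter> C) = measure coin_flips C' * measure coin_flips C" if n: "n > 2 * b" for n
  proof -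
    let ?K' = "(\<lambda>i. i + int n) ` ?K"
    have disj: "?J \<inter> ?K' = {}"
    proof (rule equals0I)
      fix k assume "k \<in> ?J \<inter> ?K'"
      then obtain i where "k = i + int n" "k \<in> ?J" "i \<in> ?K" by blast
      then have "\<bar>i + int n\<bar> \<le> int b" "\<bar>i\<bar> \<le> int b" using b by auto
      then show False using n by linarith
    qed
    have K: "Y (i - int n) = UNIV" if "i \<notin> ?K'" for i
      using that by (metis (mono_tags, lifting) diff_add_cancel image_eqI mem_Collect_eq)
    have "(shift ^^ n) -` C' \<inter> C = cylinder (\<lambda>i. Y (i - int n) \<inter> X i)"
      unfolding X Y vimage_shift_cylinder by (auto simp: cylinder_def)
    then have "measure coin_flips ((shift ^^ n) -` C' \<inter> C) = (\<Prod>i\<in>?J \<union> ?K'. ?m (Y (i - int n) \<inter> X i))"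
      using measure_cylinder(2)[of "?J \<union> ?K'" "\<lambda>i. Y (i - int n) \<inter> X i"] X Y K by simp
    also have "\<dots> = (\<Prod>i\<in>?J. ?m (Y (i - int n) \<inter> X i)) * (\<Prod>i\<in>?K'. ?m (Y (i - int n) \<inter> X i))"
      by (rule prod.union_disjoint) (use X Y disj in auto)
    also have "(\<Prod>i\<in>?J. ?m (Y (i - int n) \<inter> X i)) = (\<Prod>i\<in>?J. ?m (X i))"
    proof (rule prod.cong)
      fix i assume "i \<in> ?J"
      then have "Y (i - int n) = UNIV" using K disj by blast
      then show "?m (Y (i - int n) \<inter> X i) = ?m (X i)" by simp
    qed simp
    also have "(\<Prod>i\<in>?J. ?m (X i)) = measure coin_flips C"
      unfolding X(1) by (rule measure_cylinder(2)[symmetric]) (use X in auto)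
    also have "(\<Prod>i\<in>?K'. ?m (Y (i - int n) \<inter> X i)) = (\<Prod>i\<in>?K'. ?m (Y (i - int n)))"
    proof (rule prod.cong)
      fix i assume "i \<in> ?K'"
      then have "X i = UNIV" using disj by blast
      then show "?m (Y (i - int n) \<inter> X i) = ?m (Y (i - int n))" by simp
    qed simp
    also have "\<dots> = measure coin_flips C'"
      unfolding Y(1) by (subst prod.reindex) (use Y in \<open>auto simp: inj_on_def intro!: measure_cylinder(2)[symmetric]\<close>)
    finally show ?thesis by simp
  qed
  then show ?thesis unfolding eventually_sequentially by (intro exI[of _ "Suc (2 * b)"]) auto
qed

lemma shift_measurable [measurable]: "shift \<in> measurable coin_flips coin_flips"
proof (rule measurable_sigma_sets[OF cylinders_generator(4,2)])
  fix C assume "C \<in> cylinders"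
  then obtain X where X: "C = cylinder X" "finite {i. X i \<noteq> UNIV}" unfolding cylinders_def by auto
  have "shift -` C \<inter> space coin_flips = {w \<in> space coin_flips. \<forall>i\<in>{i. X i \<noteq> UNIV}. w (i + 1) \<in> X i}"
    unfolding X cylinder_def shift_def by auto
  also have "\<dots> \<in> sets coin_flips" unfolding coin_flips_def using X(2) by measurable
  finally show "shift -` C \<inter> space coin_flips \<in> sets coin_flips" .
qed simp

lemma pmp_shift: "pmp_system coin_flips shift"
proof -
  interpret prob_space coin_flips by (rule prob_space_coin_flips)
  have "distr coin_flips coin_flips shift = coin_flips"
  proof (rule measure_eqI_generator_eq[OF cylinders_generator(1,2), of _ _ "\<lambda>_. space coin_flips"])
    fix C assume C: "C \<in> cylinders"
    have "emeasure (distr coin_flips coin_flips shift) C = emeasure coin_flips (shift -` C)"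
      using cylinders_sets[OF C] by (simp add: emeasure_distr)
    also have "\<dots> = emeasure coin_flips C"
      using measure_shift_cylinder[OF C, of 1] by (simp add: emeasure_eq_measure)
    finally show "emeasure (distr coin_flips coin_flips shift) C = emeasure coin_flips C" .
  qed (use cylinders_generator in \<open>auto simp: emeasure_distr\<close>)
  then show ?thesis unfolding pmp_system_def using prob_space_coin_flips by simp
qed

lemma coin_flips_invertible: "invertible_pmp_system coin_flips shift"
proof -
  have m: "(\<lambda>w i. w (i - 1)) \<in> coin_flips \<rightarrow>\<^sub>M coin_flips"
    unfolding coin_flips_def
    by (rule measurable_PiM_single') (auto simp: space_PiM)
  show ?thesis
    unfolding invertible_pmp_system_def using pmp_shift
    by (intro conjI bexI[OF _ m]) (auto simp: shift_def)
qed

text \<open>Fixing \<open>n\<close> coordinates of \<open>w\<close> gives a cylinder of measure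
  \<open>(1/2) ^ n\<close> around it.\<close>

lemma coin_flips_atomless: "{w} \<in> null_sets coin_flips"
proof -
  interpret prob_space coin_flips by (rule prob_space_coin_flips)
  let ?X = "\<lambda>n i. if i \<in> {0..<int n} then {w i} else UNIV"
  have c: "cylinder (?X n) \<in> sets coin_flips" "measure coin_flips (cylinder (?X n)) = (1/2) ^ n" for n
  proof -
    have X: "?X n i = UNIV" if "i \<notin> {0..<int n}" for i using that by (rule if_not_P)
    show "cylinder (?X n) \<in> sets coin_flips" by (rule measure_cylinder(1)[where J = "{0..<int n}"]) (simp, rule X)
    have "measure coin_flips (cylinder (?X n)) = (\<Prod>i\<in>{0..<int n}. measure (measure_pmf (pmf_of_set UNIV)) (?X n i))"
      by (rule measure_cylinder(2)) (simp, rule X)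
    also have "\<dots> = (\<Prod>i\<in>{0..<int n}. 1/2)"
      by (rule prod.cong) (simp_all add: measure_pmf_single)
    finally show "measure coin_flips (cylinder (?X n)) = (1/2) ^ n" by simp
  qed
  have eq: "{w} = (\<Inter>i. {v \<in> space coin_flips. v i = w i})" by auto
  have s: "{w} \<in> sets coin_flips"
    unfolding eq coin_flips_def by (rule sets.countable_INT') (auto intro!: countableI_type)
  have "measure coin_flips {w} \<le> (1/2) ^ n" for n
    unfolding c(2)[symmetric] by (rule finite_measure_mono) (use c in \<open>auto simp: cylinder_def\<close>)
  then have "measure coin_flips {w} \<le> 0"
    by (intro LIMSEQ_le_const[OF LIMSEQ_power_zero[of "1/2 :: real"]]) auto
  then show ?thesis using s by (auto simp: null_sets_def emeasure_eq_measure measure_le_0_iff)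
qed

lemma pmp_measure_vimage:
  assumes "pmp_system M T" "A \<in> sets M"
  shows "measure M (T -` A \<inter> space M) = measure M A" "emeasure M (T -` A \<inter> space M) = emeasure M A"
proof -
  have T: "T \<in> measurable M M" and dT: "distr M M T = M" using assms(1) unfolding pmp_system_def by auto
  show "measure M (T -` A \<inter> space M) = measure M A" "emeasure M (T -` A \<inter> space M) = emeasure M A"
    using measure_distr[OF T assms(2)] emeasure_distr[OF T assms(2)] dT by simp_all
qed

lemma pmp_system_funpow: "pmp_system M T \<Longrightarrow> pmp_system M (T ^^ n)"
proof (induction n)
  case 0 then show ?case unfolding pmp_system_def by (simp add: distr_id id_def)
next
  case (Suc n)
  then have "T \<in> measurable M M" "T ^^ n \<in> measurable M M" "distr M M T = M" "distr M M (T ^^ n) = M" "prob_space M"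
    unfolding pmp_system_def by auto
  then show ?case
    unfolding pmp_system_def using distr_distr[of T M M "T ^^ n" M] by (simp add: measurable_comp)
qed

lemma pmp_system_product:
  assumes "pmp_system M T" "pmp_system N S"
  shows "pmp_system (M \<Otimes>\<^sub>M N) (map_prod T S)"
proof -
  have "prob_space M" "prob_space N" and [measurable]: "T \<in> measurable M M" "S \<in> measurable N N"
    using assms unfolding pmp_system_def by auto
  interpret M: prob_space M by fact
  interpret N: prob_space N by fact
  interpret MN: pair_prob_space M N ..
  show ?thesis
    using product_joining[OF assms] MN.prob_space_axioms
    unfolding joinings_def pmp_system_def by (simp add: map_prod_def)
qed

text \<open>For an invariant set \<open>A\<close>, mixing of the second factor makes \<open>A\<close> independent of the second
  coordinate, so that \<open>A\<close> defines an invariant measure on the first factor.\<close>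

lemma ergodic_product_mixing:
  assumes erg: "ergodic_system N S" and pW: "pmp_system W s"
    and G: "Int_stable G" "G \<subseteq> Pow (space W)" "space W \<in> G" "sets W = sigma_sets (space W) G"
    and mix: "\<And>C C'. C \<in> G \<Longrightarrow> C' \<in> G \<Longrightarrow>
      \<forall>\<^sub>F n in sequentially. measure W (((s ^^ n) -` C' \<inter> space W) \<inter> C) = measure W C' * measure W C"
  shows "ergodic_system (N \<Otimes>\<^sub>M W) (map_prod S s)"
proof -
  have pN: "pmp_system N S" using erg unfolding ergodic_system_def by simp
  have "prob_space N" "prob_space W" and S[measurable]: "S \<in> measurable N N" and s[measurable]: "s \<in> measurable W W"
    using pN pW unfolding pmp_system_def by auto
  interpret N: prob_space N by fact
  interpret W: prob_space W by fact
  interpret Z: pair_prob_space N W ..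
  let ?Z = "N \<Otimes>\<^sub>M W"
  let ?\<tau> = "map_prod S s"
  have pZ: "pmp_system ?Z ?\<tau>" by (rule pmp_system_product[OF pN pW])
  have pZn: "pmp_system ?Z (?\<tau> ^^ n)" for n by (rule pmp_system_funpow[OF pZ])
  have \<tau>n[measurable]: "?\<tau> ^^ n \<in> measurable ?Z ?Z" for n using pZn unfolding pmp_system_def by simp
  have Sn[measurable]: "S ^^ n \<in> measurable N N" for n using pmp_system_funpow[OF pN] unfolding pmp_system_def by simp
  have sn[measurable]: "s ^^ n \<in> measurable W W" for n using pmp_system_funpow[OF pW] unfolding pmp_system_def by simp
  have fp: "?\<tau> ^^ n = map_prod (S ^^ n) (s ^^ n)" for n by (induction n) auto
  have G_sets[measurable]: "C \<in> sets W" if "C \<in> G" for C using that G(4) by auto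
  have rect: "measure ?Z (U \<times> C) = measure N U * measure W C" if "U \<in> sets N" "C \<in> sets W" for U C
    using W.emeasure_pair_measure_Times[OF that] by (simp add: measure_def enn2real_mult)
  \<comment> \<open>The defect of independence, inside \<open>U\<close>, between being in
    \<open>A\<close> at time \<open>n\<close> and having second coordinate in \<open>C\<close>.
    Mixing makes it vanish eventually for rectangles \<open>A\<close>, and the sets \<open>A\<close>
    for which it tends to 0 form a Dynkin system. For an invariant \<open>A\<close> it does not
    depend on \<open>n\<close>, so it is then 0.\<close>
  define \<Delta> where "\<Delta> U C A n = measure ?Z (((?\<tau> ^^ n) -` A \<inter> space ?Z) \<inter> (U \<times> C)) -
     measure ?Z (((?\<tau> ^^ n) -` A \<inter> space ?Z) \<inter> (U \<times> space W)) * measure W C" for U C A n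
  let ?E = "{U \<times> C |U C. U \<in> sets N \<and> C \<in> G}"
  have spZ: "space ?Z = space N \<times> space W" by (simp add: space_pair_measure)
  have Epow: "?E \<subseteq> Pow (space ?Z)" using sets.space_closed G(2) unfolding spZ by blast
  have "sets ?Z = sets (sigma (space N \<times> space W) ?E)"
    by (rule sets_pair_eq[where Ca = "{space N}" and Cb = "{space W}"])
      (use G in \<open>auto simp: sets.sigma_sets_eq dest: sets.sets_into_space\<close>)
  also have "\<dots> = sigma_sets (space ?Z) ?E" using Epow unfolding spZ by (simp add: sets_measure_of)
  finally have Egen: "sets ?Z = sigma_sets (space ?Z) ?E" .
  have EInt: "Int_stable ?E" by (rule Int_stable_rectangles[OF algebra_generator(1)[OF sets_algebra(1)] G(1)])
  have lim: "\<Delta> U C A \<longlonglongrightarrow> 0" if U[measurable]: "U \<in> sets N" and C: "C \<in> G" and A: "A \<in> sets ?Z" for U C A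
  proof -
    have C'[measurable]: "C \<in> sets W" using C by simp
    have pre[measurable]: "(?\<tau> ^^ n) -` A \<inter> space ?Z \<in> sets ?Z" if "A \<in> sets ?Z" for A n
      using that by measurable
    have UC[measurable]: "U \<times> C \<in> sets ?Z" "U \<times> space W \<in> sets ?Z" by auto
    from EInt Epow A[unfolded Egen] show ?thesis
    proof (induction rule: sigma_sets_induct_disjoint)
      case (basic A)
      then obtain U' C' where A: "A = U' \<times> C'" "U' \<in> sets N" "C' \<in> G" by blast
      have [measurable]: "U' \<in> sets N" "C' \<in> sets W" using A by auto
      have 1: "((?\<tau> ^^ n) -` A \<inter> space ?Z) \<inter> (U \<times> D) = (((S ^^ n) -` U' \<inter> space N) \<inter> U) \<times> (((s ^^ n) -` C' \<inter> space W) \<inter> D)" for n D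
        unfolding A fp spZ by auto
      have "\<forall>\<^sub>F n in sequentially. \<Delta> U C A n = 0"
        using mix[OF C A(3)]
      proof eventually_elim
        case (elim n)
        have "measure W ((s ^^ n) -` C' \<inter> space W \<inter> space W) = measure W C'"
          using pmp_measure_vimage(1)[OF pmp_system_funpow[OF pW], of C' n] by simp
        then show ?case unfolding \<Delta>_def 1 using elim by (simp add: rect)
      qed
      then show ?case by (rule tendsto_eventually)
    next
      case empty
      then show ?case by (simp add: \<Delta>_def[abs_def])
    next
      case (compl A)
      then have A: "A \<in> sets ?Z" using Egen by simp
      have c: "measure ?Z (((?\<tau> ^^ n) -` (space ?Z - A) \<inter> space ?Z) \<inter> V) = measure ?Z V - measure ?Z (((?\<tau> ^^ n) -` A \<inter> space ?Z) \<inter> V)"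
        if V: "V \<in> sets ?Z" for V n
      proof -
        have "((?\<tau> ^^ n) -` (space ?Z - A) \<inter> space ?Z) \<inter> V = V - (((?\<tau> ^^ n) -` A \<inter> space ?Z) \<inter> V)"
          using measurable_space[OF \<tau>n[of n]] sets.sets_into_space[OF V] by auto
        then show ?thesis
          using pre[OF A] V by (simp add: Z.P.finite_measure_Diff)
      qed
      have "\<Delta> U C (space ?Z - A) n = - \<Delta> U C A n" for n
        unfolding \<Delta>_def c[OF UC(1)] c[OF UC(2)] by (simp add: rect W.prob_space algebra_simps)
      then show ?case using tendsto_minus[OF compl.IH] by simp
    next
      case (union A)
      then have A: "A i \<in> sets ?Z" for i using Egen by auto
      define a where "a k n = \<Delta> U C (A k) n" for k n
      have sumV: "(\<lambda>k. measure ?Z (((?\<tau> ^^ n) -` A k \<inter> space ?Z) \<inter> V)) sums measure ?Z (((?\<tau> ^^ n) -` (\<Union>k. A k) \<inter> space ?Z) \<inter> V)"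
        if V: "V \<in> sets ?Z" for V n
      proof -
        have "(\<lambda>k. measure ?Z (((?\<tau> ^^ n) -` A k \<inter> space ?Z) \<inter> V)) sums measure ?Z (\<Union>k. ((?\<tau> ^^ n) -` A k \<inter> space ?Z) \<inter> V)"
        proof (rule Z.P.finite_measure_UNION)
          show "range (\<lambda>k. ((?\<tau> ^^ n) -` A k \<inter> space ?Z) \<inter> V) \<subseteq> sets ?Z" using pre[OF A] V by auto
          show "disjoint_family (\<lambda>k. ((?\<tau> ^^ n) -` A k \<inter> space ?Z) \<inter> V)"
            using union(1) unfolding disjoint_family_on_def by blast
        qed
        also have "(\<Union>k. ((?\<tau> ^^ n) -` A k \<inter> space ?Z) \<inter> V) = ((?\<tau> ^^ n) -` (\<Union>k. A k) \<inter> space ?Z) \<inter> V" by auto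
        finally show ?thesis .
      qed
      have sums: "(\<lambda>k. a k n) sums \<Delta> U C (\<Union>k. A k) n" for n
        unfolding a_def \<Delta>_def by (intro sums_diff sums_mult2 sumV UC)
      have bnd: "\<bar>a k n\<bar> \<le> measure ?Z (A k)" for k n
      proof -
        let ?P = "(?\<tau> ^^ n) -` A k \<inter> space ?Z"
        have P: "measure ?Z ?P = measure ?Z (A k)" by (rule pmp_measure_vimage(1)[OF pZn A])
        have le: "measure ?Z (?P \<inter> V) \<le> measure ?Z (A k)" for V
          unfolding P[symmetric] using pre[OF A, of n k] by (intro Z.P.finite_measure_mono) auto
        have "measure ?Z (?P \<inter> (U \<times> space W)) * measure W C \<le> measure ?Z (A k) * 1"
          by (rule mult_mono[OF le W.prob_le_1]) simp_all
        moreover have "0 \<le> measure ?Z (?P \<inter> (U \<times> space W)) * measure W C" by simp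
        moreover have "0 \<le> measure ?Z (?P \<inter> (U \<times> C))" by simp
        moreover note le[of "U \<times> C"]
        ultimately show ?thesis unfolding a_def \<Delta>_def by (intro abs_leI) linarith+
      qed
      have sm: "summable (\<lambda>k. measure ?Z (A k))"
        using Z.P.finite_measure_UNION[of A] A union(1) by (auto simp: sums_iff)
      \<comment> \<open>Dominated convergence for series: the defects of the disjoint pieces are
        bounded, uniformly in \<open>n\<close>, by their summable measures.\<close>
      have "(\<lambda>n. \<Sum>k. a k n) \<longlonglongrightarrow> (\<Sum>k::nat. 0)"
      proof (rule tannerys_theorem[THEN conjunct2, THEN conjunct2])
        show "(\<lambda>n. a k n) \<longlonglongrightarrow> 0" for k using union(3)[of k] unfolding a_def by simp
        show "\<forall>\<^sub>F (k, n) in at_top \<times>\<^sub>F sequentially. norm (a k n) \<le> measure ?Z (A k)"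
          by (intro always_eventually) (auto simp: bnd)
      qed (use sm in auto)
      then show ?case using sums by (simp add: sums_iff)
    qed
  qed
  show ?thesis
    unfolding ergodic_system_def
  proof (intro conjI allI impI pZ)
    fix A assume "invariant_set ?Z ?\<tau> A"
    then have A[measurable]: "A \<in> sets ?Z" and inv: "?\<tau> -` A \<inter> space ?Z = A" unfolding invariant_set_def by auto
    have An: "(?\<tau> ^^ n) -` A \<inter> space ?Z = A" for n
    proof (induction n)
      case 0 then show ?case using sets.sets_into_space[OF A] by auto
    next
      case (Suc n)
      have "(?\<tau> ^^ Suc n) -` A \<inter> space ?Z = (?\<tau> ^^ n) -` (?\<tau> -` A \<inter> space ?Z) \<inter> space ?Z"
        using measurable_space[OF \<tau>n[of n]] by auto
      then show ?case using inv Suc by (simp add: comp_def)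
    qed
    have ind: "measure ?Z (A \<inter> (U \<times> C)) = measure ?Z (A \<inter> (U \<times> space W)) * measure W C" if "U \<in> sets N" "C \<in> G" for U C
      using lim[OF that A] unfolding \<Delta>_def An by (simp add: LIMSEQ_const_iff)
    define m where "m = distr (density ?Z (indicator A)) N fst"
    have em: "emeasure m U = emeasure ?Z (A \<inter> (U \<times> space W))" if U[measurable]: "U \<in> sets N" for U
    proof -
      have "emeasure m U = emeasure (density ?Z (indicator A)) (fst -` U \<inter> space ?Z)"
        unfolding m_def by (subst emeasure_distr) auto
      also have "\<dots> = emeasure ?Z (A \<inter> (fst -` U \<inter> space ?Z))"
        by (subst emeasure_density) (auto simp: indicator_inter_arith[symmetric])
      also have "A \<inter> (fst -` U \<inter> space ?Z) = A \<inter> (U \<times> space W)"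
        using sets.sets_into_space[OF A] by (auto simp: spZ)
      finally show ?thesis .
    qed
    have mU: "measure ?Z (A \<inter> (U \<times> space W)) = measure ?Z A * measure N U" if U: "U \<in> sets N" for U
    proof -
      have "measure m U = measure m (space N) * measure N U"
      proof (rule ergodic_invariant_dominated[OF erg _ _ _ U])
        show "sets m = sets N" unfolding m_def by simp
        fix B assume B[measurable]: "B \<in> sets N"
        have "emeasure m B \<le> emeasure ?Z (B \<times> space W)" unfolding em[OF B] by (rule emeasure_mono) auto
        also have "\<dots> = emeasure N B" by (simp add: W.emeasure_pair_measure_Times W.emeasure_space_1)
        finally show "emeasure m B \<le> emeasure N B" .
        have eq: "A \<inter> ((S -` B \<inter> space N) \<times> space W) = ?\<tau> -` (A \<inter> (B \<times> space W)) \<inter> space ?Z"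
          using inv measurable_space[OF s] by (auto simp: spZ)
        have "emeasure m (S -` B \<inter> space N) = emeasure ?Z (A \<inter> ((S -` B \<inter> space N) \<times> space W))"
          by (rule em) simp
        also have "\<dots> = emeasure ?Z (A \<inter> (B \<times> space W))"
          unfolding eq by (rule pmp_measure_vimage(2)[OF pZ]) simp
        finally show "emeasure m (S -` B \<inter> space N) = emeasure m B" by (simp only: em[OF B])
      qed
      moreover have "A \<inter> (space N \<times> space W) = A" using sets.sets_into_space[OF A] by (auto simp: spZ)
      ultimately show ?thesis using em[OF U] em[OF sets.top] by (simp add: measure_def)
    qed
    \<comment> \<open>Being independent of all rectangles over a generator, \<open>A\<close> is
      independent of every measurable set, in particular of itself.\<close>
    have "density ?Z (indicator A) = density ?Z (\<lambda>_. ennreal (measure ?Z A))"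
    proof (rule pair_measure_eqI_generators[OF algebra_generator[OF sets_algebra(1)] sets_algebra(2) G])
      have e1: "emeasure (density ?Z (indicator A)) V = emeasure ?Z (A \<inter> V)" if "V \<in> sets ?Z" for V
        using that by (subst emeasure_density) (auto simp: indicator_inter_arith[symmetric])
      have e2: "emeasure (density ?Z (\<lambda>_. ennreal (measure ?Z A))) V = ennreal (measure ?Z A) * emeasure ?Z V" if "V \<in> sets ?Z" for V
        using that by (subst emeasure_density) (auto simp: nn_integral_cmult)
      show "finite_measure (density ?Z (indicator A))"
        by (rule finite_measureI) (simp add: e1)
      show "finite_measure (density ?Z (\<lambda>_. ennreal (measure ?Z A)))"
        by (rule finite_measureI) (simp add: e2 Z.P.emeasure_space_1)
      fix U C assume U: "U \<in> sets N" and C: "C \<in> G"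
      have "measure ?Z (A \<inter> (U \<times> C)) = measure ?Z A * measure ?Z (U \<times> C)"
        using ind[OF U C] mU[OF U] U C by (simp add: rect)
      then show "measure (density ?Z (indicator A)) (U \<times> C) = measure (density ?Z (\<lambda>_. ennreal (measure ?Z A))) (U \<times> C)"
      proof -
        assume *: "measure ?Z (A \<inter> (U \<times> C)) = measure ?Z A * measure ?Z (U \<times> C)"
        have V: "U \<times> C \<in> sets ?Z" using U C by simp
        have "emeasure (density ?Z (indicator A)) (U \<times> C) = emeasure (density ?Z (\<lambda>_. ennreal (measure ?Z A))) (U \<times> C)"
          unfolding e1[OF V] e2[OF V] by (simp add: Z.P.emeasure_eq_measure * ennreal_mult)
        then show ?thesis by (simp add: measure_def)
      qed
    qed auto
    then have "emeasure (density ?Z (indicator A)) A = emeasure (density ?Z (\<lambda>_. ennreal (measure ?Z A))) A" by simp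
    then have "emeasure ?Z A = ennreal (measure ?Z A) * emeasure ?Z A"
      by (simp add: emeasure_density nn_integral_cmult flip: indicator_inter_arith)
    then have "measure ?Z A = measure ?Z A * measure ?Z A"
      by (metis Z.P.emeasure_eq_measure enn2real_ennreal enn2real_mult measure_nonneg)
    then have "measure ?Z A = 0 \<or> measure ?Z A = 1" by simp
    then show "emeasure ?Z A = 0 \<or> emeasure ?Z A = 1" by (auto simp: Z.P.emeasure_eq_measure)
  qed
qed

section \<open>Realisation on the unit interval\<close>

lemma unit_interval_measure_facts:
  "prob_space unit_interval_measure" "space unit_interval_measure = {0..1}"
  "sets unit_interval_measure = sets (restrict_space borel {0..1})"
  "id \<in> borel_measurable unit_interval_measure"
proof -
  show sp: "space unit_interval_measure = {0..1}"
    unfolding unit_interval_measure_def by (simp add: space_restrict_space)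
  show "sets unit_interval_measure = sets (restrict_space borel {0..1})"
    unfolding unit_interval_measure_def by (simp add: sets_restrict_space)
  show "id \<in> borel_measurable unit_interval_measure"
    unfolding unit_interval_measure_def by (rule measurable_restrict_space1) simp
  have "emeasure unit_interval_measure {0..1} = emeasure lborel {0..1::real}"
    unfolding unit_interval_measure_def by (rule emeasure_restrict_space) auto
  then show "prob_space unit_interval_measure"
    by (intro prob_spaceI) (simp add: sp)
qed

text \<open>The pointwise bijection of the interval required by \<open>MPT\<close> conjugates \<open>\<tau>\<close> on an invariant
  conull set on which \<open>\<Phi>\<close> and \<open>\<Psi>\<close> are mutually inverse, and is the identity elsewhere.\<close>

lemma MPT_model:
  fixes \<Phi> :: "'z \<Rightarrow> real"
  assumes erg: "ergodic_system Z \<tau>" and \<tau>': "\<tau>' \<in> measurable Z Z"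
    and \<tau>\<tau>': "\<And>z. z \<in> space Z \<Longrightarrow> \<tau>' (\<tau> z) = z" "\<And>z. z \<in> space Z \<Longrightarrow> \<tau> (\<tau>' z) = z"
    and \<Phi>: "\<Phi> \<in> measurable Z unit_interval_measure" and \<Psi>: "\<Psi> \<in> measurable unit_interval_measure Z"
    and dist: "distr Z unit_interval_measure \<Phi> = unit_interval_measure"
    and fix1: "{z \<in> space Z. \<Psi> (\<Phi> z) = z} \<in> sets Z" "AE z in Z. \<Psi> (\<Phi> z) = z"
  obtains S where "S \<in> MPT" "ergodic_system unit_interval_measure S" "AE z in Z. S (\<Phi> z) = \<Phi> (\<tau> z)"
proof -
  let ?U = unit_interval_measure
  note UF = unit_interval_measure_facts
  have pZ: "pmp_system Z \<tau>" using erg unfolding ergodic_system_def by simp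
  then have "prob_space Z" and \<tau>: "\<tau> \<in> measurable Z Z" and d\<tau>: "distr Z Z \<tau> = Z" unfolding pmp_system_def by auto
  note [measurable] = \<tau> \<tau>' \<Phi> \<Psi>
  interpret Z: prob_space Z by fact
  have d\<tau>': "distr Z Z \<tau>' = Z"
  proof -
    have "distr Z Z \<tau>' = distr (distr Z Z \<tau>) Z \<tau>'" by (simp only: d\<tau>)
    also have "\<dots> = distr Z Z (\<tau>' \<circ> \<tau>)" by (rule distr_distr) measurable
    also have "\<dots> = distr Z Z (\<lambda>z. z)" by (rule distr_cong) (auto simp: \<tau>\<tau>')
    finally show ?thesis by (simp add: distr_id2)
  qed
  have pZ': "pmp_system Z \<tau>'" unfolding pmp_system_def using d\<tau>' \<tau>' \<open>prob_space Z\<close> by simp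
  define Z0 where "Z0 = {z \<in> space Z. \<Psi> (\<Phi> z) = z}"
  have Z0[measurable]: "Z0 \<in> sets Z" using fix1(1) unfolding Z0_def .
  have ae0: "AE z in Z. z \<in> Z0" using fix1(2) AE_space by eventually_elim (simp add: Z0_def)
  \<comment> \<open>The points whose entire two-sided orbit stays in \<open>Z0\<close>. Invariance
    under \<open>\<tau>\<close> and under \<open>\<tau>'\<close> makes the lifts of the two maps
    inverse to each other at every point.\<close>
  define Z1 where "Z1 = {z \<in> space Z. \<forall>n. (\<tau> ^^ n) z \<in> Z0 \<and> (\<tau>' ^^ n) z \<in> Z0}"
  have mn[measurable]: "\<tau> ^^ n \<in> measurable Z Z" "\<tau>' ^^ n \<in> measurable Z Z" for n
    using pmp_system_funpow[OF pZ] pmp_system_funpow[OF pZ'] unfolding pmp_system_def by auto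
  have Z1[measurable]: "Z1 \<in> sets Z" unfolding Z1_def by measurable
  have aeZ1: "AE z in Z. z \<in> Z1"
  proof -
    have "AE z in Z. (\<tau> ^^ n) z \<in> Z0" "AE z in Z. (\<tau>' ^^ n) z \<in> Z0" for n
    proof -
      have d: "distr Z Z (\<tau> ^^ n) = Z" "distr Z Z (\<tau>' ^^ n) = Z"
        using pmp_system_funpow[OF pZ] pmp_system_funpow[OF pZ'] unfolding pmp_system_def by auto
      have "AE z in distr Z Z (\<tau> ^^ n). z \<in> Z0" unfolding d by (rule ae0)
      then show "AE z in Z. (\<tau> ^^ n) z \<in> Z0" by (rule AE_distrD[rotated]) measurable
      have "AE z in distr Z Z (\<tau>' ^^ n). z \<in> Z0" unfolding d by (rule ae0)
      then show "AE z in Z. (\<tau>' ^^ n) z \<in> Z0" by (rule AE_distrD[rotated]) measurable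
    qed
    then have "AE z in Z. \<forall>n. (\<tau> ^^ n) z \<in> Z0" "AE z in Z. \<forall>n. (\<tau>' ^^ n) z \<in> Z0"
      by (simp_all add: AE_all_countable)
    then show ?thesis using AE_space by eventually_elim (simp add: Z1_def)
  qed
  have Z1sp: "z \<in> space Z" if "z \<in> Z1" for z using that unfolding Z1_def by simp
  have Z1\<Psi>: "\<Psi> (\<Phi> z) = z" if "z \<in> Z1" for z
  proof -
    have "(\<tau> ^^ 0) z \<in> Z0" using that unfolding Z1_def by blast
    then show ?thesis unfolding Z0_def by simp
  qed
  have Z1\<tau>: "\<tau> z \<in> Z1" if z: "z \<in> Z1" for z
  proof -
    have "(\<tau> ^^ n) (\<tau> z) \<in> Z0" for n
    proof -
      have "(\<tau> ^^ Suc n) z \<in> Z0" using z unfolding Z1_def by blast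
      then show ?thesis by (simp add: funpow_swap1)
    qed
    moreover have "(\<tau>' ^^ n) (\<tau> z) \<in> Z0" for n
    proof (cases n)
      case 0
      have "(\<tau> ^^ 1) z \<in> Z0" using z unfolding Z1_def by blast
      then show ?thesis using 0 by simp
    next
      case (Suc m)
      have "(\<tau>' ^^ m) z \<in> Z0" using z unfolding Z1_def by blast
      then show ?thesis using Suc \<tau>\<tau>'(1)[OF Z1sp[OF z]] by (simp add: funpow_swap1)
    qed
    ultimately show ?thesis unfolding Z1_def using measurable_space[OF \<tau> Z1sp[OF z]] by simp
  qed
  have Z1\<tau>': "\<tau>' z \<in> Z1" if z: "z \<in> Z1" for z
  proof -
    have "(\<tau>' ^^ n) (\<tau>' z) \<in> Z0" for n
    proof -
      have "(\<tau>' ^^ Suc n) z \<in> Z0" using z unfolding Z1_def by blast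
      then show ?thesis by (simp add: funpow_swap1)
    qed
    moreover have "(\<tau> ^^ n) (\<tau>' z) \<in> Z0" for n
    proof (cases n)
      case 0
      have "(\<tau>' ^^ 1) z \<in> Z0" using z unfolding Z1_def by blast
      then show ?thesis using 0 by simp
    next
      case (Suc m)
      have "(\<tau> ^^ m) z \<in> Z0" using z unfolding Z1_def by blast
      then show ?thesis using Suc \<tau>\<tau>'(2)[OF Z1sp[OF z]] by (simp add: funpow_swap1)
    qed
    ultimately show ?thesis unfolding Z1_def using measurable_space[OF \<tau>' Z1sp[OF z]] by simp
  qed
  have id[measurable]: "(\<lambda>u. u) \<in> borel_measurable ?U" using UF(4) by (simp add: id_def)
  have \<Phi>b[measurable]: "\<Phi> \<in> borel_measurable Z"
    using measurable_compose[OF \<Phi> id] by simp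
  define U1 where "U1 = {u \<in> space ?U. \<Psi> u \<in> Z1 \<and> \<Phi> (\<Psi> u) = u}"
  have U1[measurable]: "U1 \<in> sets ?U" unfolding U1_def by measurable
  have \<Phi>U1: "\<Phi> z \<in> U1" if "z \<in> Z1" for z
    using that Z1\<Psi>[OF that] measurable_space[OF \<Phi> Z1sp[OF that]] unfolding U1_def by simp
  define lift where "lift \<sigma> u = (if u \<in> U1 then \<Phi> (\<sigma> (\<Psi> u)) else u)" for \<sigma> u
  have lift_meas: "lift \<sigma> \<in> measurable ?U ?U" if [measurable]: "\<sigma> \<in> measurable Z Z" for \<sigma>
    unfolding lift_def[abs_def] by measurable
  have lift_Z1: "lift \<sigma> (\<Phi> z) = \<Phi> (\<sigma> z)" if "z \<in> Z1" for \<sigma> z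
    using that \<Phi>U1[OF that] Z1\<Psi>[OF that] unfolding lift_def by simp
  have lift_inv: "lift \<rho> (lift \<sigma> u) = u"
    if "\<And>z. z \<in> Z1 \<Longrightarrow> \<sigma> z \<in> Z1" "\<And>z. z \<in> Z1 \<Longrightarrow> \<rho> (\<sigma> z) = z" for \<sigma> \<rho> u
  proof (cases "u \<in> U1")
    case True
    then have u: "\<Psi> u \<in> Z1" "\<Phi> (\<Psi> u) = u" unfolding U1_def by auto
    have "lift \<sigma> u = \<Phi> (\<sigma> (\<Psi> u))" using True by (simp add: lift_def)
    then show ?thesis using lift_Z1[OF that(1)[OF u(1)]] that(2)[OF u(1)] u(2) by simp
  qed (simp add: lift_def)
  define S where "S = lift \<tau>"
  have S[measurable]: "S \<in> measurable ?U ?U" unfolding S_def by (rule lift_meas) measurable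
  have aeS: "AE z in Z. S (\<Phi> z) = \<Phi> (\<tau> z)"
    using aeZ1 by eventually_elim (simp add: S_def lift_Z1)
  have dS: "distr ?U ?U S = ?U"
  proof -
    have "distr ?U ?U S = distr (distr Z ?U \<Phi>) ?U S" by (simp only: dist)
    also have "\<dots> = distr Z ?U (S \<circ> \<Phi>)" by (rule distr_distr) measurable
    also have "\<dots> = distr Z ?U (\<Phi> \<circ> \<tau>)"
      by (rule distr_cong_AE) (use aeS in auto)
    also have "\<dots> = distr (distr Z Z \<tau>) ?U \<Phi>" by (rule distr_distr[symmetric]) measurable
    also have "\<dots> = ?U" by (simp only: d\<tau> dist)
    finally show ?thesis .
  qed
  have pS: "pmp_system ?U S" unfolding pmp_system_def using UF(1) S dS by simp
  have "S \<in> MPT"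
    unfolding MPT_def invertible_pmp_system_def
  proof (intro CollectI conjI pS bexI[of _ "lift \<tau>'"] ballI)
    show "lift \<tau>' \<in> measurable ?U ?U" by (rule lift_meas) measurable
    show "lift \<tau>' (S u) = u" for u
      unfolding S_def by (rule lift_inv) (use Z1\<tau> \<tau>\<tau>' Z1sp in auto)
    show "S (lift \<tau>' u) = u" for u
      unfolding S_def by (rule lift_inv) (use Z1\<tau>' \<tau>\<tau>' Z1sp in auto)
  qed
  moreover have "ergodic_system ?U S"
    unfolding ergodic_system_def
  proof (intro conjI pS allI impI)
    fix A assume "invariant_set ?U S A"
    then have A[measurable]: "A \<in> sets ?U" and inv: "S -` A \<inter> space ?U = A" unfolding invariant_set_def by auto
    define B where "B = \<Phi> -` A \<inter> space Z"
    have B[measurable]: "B \<in> sets Z" unfolding B_def by measurable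
    \<comment> \<open>\<open>S\<close> and \<open>\<tau>\<close> are conjugate over
      \<open>Z1\<close>, so the preimage of an \<open>S\<close>-invariant set is shown to be
      invariant up to a null set, which is what \<open>ergodic_almost_invariant\<close>
      takes.\<close>
    have iffZ1: "z \<in> B \<longleftrightarrow> z \<in> \<tau> -` B \<inter> space Z" if "z \<in> Z1" for z
    proof -
      have "S (\<Phi> z) = \<Phi> (\<tau> z)" using that by (simp add: S_def lift_Z1)
      moreover have "\<Phi> z \<in> space ?U" "\<tau> z \<in> space Z"
        using measurable_space[OF \<Phi> Z1sp[OF that]] measurable_space[OF \<tau> Z1sp[OF that]] by auto
      moreover have "\<Phi> z \<in> A \<longleftrightarrow> \<Phi> z \<in> S -` A \<inter> space ?U" using inv by simp
      ultimately show ?thesis using Z1sp[OF that] unfolding B_def by simp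
    qed
    have iff: "AE z in Z. z \<in> B \<longleftrightarrow> z \<in> \<tau> -` B \<inter> space Z"
      using aeZ1 by eventually_elim (rule iffZ1)
    have "emeasure Z (B - \<tau> -` B \<inter> space Z) = emeasure Z {}" "emeasure Z (\<tau> -` B \<inter> space Z - B) = emeasure Z {}"
      by (rule emeasure_eq_AE; use iff in \<open>auto elim!: eventually_mono\<close>)+
    then have "emeasure Z B = 0 \<or> emeasure Z B = 1"
      by (intro ergodic_almost_invariant[OF erg B]) simp_all
    moreover have "emeasure ?U A = emeasure Z B"
      unfolding B_def by (subst dist[symmetric]) (simp add: emeasure_distr)
    ultimately show "emeasure ?U A = 0 \<or> emeasure ?U A = 1" by simp
  qed
  ultimately show thesis using that aeS by blast
qed

text \<open>The distribution function of an atomless measure on the line and the quantile function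
  are mutually inverse up to null sets.\<close>

lemma unit_interval_isomorphism:
  fixes Z :: "'z measure"
  assumes pZ: "prob_space Z" and ret: "measurable_retract Z cantor_space"
    and atomless: "\<And>z. z \<in> space Z \<Longrightarrow> \<exists>A \<in> null_sets Z. z \<in> A"
  obtains \<Phi> :: "'z \<Rightarrow> real" and \<Psi> where
    "\<Phi> \<in> measurable Z unit_interval_measure" "\<Psi> \<in> measurable unit_interval_measure Z"
    "distr Z unit_interval_measure \<Phi> = unit_interval_measure"
    "{z \<in> space Z. \<Psi> (\<Phi> z) = z} \<in> sets Z" "AE z in Z. \<Psi> (\<Phi> z) = z"
proof -
  let ?U = unit_interval_measure
  note UF = unit_interval_measure_facts
  interpret Z: prob_space Z by fact
  interpret U: prob_space ?U by (rule UF(1))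
  obtain e r where e[measurable]: "e \<in> borel_measurable Z" and r[measurable]: "r \<in> measurable (borel :: real measure) Z"
    and re: "\<And>z. z \<in> space Z \<Longrightarrow> r (e z) = z"
    using measurable_retract_unit_interval[OF ret] by metis
  define \<nu> where "\<nu> = distr Z borel e"
  interpret \<nu>: cdf_distribution \<nu>
    unfolding \<nu>_def cdf_distribution_def by (rule Z.real_distribution_distr) measurable
  \<comment> \<open>The coding \<open>e\<close> is injective on the space, so its fibres have at
    most one point and lie in null sets by assumption.\<close>
  have at: "measure \<nu> {t} = 0" for t
  proof -
    have "emeasure \<nu> {t} = emeasure Z (e -` {t} \<inter> space Z)"
      unfolding \<nu>_def by (simp add: emeasure_distr)
    also have "\<dots> = 0"
    proof (cases "e -` {t} \<inter> space Z = {}")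
      case False
      then obtain z where z: "z \<in> space Z" "e z = t" by auto
      obtain A where A: "A \<in> null_sets Z" "z \<in> A" using atomless[OF z(1)] by blast
      have "e -` {t} \<inter> space Z \<subseteq> A"
      proof
        fix y assume "y \<in> e -` {t} \<inter> space Z"
        then have y: "y \<in> space Z" "e y = e z" using z by auto
        have "y = r (e y)" by (rule re[OF y(1), symmetric])
        also have "\<dots> = z" unfolding y(2) by (rule re[OF z(1)])
        finally have "y = z" .
        then show "y \<in> A" using A by simp
      qed
      then have "e -` {t} \<inter> space Z \<in> null_sets Z"
        by (intro null_sets_subset[OF A(1)]) auto
      then show ?thesis by auto
    qed simp
    finally show ?thesis by (simp add: measure_def)
  qed
  \<comment> \<open>The quantile function on the open interval. At the endpoints the infimum may run
    over an empty or an unbounded set; the default 0 there matters only on a null set.\<close>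
  define G where "G u = (if u \<in> {0<..<1} then Inf {x. u \<le> cdf \<nu> x} else 0)" for u
  have G[measurable]: "G \<in> borel_measurable borel"
    unfolding G_def[abs_def] using \<nu>.measurable_CI
    by (subst (asm) measurable_restrict_space_iff[of _ _ 0]) auto
  \<comment> \<open>Without atoms the distribution function is continuous; left of
    \<open>G u\<close> its values are at most \<open>u\<close>, so its value at \<open>G u\<close>
    is exactly \<open>u\<close>.\<close>
  have FG: "cdf \<nu> (G u) = u" if u: "u \<in> {0<..<1}" for u
  proof (rule antisym)
    have ps: "u \<le> cdf \<nu> x \<longleftrightarrow> G u \<le> x" for x
      using \<nu>.pseudoinverse[of u x] u unfolding G_def by simp
    show "u \<le> cdf \<nu> (G u)" using ps by simp
    have "isCont (cdf \<nu>) (G u)" using at by (simp add: \<nu>.isCont_cdf)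
    then have "(cdf \<nu> \<longlongrightarrow> cdf \<nu> (G u)) (at_left (G u))"
      unfolding isCont_def by (rule tendsto_within_subset) simp
    then show "cdf \<nu> (G u) \<le> u"
    proof (rule tendsto_upperbound)
      show "\<forall>\<^sub>F x in at_left (G u). cdf \<nu> x \<le> u"
      proof -
        have "cdf \<nu> x \<le> u" if "x < G u" for x
          using ps[of x] that by linarith
        then show ?thesis unfolding eventually_at_filter by (intro always_eventually) simp
      qed
    qed simp
  qed
  have id[measurable]: "(\<lambda>u. u) \<in> borel_measurable ?U" using UF(4) by (simp add: id_def)
  have GU[measurable]: "G \<in> borel_measurable ?U" by (rule measurable_compose[OF id G])
  have ae01: "AE u in ?U. u \<in> {0<..<1}"
  proof -
    have "emeasure ?U {0, 1} = emeasure lborel {0, 1::real}"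
      unfolding unit_interval_measure_def by (rule emeasure_restrict_space) auto
    also have "\<dots> = 0" by (rule emeasure_lborel_countable) simp
    finally have "{0, 1} \<in> null_sets ?U"
      using sets_restrict_space_iff[of "{0..1}" borel "{0, 1::real}"] by (auto simp: null_sets_def UF(3))
    from AE_not_in[OF this] AE_space show ?thesis
      by eventually_elim (auto simp: UF(2))
  qed
  have dG: "distr ?U borel G = \<nu>"
  proof -
    \<comment> \<open>The law of the quantile function is available for Lebesgue measure on the open
      interval, from which the closed interval differs by a null set.\<close>
    have "distr ?U borel G = distr (restrict_space lborel {0<..<1}) borel (\<lambda>\<omega>. Inf {x. \<omega> \<le> cdf \<nu> x})"
    proof (rule measure_eqI)
      fix A assume "A \<in> sets (distr ?U borel G)"
      then have A[measurable]: "A \<in> sets borel" by simp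
      have "emeasure (distr ?U borel G) A = emeasure ?U (G -` A \<inter> space ?U)"
        by (simp add: emeasure_distr)
      also have "\<dots> = emeasure ?U ((G -` A \<inter> space ?U) \<inter> {0<..<1})"
      proof (rule emeasure_eq_AE)
        show "AE u in ?U. u \<in> G -` A \<inter> space ?U \<longleftrightarrow> u \<in> (G -` A \<inter> space ?U) \<inter> {0<..<1}"
          using ae01 by eventually_elim simp
        have "{0<..<1::real} \<in> sets ?U"
          using sets_restrict_space_iff[of "{0..1}" borel "{0<..<1::real}"] by (auto simp: UF(3))
        then show "(G -` A \<inter> space ?U) \<inter> {0<..<1} \<in> sets ?U" by measurable
      qed measurable
      also have "\<dots> = emeasure lborel ((G -` A \<inter> space ?U) \<inter> {0<..<1})"
        unfolding unit_interval_measure_def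
        by (rule emeasure_restrict_space) (auto simp: space_restrict_space)
      also have "(G -` A \<inter> space ?U) \<inter> {0<..<1} = (\<lambda>\<omega>. Inf {x. \<omega> \<le> cdf \<nu> x}) -` A \<inter> {0<..<1}"
        by (auto simp: G_def UF(2))
      also have "emeasure lborel \<dots> = emeasure (restrict_space lborel {0<..<1}) ((\<lambda>\<omega>. Inf {x. \<omega> \<le> cdf \<nu> x}) -` A \<inter> {0<..<1})"
        by (rule emeasure_restrict_space[symmetric]) auto
      also have "\<dots> = emeasure (distr (restrict_space lborel {0<..<1}) borel (\<lambda>\<omega>. Inf {x. \<omega> \<le> cdf \<nu> x})) A"
      proof (subst emeasure_distr)
        show "(\<lambda>\<omega>. Inf {x. \<omega> \<le> cdf \<nu> x}) \<in> borel_measurable (restrict_space lborel {0<..<1})"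
          using \<nu>.measurable_CI by (simp cong: measurable_cong_sets add: sets_restrict_space measurable_def space_restrict_space)
      qed (auto simp: space_restrict_space)
      finally show "emeasure (distr ?U borel G) A = emeasure (distr (restrict_space lborel {0<..<1}) borel (\<lambda>\<omega>. Inf {x. \<omega> \<le> cdf \<nu> x})) A" .
    qed simp
    then show ?thesis using \<nu>.distr_I_eq_M by simp
  qed
  define \<Phi> where "\<Phi> z = cdf \<nu> (e z)" for z
  define \<Psi> where "\<Psi> u = r (G u)" for u
  have [measurable]: "cdf \<nu> \<in> borel_measurable borel" by (rule \<nu>.measurable_C)
  have \<Phi>b[measurable]: "\<Phi> \<in> borel_measurable Z" unfolding \<Phi>_def by measurable
  have \<Phi>[measurable]: "\<Phi> \<in> measurable Z ?U"
  proof -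
    have "\<Phi> \<in> measurable Z (restrict_space borel {0..1})"
      by (rule measurable_restrict_space2) (auto simp: \<Phi>_def \<nu>.cdf_nonneg \<nu>.cdf_bounded_prob)
    then show ?thesis unfolding measurable_cong_sets[OF refl UF(3)] .
  qed
  have \<Psi>[measurable]: "\<Psi> \<in> measurable ?U Z" unfolding \<Psi>_def by measurable
  have d\<Psi>: "distr ?U Z \<Psi> = Z"
  proof -
    have "distr ?U Z \<Psi> = distr (distr ?U borel G) Z r"
      unfolding \<Psi>_def by (subst distr_distr) (auto simp: comp_def)
    also have "\<dots> = distr Z Z (r \<circ> e)" unfolding dG \<nu>_def by (rule distr_distr) measurable
    also have "\<dots> = distr Z Z (\<lambda>z. z)" by (rule distr_cong) (auto simp: re)
    finally show ?thesis by (simp add: distr_id2)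
  qed
  have aeer: "AE u in ?U. e (r (G u)) = G u"
  proof -
    have "AE t in distr Z borel e. e (r t) = t"
      by (subst AE_distr_iff) (auto simp: re)
    then have "AE t in distr ?U borel G. e (r t) = t" unfolding dG unfolding \<nu>_def .
    then show ?thesis by (subst (asm) AE_distr_iff) auto
  qed
  have ae\<Phi>\<Psi>: "AE u in ?U. \<Phi> (\<Psi> u) = u"
    using aeer ae01 by eventually_elim (simp add: \<Phi>_def \<Psi>_def FG)
  \<comment> \<open>The injective coding \<open>e\<close> turns an equality in \<open>Z\<close> into
    an equality of real functions, which defines a measurable set.\<close>
  have good: "{z \<in> space Z. \<Psi> (\<Phi> z) = z} = {z \<in> space Z. e (\<Psi> (\<Phi> z)) = e z}"
    using re measurable_space[OF measurable_compose[OF \<Phi> \<Psi>]] by (auto) (metis re)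
  have good_sets: "{z \<in> space Z. \<Psi> (\<Phi> z) = z} \<in> sets Z"
    unfolding good by measurable
  show thesis
  proof (rule that[OF \<Phi> \<Psi> _ good_sets])
    have "distr Z ?U \<Phi> = distr (distr ?U Z \<Psi>) ?U \<Phi>" by (simp only: d\<Psi>)
    also have "\<dots> = distr ?U ?U (\<Phi> \<circ> \<Psi>)" by (rule distr_distr) measurable
    also have "\<dots> = distr ?U ?U (\<lambda>u. u)" by (rule distr_cong_AE) (use ae\<Phi>\<Psi> in auto)
    finally show "distr Z ?U \<Phi> = ?U" by (simp add: distr_id2)
    have "AE u in ?U. \<Psi> (\<Phi> (\<Psi> u)) = \<Psi> u" using ae\<Phi>\<Psi> by eventually_elim simp
    then have "AE z in distr ?U Z \<Psi>. \<Psi> (\<Phi> z) = z"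
      by (subst AE_distr_iff) (use good_sets in auto)
    then show "AE z in Z. \<Psi> (\<Phi> z) = z" by (simp only: d\<Psi>)
  qed
qed

lemma measure_pair_slab:
  assumes "prob_space W" "V \<in> sets K"
  shows "measure (K \<Otimes>\<^sub>M W) (V \<times> space W) = measure K V"
proof -
  interpret W: prob_space W by fact
  show ?thesis
    using W.emeasure_pair_measure_Times[OF assms(2) sets.top] by (simp add: measure_def W.emeasure_space_1)
qed

text \<open>The product with a Bernoulli shift is still ergodic and is atomless even if \<open>N\<close> is a finite
  cycle, so it can be realised on the unit interval; joinings with \<open>N\<close> lift to joinings with it.\<close>

lemma disjoint_from_standard_ergodic:
  assumes pM: "pmp_system M T"
    and disj: "\<And>S. S \<in> MPT \<Longrightarrow> ergodic_system unit_interval_measure S \<Longrightarrow> disjoint_systems M T unit_interval_measure S"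
    and erg: "ergodic_system N S" and S'[measurable]: "S' \<in> measurable N N"
    and SS': "\<And>y. y \<in> space N \<Longrightarrow> S' (S y) = y" "\<And>y. y \<in> space N \<Longrightarrow> S (S' y) = y"
    and ret: "measurable_retract N cantor_space"
  shows "disjoint_systems M T N S"
proof -
  let ?U = unit_interval_measure and ?W = coin_flips
  let ?Z = "N \<Otimes>\<^sub>M ?W"
  let ?\<tau> = "map_prod S shift"
  note UF = unit_interval_measure_facts
  have pN: "pmp_system N S" using erg unfolding ergodic_system_def by simp
  have "prob_space M" and T[measurable]: "T \<in> measurable M M" and "prob_space N" and S[measurable]: "S \<in> measurable N N"
    using pM pN unfolding pmp_system_def by auto
  interpret M: prob_space M by fact
  interpret N: prob_space N by fact
  interpret W: prob_space ?W by (rule prob_space_coin_flips)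
  interpret U: prob_space ?U by (rule UF(1))
  interpret Z: pair_prob_space N ?W ..
  have spZ: "space ?Z = space N \<times> UNIV" by (simp add: space_pair_measure)
  have ergZ: "ergodic_system ?Z ?\<tau>"
    by (rule ergodic_product_mixing[OF erg pmp_shift cylinders_generator(1-3,4)]) (use shift_mixing in auto)
  obtain s' where s'[measurable]: "s' \<in> measurable ?W ?W" and ss': "\<And>w. s' (shift w) = w" "\<And>w. shift (s' w) = w"
    using coin_flips_invertible unfolding invertible_pmp_system_def by auto
  have m': "map_prod S' s' \<in> measurable ?Z ?Z" unfolding map_prod_def by measurable
  have \<tau>[measurable]: "?\<tau> \<in> measurable ?Z ?Z" unfolding map_prod_def by measurable
  obtain \<Phi> :: "'b \<times> (int \<Rightarrow> bool) \<Rightarrow> real" and \<Psi> where \<Phi>[measurable]: "\<Phi> \<in> measurable ?Z ?U" and \<Psi>[measurable]: "\<Psi> \<in> measurable ?U ?Z"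
    and dist: "distr ?Z ?U \<Phi> = ?U" and fix1: "{z \<in> space ?Z. \<Psi> (\<Phi> z) = z} \<in> sets ?Z" "AE z in ?Z. \<Psi> (\<Phi> z) = z"
  proof (rule unit_interval_isomorphism[OF Z.prob_space_axioms measurable_retract_pair[OF ret measurable_retract_coin_flips]])
    fix z assume z: "z \<in> space ?Z"
    have w: "{snd z} \<in> sets ?W" "emeasure ?W {snd z} = 0" using coin_flips_atomless[of "snd z"] by auto
    have "space N \<times> {snd z} \<in> null_sets ?Z"
      using w W.emeasure_pair_measure_Times[of "space N" N "{snd z}"] by (auto simp: null_sets_def)
    then show "\<exists>A \<in> null_sets ?Z. z \<in> A"
      using z by (intro bexI[of _ "space N \<times> {snd z}"]) (auto simp: spZ)
  qed
  obtain Q where Q: "Q \<in> MPT" "ergodic_system ?U Q" "AE z in ?Z. Q (\<Phi> z) = \<Phi> (?\<tau> z)"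
  proof (rule MPT_model[OF ergZ m' _ _ \<Phi> \<Psi> dist fix1])
    show "map_prod S' s' (?\<tau> z) = z" if "z \<in> space ?Z" for z using that SS'(1) by (auto simp: spZ ss')
    show "?\<tau> (map_prod S' s' z) = z" if "z \<in> space ?Z" for z using that SS'(2) by (auto simp: spZ ss')
  qed
  have pQ: "pmp_system ?U Q" using Q(2) unfolding ergodic_system_def by simp
  then have Qm[measurable]: "Q \<in> measurable ?U ?U" unfolding pmp_system_def by simp
  have dQ: "disjoint_systems M T ?U Q" by (rule disj[OF Q(1,2)])
  have "measure K (A \<times> B) = measure M A * measure N B"
    if J: "K \<in> joinings M T N S" and A[measurable]: "A \<in> sets M" and B[measurable]: "B \<in> sets N" for K A B
  proof -
    note JD = joiningsD[OF J]
    interpret K: prob_space K by (rule JD(2))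
    have sK[measurable_cong]: "sets K = sets (M \<Otimes>\<^sub>M N)" by (rule JD(1))
    have spK: "space K = space M \<times> space N" by (rule JD(3))
    have TS[measurable]: "map_prod T S \<in> measurable K K" unfolding map_prod_def by measurable
    have pK: "pmp_system K (map_prod T S)"
      using J TS JD(2) unfolding joinings_def pmp_system_def by simp
    interpret KW: pair_prob_space K ?W ..
    \<comment> \<open>The lifted joining: an independent Bernoulli coordinate is added to
      \<open>K\<close>, and the second and third coordinates together are carried to the interval by
      \<open>\<Phi>\<close>.\<close>
    let ?K = "K \<Otimes>\<^sub>M ?W"
    have spKW: "space ?K = (space M \<times> space N) \<times> UNIV" by (simp add: space_pair_measure spK)
    let ?\<rho> = "map_prod (map_prod T S) shift"
    have p\<rho>: "pmp_system ?K ?\<rho>" by (rule pmp_system_product[OF pK pmp_shift])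
    define zz :: "('a \<times> 'b) \<times> (int \<Rightarrow> bool) \<Rightarrow> 'b \<times> (int \<Rightarrow> bool)" where "zz k = (snd (fst k), snd k)" for k
    have fsts[measurable]: "(\<lambda>k. fst (fst k)) \<in> measurable ?K M" "(\<lambda>k. snd (fst k)) \<in> measurable ?K N" by measurable
    have zz[measurable]: "zz \<in> measurable ?K ?Z" unfolding zz_def by measurable
    have dzz: "distr ?K ?Z zz = ?Z"
    proof -
      have "distr K N snd \<Otimes>\<^sub>M distr ?W ?W (\<lambda>w. w) = distr ?K ?Z (\<lambda>(a, w). (snd a, w))"
      proof (rule pair_measure_distr)
        show "sigma_finite_measure (distr ?W ?W (\<lambda>w. w))" using W.sigma_finite_measure_axioms by (simp add: distr_id2)
      qed measurable
      moreover have "distr K N snd = N" using J unfolding joinings_def by simp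
      moreover have "(\<lambda>(a, w). (snd a, w)) = zz" by (auto simp: zz_def)
      ultimately show ?thesis by (simp add: distr_id2)
    qed
    have aezz: "AE k in ?K. P (zz k)" if "AE z in ?Z. P z" for P
      by (rule AE_distrD[OF zz]) (unfold dzz, rule that)
    define \<theta> where "\<theta> k = (fst (fst k), \<Phi> (zz k))" for k
    have \<theta>[measurable]: "\<theta> \<in> measurable ?K (M \<Otimes>\<^sub>M ?U)" unfolding \<theta>_def by measurable
    define K' where "K' = distr ?K (M \<Otimes>\<^sub>M ?U) \<theta>"
    have m: "measure K' (C \<times> D) = measure ?K {k \<in> space ?K. fst (fst k) \<in> C \<and> \<Phi> (zz k) \<in> D}"
      if [measurable]: "C \<in> sets M" "D \<in> sets ?U" for C D
    proof -
      have "measure K' (C \<times> D) = measure ?K (\<theta> -` (C \<times> D) \<inter> space ?K)"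
        unfolding K'_def by (rule measure_distr) measurable
      also have "\<theta> -` (C \<times> D) \<inter> space ?K = {k \<in> space ?K. fst (fst k) \<in> C \<and> \<Phi> (zz k) \<in> D}"
        by (auto simp: \<theta>_def)
      finally show ?thesis .
    qed
    have mZ: "measure ?K {k \<in> space ?K. zz k \<in> V} = measure ?Z V" if V[measurable]: "V \<in> sets ?Z" for V
    proof -
      have "measure ?Z V = measure (distr ?K ?Z zz) V" by (simp only: dzz)
      also have "\<dots> = measure ?K (zz -` V \<inter> space ?K)" by (rule measure_distr) measurable
      also have "zz -` V \<inter> space ?K = {k \<in> space ?K. zz k \<in> V}" by auto
      finally show ?thesis by simp
    qed
    have mU: "measure ?U D = measure ?Z (\<Phi> -` D \<inter> space ?Z)" if [measurable]: "D \<in> sets ?U" for D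
    proof -
      have "measure ?U D = measure (distr ?Z ?U \<Phi>) D" by (simp only: dist)
      also have "\<dots> = measure ?Z (\<Phi> -` D \<inter> space ?Z)" by (rule measure_distr) measurable
      finally show ?thesis .
    qed
    have "K' \<in> joinings M T ?U Q"
    proof (rule joiningsI[OF _ _ T Qm sets_algebra sets_algebra M.prob_space_axioms U.prob_space_axioms])
      show "sets K' = sets (M \<Otimes>\<^sub>M ?U)" unfolding K'_def by simp
      show "prob_space K'" unfolding K'_def by (rule KW.P.prob_space_distr) measurable
      fix C assume C[measurable]: "C \<in> sets M"
      have "{k \<in> space ?K. fst (fst k) \<in> C \<and> \<Phi> (zz k) \<in> space ?U} = (C \<times> space N) \<times> space ?W"
        using sets.sets_into_space[OF C] measurable_space[OF measurable_compose[OF zz \<Phi>]] by (auto simp: spKW)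
      then have "measure K' (C \<times> space ?U) = measure ?K ((C \<times> space N) \<times> space ?W)" by (simp add: m)
      also have "\<dots> = measure K (C \<times> space N)"
        by (rule measure_pair_slab[OF prob_space_coin_flips]) measurable
      also have "\<dots> = measure M C" by (rule JD(4)[OF C])
      finally show "measure K' (C \<times> space ?U) = measure M C" .
    next
      fix D assume D[measurable]: "D \<in> sets ?U"
      have eq: "{k \<in> space ?K. fst (fst k) \<in> space M \<and> \<Phi> (zz k) \<in> D} = {k \<in> space ?K. zz k \<in> \<Phi> -` D \<inter> space ?Z}"
        using measurable_space[OF zz] by (auto simp: spKW)
      have "measure K' (space M \<times> D) = measure ?Z (\<Phi> -` D \<inter> space ?Z)"
        unfolding m[OF sets.top D] eq by (rule mZ) measurable
      then show "measure K' (space M \<times> D) = measure ?U D" by (simp only: mU[OF D])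
    next
      fix C D assume C[measurable]: "C \<in> sets M" and D[measurable]: "D \<in> sets ?U"
      have "measure K' ((T -` C \<inter> space M) \<times> (Q -` D \<inter> space ?U)) =
        measure ?K {k \<in> space ?K. fst (fst k) \<in> T -` C \<inter> space M \<and> \<Phi> (zz k) \<in> Q -` D \<inter> space ?U}" by (rule m) measurable
      also have "\<dots> = measure ?K {k \<in> space ?K. T (fst (fst k)) \<in> C \<and> \<Phi> (?\<tau> (zz k)) \<in> D}"
      proof (rule KW.P.finite_measure_eq_AE)
        show "AE k in ?K. k \<in> {k \<in> space ?K. fst (fst k) \<in> T -` C \<inter> space M \<and> \<Phi> (zz k) \<in> Q -` D \<inter> space ?U} \<longleftrightarrow>
          k \<in> {k \<in> space ?K. T (fst (fst k)) \<in> C \<and> \<Phi> (?\<tau> (zz k)) \<in> D}"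
          using aezz[OF Q(3)] AE_space
        proof eventually_elim
          case (elim k)
          have "\<Phi> (zz k) \<in> space ?U" using measurable_space[OF measurable_compose[OF zz \<Phi>] elim(2)] .
          then show ?case using elim by (auto simp: spKW)
        qed
      qed measurable
      also have "{k \<in> space ?K. T (fst (fst k)) \<in> C \<and> \<Phi> (?\<tau> (zz k)) \<in> D} =
        ?\<rho> -` {k \<in> space ?K. fst (fst k) \<in> C \<and> \<Phi> (zz k) \<in> D} \<inter> space ?K"
        using measurable_space[OF T] measurable_space[OF S] by (auto simp: zz_def spKW)
      also have "measure ?K \<dots> = measure ?K {k \<in> space ?K. fst (fst k) \<in> C \<and> \<Phi> (zz k) \<in> D}"
        by (rule pmp_measure_vimage(1)[OF p\<rho>]) measurable
      also have "\<dots> = measure K' (C \<times> D)" by (rule m[symmetric]) measurable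
      finally show "measure K' ((T -` C \<inter> space M) \<times> (Q -` D \<inter> space ?U)) = measure K' (C \<times> D)" .
    qed
    then have prod: "measure K' (A \<times> D) = measure M A * measure ?U D" if "D \<in> sets ?U" for D
      using dQ that A unfolding disjoint_systems_iff[OF pM pQ] by blast
    \<comment> \<open>The part of the interval that corresponds to
      \<open>B \<times> space ?W\<close>; evaluating the lifted joining on it forgets the Bernoulli
      coordinate again.\<close>
    define D where "D = \<Psi> -` (B \<times> space ?W) \<inter> space ?U"
    have D[measurable]: "D \<in> sets ?U" unfolding D_def by measurable
    have \<Phi>D: "\<Phi> z \<in> D \<longleftrightarrow> fst z \<in> B" if "z \<in> space ?Z" "\<Psi> (\<Phi> z) = z" for z
      using that measurable_space[OF \<Phi> that(1)] unfolding D_def by (cases z) auto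
    have "measure K' (A \<times> D) = measure ?K ((A \<times> B) \<times> space ?W)"
      unfolding m[OF A D]
    proof (rule KW.P.finite_measure_eq_AE)
      show "AE k in ?K. k \<in> {k \<in> space ?K. fst (fst k) \<in> A \<and> \<Phi> (zz k) \<in> D} \<longleftrightarrow> k \<in> (A \<times> B) \<times> space ?W"
        using aezz[OF fix1(2)] AE_space
      proof eventually_elim
        case (elim k)
        obtain x y w where "k = ((x, y), w)" by (metis surj_pair)
        then show ?case using \<Phi>D[OF measurable_space[OF zz elim(2)] elim(1)] elim(2) by (auto simp: zz_def)
      qed
    qed measurable
    also have "\<dots> = measure K (A \<times> B)"
      by (rule measure_pair_slab[OF prob_space_coin_flips]) measurable
    finally have 1: "measure K' (A \<times> D) = measure K (A \<times> B)" .
    have "measure ?U D = measure ?Z (B \<times> space ?W)"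
      unfolding mU[OF D]
    proof (rule Z.P.finite_measure_eq_AE)
      show "AE z in ?Z. z \<in> \<Phi> -` D \<inter> space ?Z \<longleftrightarrow> z \<in> B \<times> space ?W"
        using fix1(2) AE_space
      proof eventually_elim
        case (elim z)
        show ?case using \<Phi>D[OF elim(2,1)] elim(2) by (cases z) auto
      qed
    qed measurable
    also have "\<dots> = measure N B"
      by (rule measure_pair_slab[OF prob_space_coin_flips B])
    finally show ?thesis using 1 prod[OF D] by simp
  qed
  then show ?thesis using disjoint_systems_iff[OF pM pN] by blast
qed

section \<open>Disjointness of almost all pairs of components\<close>

text \<open>Cantor's diagonal argument over the second index, with compactness of the unit interval
  at each stage.\<close>

lemma bounded_diagonal_subsequence:
  fixes f :: "nat \<Rightarrow> nat \<Rightarrow> real"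
  assumes bdd: "\<And>n i. f n i \<in> {0..1}"
  obtains s where "strict_mono s" "\<And>i. convergent (\<lambda>k. f (s k) i)"
proof -
  let ?P = "\<lambda>i s. convergent (\<lambda>k. f (s k) i)"
  interpret D: subseqs ?P
  proof
    fix n and s :: "nat \<Rightarrow> nat"
    have "\<And>k. f (s k) n \<in> {0..1}" using bdd by blast
    then obtain l r where "strict_mono r" "((\<lambda>k. f (s k) n) \<circ> r) \<longlonglongrightarrow> l"
      using compact_Icc[of 0 "1::real"] unfolding compact_eq_seq_compact_metric seq_compact_def by metis
    then show "\<exists>r. strict_mono r \<and> ?P n (s \<circ> r)" by (auto simp: comp_def convergent_def)
  qed
  have "?P i D.diagseq" for i
  proof -
    \<comment> \<open>Only from index \<open>Suc i\<close> on is the diagonal sequence guaranteed to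
      run inside the subsequence chosen for \<open>i\<close>.\<close>
    have "?P i (D.diagseq \<circ> ((+) (Suc i)))"
    proof (rule D.diagseq_holds)
      fix r s :: "nat \<Rightarrow> nat" and n assume "strict_mono r" "?P n s"
      then show "?P n (s \<circ> r)"
        using convergent_subseq_convergent[of "\<lambda>k. f (s k) n" r] by (simp add: comp_def)
    qed
    then have "convergent (\<lambda>k. f (D.diagseq (k + Suc i)) i)" by (simp only: comp_def add.commute)
    then show ?thesis by (rule convergent_ignore_initial_segment[THEN iffD1])
  qed
  then show thesis using that D.subseq_diagseq by blast
qed

text \<open>\<open>approx_joining A tr Y \<delta> k p f g\<close>: on the first \<open>k\<close> sets of the enumeration \<open>A\<close>, the matrix \<open>p\<close>
  is, up to errors \<open>\<delta>\<close>, an invariant bimeasure with marginals \<open>f\<close> and \<open>g\<close>. Here \<open>tr X\<close> is the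
  preimage of \<open>X\<close> and \<open>Y\<close> the whole space.\<close>

definition approx_joining ::
  "(nat \<Rightarrow> 'a set) \<Rightarrow> ('a set \<Rightarrow> 'a set) \<Rightarrow> 'a set \<Rightarrow> real \<Rightarrow> nat \<Rightarrow> (nat \<Rightarrow> nat \<Rightarrow> real) \<Rightarrow>
    (nat \<Rightarrow> real) \<Rightarrow> (nat \<Rightarrow> real) \<Rightarrow> bool" where
  "approx_joining A tr Y \<delta> k p f g \<longleftrightarrow>
     (\<forall>i<k. \<forall>j<k. \<forall>l<k. \<forall>n<k.
        (A i \<inter> A j = {} \<and> A l = A i \<union> A j \<longrightarrow> \<bar>p l n - (p i n + p j n)\<bar> \<le> \<delta> \<and> \<bar>p n l - (p n i + p n j)\<bar> \<le> \<delta>) \<and>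
        (A i = tr (A j) \<and> A l = tr (A n) \<longrightarrow> \<bar>p i l - p j n\<bar> \<le> \<delta>) \<and>
        (A j = Y \<longrightarrow> \<bar>p i j - f i\<bar> \<le> \<delta> \<and> \<bar>p j i - g i\<bar> \<le> \<delta>))"

lemma approx_joiningD:
  assumes "approx_joining A tr Y \<delta> k p f g" "i < k" "j < k" "l < k" "n < k"
  shows "A i \<inter> A j = {} \<Longrightarrow> A l = A i \<union> A j \<Longrightarrow> \<bar>p l n - (p i n + p j n)\<bar> \<le> \<delta>"
    "A i \<inter> A j = {} \<Longrightarrow> A l = A i \<union> A j \<Longrightarrow> \<bar>p n l - (p n i + p n j)\<bar> \<le> \<delta>"
    "A i = tr (A j) \<Longrightarrow> A l = tr (A n) \<Longrightarrow> \<bar>p i l - p j n\<bar> \<le> \<delta>"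
    "A j = Y \<Longrightarrow> \<bar>p i j - f i\<bar> \<le> \<delta>" "A j = Y \<Longrightarrow> \<bar>p j i - g i\<bar> \<le> \<delta>"
  using assms unfolding approx_joining_def by blast+

lemma approx_joiningI:
  assumes "\<And>i j l n. i < k \<Longrightarrow> j < k \<Longrightarrow> l < k \<Longrightarrow> n < k \<Longrightarrow> A i \<inter> A j = {} \<Longrightarrow> A l = A i \<union> A j \<Longrightarrow> \<bar>p l n - (p i n + p j n)\<bar> \<le> \<delta>"
    "\<And>i j l n. i < k \<Longrightarrow> j < k \<Longrightarrow> l < k \<Longrightarrow> n < k \<Longrightarrow> A i \<inter> A j = {} \<Longrightarrow> A l = A i \<union> A j \<Longrightarrow> \<bar>p n l - (p n i + p n j)\<bar> \<le> \<delta>"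
    "\<And>i j l n. i < k \<Longrightarrow> j < k \<Longrightarrow> l < k \<Longrightarrow> n < k \<Longrightarrow> A i = tr (A j) \<Longrightarrow> A l = tr (A n) \<Longrightarrow> \<bar>p i l - p j n\<bar> \<le> \<delta>"
    "\<And>i j. i < k \<Longrightarrow> j < k \<Longrightarrow> A j = Y \<Longrightarrow> \<bar>p i j - f i\<bar> \<le> \<delta>"
    "\<And>i j. i < k \<Longrightarrow> j < k \<Longrightarrow> A j = Y \<Longrightarrow> \<bar>p j i - g i\<bar> \<le> \<delta>"
  shows "approx_joining A tr Y \<delta> k p f g"
  unfolding approx_joining_def
  by (intro allI impI conjI; (elim conjE)?; rule assms; assumption)

lemma approx_joining_exact:
  assumes J: "L \<in> joinings M1 T M2 T" and sp: "space M1 = X" "space M2 = X"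
    and T: "T \<in> measurable M1 M1" "T \<in> measurable M2 M2"
    and A: "\<And>i. A i \<in> sets M1" "\<And>i. A i \<in> sets M2" and \<delta>: "0 \<le> \<delta>"
  shows "approx_joining A (\<lambda>B. T -` B \<inter> X) X \<delta> k (\<lambda>i j. measure L (A i \<times> A j))
     (\<lambda>i. measure M1 (A i)) (\<lambda>i. measure M2 (A i))"
proof -
  note JD = joiningsD[OF J]
  interpret L: prob_space L by (rule JD(2))
  have AL: "A i \<times> A j \<in> sets L" for i j using A by (simp add: JD(1))
  show ?thesis
  proof (rule approx_joiningI)
    fix i j l n assume *: "A i \<inter> A j = {}" "A l = A i \<union> A j"
    have "A l \<times> A n = A i \<times> A n \<union> A j \<times> A n" "(A i \<times> A n) \<inter> (A j \<times> A n) = {}"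
      "A n \<times> A l = A n \<times> A i \<union> A n \<times> A j" "(A n \<times> A i) \<inter> (A n \<times> A j) = {}" using * by auto
    then show "\<bar>measure L (A l \<times> A n) - (measure L (A i \<times> A n) + measure L (A j \<times> A n))\<bar> \<le> \<delta>"
      "\<bar>measure L (A n \<times> A l) - (measure L (A n \<times> A i) + measure L (A n \<times> A j))\<bar> \<le> \<delta>"
      using L.finite_measure_Union[OF AL AL] \<delta> by simp_all
  next
    fix i j l n assume "A i = T -` A j \<inter> X" "A l = T -` A n \<inter> X"
    then show "\<bar>measure L (A i \<times> A l) - measure L (A j \<times> A n)\<bar> \<le> \<delta>"
      using JD(6)[OF T A(1)[of j] A(2)[of n]] \<delta> by (simp add: sp)
  next
    fix i j assume "A j = X"
    then show "\<bar>measure L (A i \<times> A j) - measure M1 (A i)\<bar> \<le> \<delta>" "\<bar>measure L (A j \<times> A i) - measure M2 (A i)\<bar> \<le> \<delta>"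
      using JD(4)[OF A(1)[of i]] JD(5)[OF A(2)[of i]] \<delta> by (simp_all add: sp)
  qed
qed

text \<open>Additivity involves three entries, each off by at most \<open>\<eta>\<close>; this is
  the origin of the factor 3.\<close>

lemma approx_joining_perturb:
  assumes P: "approx_joining A tr Y 0 k P f g" and near: "\<And>i j. i < k \<Longrightarrow> j < k \<Longrightarrow> \<bar>p i j - P i j\<bar> \<le> \<eta>" and \<eta>: "0 \<le> \<eta>"
  shows "approx_joining A tr Y (3 * \<eta>) k p f g"
proof (rule approx_joiningI)
  fix i j l n assume *: "i < k" "j < k" "l < k" "n < k"
  show "\<bar>p l n - (p i n + p j n)\<bar> \<le> 3 * \<eta>" if "A i \<inter> A j = {}" "A l = A i \<union> A j"
    using approx_joiningD(1)[OF P * that] near[OF *(3,4)] near[OF *(1,4)] near[OF *(2,4)]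
    unfolding abs_le_iff by linarith
  show "\<bar>p n l - (p n i + p n j)\<bar> \<le> 3 * \<eta>" if "A i \<inter> A j = {}" "A l = A i \<union> A j"
    using approx_joiningD(2)[OF P * that] near[OF *(4,3)] near[OF *(4,1)] near[OF *(4,2)]
    unfolding abs_le_iff by linarith
  show "\<bar>p i l - p j n\<bar> \<le> 3 * \<eta>" if "A i = tr (A j)" "A l = tr (A n)"
    using approx_joiningD(3)[OF P * that] near[OF *(1,3)] near[OF *(2,4)] \<eta>
    unfolding abs_le_iff by linarith
next
  fix i j assume *: "i < k" "j < k" "A j = Y"
  show "\<bar>p i j - f i\<bar> \<le> 3 * \<eta>"
    using approx_joiningD(4)[OF P *(1,2,1,1,3)] near[OF *(1,2)] \<eta> by arith
  show "\<bar>p j i - g i\<bar> \<le> 3 * \<eta>"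
    using approx_joiningD(5)[OF P *(1,2,1,1,3)] near[OF *(2,1)] \<eta> by arith
qed

lemma approx_joining_cong:
  assumes "\<And>i j. i < k \<Longrightarrow> j < k \<Longrightarrow> p i j = p' i j"
  shows "approx_joining A tr Y \<delta> k p f g \<longleftrightarrow> approx_joining A tr Y \<delta> k p' f g"
  unfolding approx_joining_def using assms by auto

lemma abs_integral_le:
  assumes "prob_space M" "integrable M h" "\<And>x. x \<in> space M \<Longrightarrow> \<bar>h x\<bar> \<le> (c :: real)"
  shows "\<bar>\<integral>x. h x \<partial>M\<bar> \<le> c"
proof -
  interpret prob_space M by fact
  have "\<bar>\<integral>x. h x \<partial>M\<bar> \<le> (\<integral>x. \<bar>h x\<bar> \<partial>M)" by (rule integral_abs_bound)
  also have "\<dots> \<le> (\<integral>x. c \<partial>M)" by (rule integral_mono) (use assms in auto)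
  finally show ?thesis by (simp add: prob_space)
qed

text \<open>All conditions bound linear expressions in \<open>p\<close>, \<open>f\<close> and
  \<open>g\<close>, so they survive averaging over a probability space with the same error.\<close>

lemma approx_joining_integral:
  assumes "prob_space M" and a: "\<And>x. x \<in> space M \<Longrightarrow> approx_joining A tr Y \<delta> k (p x) (f x) (g x)"
    and p: "\<And>i j. integrable M (\<lambda>x. p x i j)" and f: "\<And>i. integrable M (\<lambda>x. f x i)" and g: "\<And>i. integrable M (\<lambda>x. g x i)"
  shows "approx_joining A tr Y \<delta> k (\<lambda>i j. \<integral>x. p x i j \<partial>M) (\<lambda>i. \<integral>x. f x i \<partial>M) (\<lambda>i. \<integral>x. g x i \<partial>M)"
proof (rule approx_joiningI)
  fix i j l n assume *: "i < k" "j < k" "l < k" "n < k"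
  show "\<bar>(\<integral>x. p x l n \<partial>M) - ((\<integral>x. p x i n \<partial>M) + (\<integral>x. p x j n \<partial>M))\<bar> \<le> \<delta>" if "A i \<inter> A j = {}" "A l = A i \<union> A j"
    using abs_integral_le[OF assms(1), of "\<lambda>x. p x l n - (p x i n + p x j n)" \<delta>] approx_joiningD(1)[OF a * that] p by simp
  show "\<bar>(\<integral>x. p x n l \<partial>M) - ((\<integral>x. p x n i \<partial>M) + (\<integral>x. p x n j \<partial>M))\<bar> \<le> \<delta>" if "A i \<inter> A j = {}" "A l = A i \<union> A j"
    using abs_integral_le[OF assms(1), of "\<lambda>x. p x n l - (p x n i + p x n j)" \<delta>] approx_joiningD(2)[OF a * that] p by simp
  show "\<bar>(\<integral>x. p x i l \<partial>M) - (\<integral>x. p x j n \<partial>M)\<bar> \<le> \<delta>" if "A i = tr (A j)" "A l = tr (A n)"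
    using abs_integral_le[OF assms(1), of "\<lambda>x. p x i l - p x j n" \<delta>] approx_joiningD(3)[OF a * that] p by simp
next
  fix i j assume *: "i < k" "j < k" "A j = Y"
  show "\<bar>(\<integral>x. p x i j \<partial>M) - (\<integral>x. f x i \<partial>M)\<bar> \<le> \<delta>"
    using abs_integral_le[OF assms(1), of "\<lambda>x. p x i j - f x i" \<delta>] approx_joiningD(4)[OF a *(1,2,1,1,3)] p f by simp
  show "\<bar>(\<integral>x. p x j i \<partial>M) - (\<integral>x. g x i \<partial>M)\<bar> \<le> \<delta>"
    using abs_integral_le[OF assms(1), of "\<lambda>x. p x j i - g x i" \<delta>] approx_joiningD(5)[OF a *(1,2,1,1,3)] p g by simp
qed

text \<open>The mesh \<open>1 / (3 * k)\<close> is such that rounding a joining costs at most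
  \<open>1 / k\<close> in \<open>approx_joining\<close>. Entries outside the \<open>k\<close> by
  \<open>k\<close> block come from the default value of extensional functions, which keeps the set
  finite.\<close>

definition grid :: "nat \<Rightarrow> (nat \<Rightarrow> nat \<Rightarrow> real) set" where
  "grid k = (\<lambda>c i j. real (c (i, j)) / real (3 * k)) ` (({..<k} \<times> {..<k}) \<rightarrow>\<^sub>E {..3 * k})"

lemma finite_grid: "finite (grid k)"
  unfolding grid_def by (intro finite_imageI finite_PiE) auto

lemma grid_bounds:
  assumes "p \<in> grid k" "i < k" "j < k"
  shows "0 \<le> p i j" "p i j \<le> 1"
proof -
  obtain c where c: "c \<in> ({..<k} \<times> {..<k}) \<rightarrow>\<^sub>E {..3 * k}" "p = (\<lambda>i j. real (c (i, j)) / real (3 * k))"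
    using assms(1) unfolding grid_def by blast
  have "c (i, j) \<le> 3 * k" using c(1) assms(2,3) by (auto simp: PiE_iff)
  then have "real (c (i, j)) \<le> real (3 * k)" by (rule of_nat_mono)
  then show "0 \<le> p i j" "p i j \<le> 1" using assms(2) by (auto simp: c(2) divide_le_eq_1)
qed

lemma grid_close:
  assumes P: "\<And>i j. 0 \<le> P i j" "\<And>i j. P i j \<le> (1 :: real)"
  shows "\<exists>p \<in> grid k. \<forall>i<k. \<forall>j<k. \<bar>p i j - P i j\<bar> \<le> 1 / real (3 * k)"
proof
  let ?c = "\<lambda>z. if z \<in> {..<k} \<times> {..<k} then nat \<lfloor>P (fst z) (snd z) * real (3 * k)\<rfloor> else undefined"
  let ?p = "\<lambda>i j. real (?c (i, j)) / real (3 * k)"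
  show "?p \<in> grid k"
    unfolding grid_def
  proof (rule image_eqI[of _ _ ?c])
    have "nat \<lfloor>P i j * real (3 * k)\<rfloor> \<le> 3 * k" for i j
    proof -
      have "P i j * real (3 * k) \<le> 1 * real (3 * k)" by (rule mult_right_mono[OF P(2)]) simp
      then have "\<lfloor>P i j * real (3 * k)\<rfloor> \<le> int (3 * k)" by (simp add: floor_le_iff)
      then show ?thesis by simp
    qed
    then show "?c \<in> ({..<k} \<times> {..<k}) \<rightarrow>\<^sub>E {..3 * k}" by (auto simp: PiE_iff extensional_def)
  qed simp
  show "\<forall>i<k. \<forall>j<k. \<bar>?p i j - P i j\<bar> \<le> 1 / real (3 * k)"
  proof (intro allI impI)
    fix i j assume ij: "i < k" "j < k"
    define m where "m = real (3 * k)"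
    have m: "m > 0" using ij by (simp add: m_def)
    have "0 \<le> P i j * m" using P(1) m by simp
    then have "real (nat \<lfloor>P i j * m\<rfloor>) \<le> P i j * m" "P i j * m \<le> real (nat \<lfloor>P i j * m\<rfloor>) + 1" by linarith+
    then have "\<bar>real (nat \<lfloor>P i j * m\<rfloor>) - P i j * m\<bar> \<le> 1" by arith
    then have "\<bar>real (nat \<lfloor>P i j * m\<rfloor>) - P i j * m\<bar> / m \<le> 1 / m" using m by (intro divide_right_mono) auto
    moreover have "real (nat \<lfloor>P i j * m\<rfloor>) / m - P i j = (real (nat \<lfloor>P i j * m\<rfloor>) - P i j * m) / m"
      using m by (simp add: diff_divide_distrib)
    ultimately have "\<bar>real (nat \<lfloor>P i j * m\<rfloor>) / m - P i j\<bar> \<le> 1 / m"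
      using m by (simp only: abs_divide abs_of_pos)
    then show "\<bar>?p i j - P i j\<bar> \<le> 1 / real (3 * k)" using ij by (simp add: m_def)
  qed
qed

text \<open>Deviations from the product must not cancel when joinings are averaged over
  \<open>x\<close>. A non-disjoint pair is therefore recorded together with one fixed rectangle
  \<open>X \<times> Y\<close> and one amount \<open>\<epsilon>\<close>, and always by an excess,
  never by a deficit. Rectangles from a countable algebra and amounts
  \<open>1 / real (Suc m)\<close> suffice, which keeps the cover countable.\<close>

lemma almost_all_pairs_disjoint:
  assumes std: "standard_prob_space M" and pM: "pmp_system M T"
    and dec: "ergodic_decomposition M T Mbar \<pi> \<mu>"
    and disj: "\<And>x. x \<in> space Mbar \<Longrightarrow> disjoint_systems M T (\<mu> x) T"
  shows "emeasure (completion (Mbar \<Otimes>\<^sub>M Mbar)) (disjoint_pairs T Mbar \<mu>) = 1"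
proof -
  have "prob_space M" and T[measurable]: "T \<in> measurable M M"
    using pM unfolding pmp_system_def by auto
  interpret M: prob_space M by fact
  note ED = ergodic_decompositionD[OF pM dec]
  interpret Mbar: prob_space Mbar by (rule ED(1))
  interpret BB: pair_prob_space Mbar Mbar ..
  let ?BB = "Mbar \<Otimes>\<^sub>M Mbar"
  let ?tr = "\<lambda>B. T -` B \<inter> space M"
  obtain e r where er: "e \<in> borel_measurable M" "r \<in> measurable (borel :: real measure) M"
    "\<And>x. x \<in> space M \<Longrightarrow> r (e x) = x" "\<And>x. e x \<in> {0..1}"
    using measurable_retract_unit_interval[OF standard_prob_space_retract[OF std]] by blast
  obtain \<A> where \<A>: "countable \<A>" "algebra (space M) \<A>" "sets M = sigma_sets (space M) \<A>"
    "\<And>A. A \<in> \<A> \<Longrightarrow> T -` A \<inter> space M \<in> \<A>" "\<And>t. t \<in> \<rat> \<Longrightarrow> {x \<in> space M. e x < t} \<in> \<A>"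
    using countable_invariant_algebra[OF T er(1-3)] by blast
  interpret \<A>: algebra "space M" \<A> by (rule \<A>(2))
  have sub: "A \<in> sets M" if "A \<in> \<A>" for A using that \<A>(3) by auto
  define A where "A = from_nat_into \<A>"
  define ix where "ix = to_nat_on \<A>"
  have A\<A>: "A i \<in> \<A>" for i unfolding A_def by (rule from_nat_into) (use \<A>.top in auto)
  have Aix: "A (ix X) = X" if "X \<in> \<A>" for X unfolding A_def ix_def using that \<A>(1) by simp
  have AM[measurable]: "A i \<in> sets M" for i by (rule sub[OF A\<A>])
  have TX: "T \<in> measurable (\<mu> x) (\<mu> x)" if "x \<in> space Mbar" for x
    using T measurable_cong_sets[OF ED(6)[OF that] ED(6)[OF that]] by simp
  define f where "f x i = measure (\<mu> x) (A i)" for x i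
  have f[measurable]: "(\<lambda>x. f x i) \<in> borel_measurable Mbar" for i
    unfolding f_def by (rule ED(11)[OF AM])
  have f01: "0 \<le> f x i" "f x i \<le> 1" if "x \<in> space Mbar" for x i
    unfolding f_def using prob_space.prob_le_1[OF ED(8)[OF that]] by auto
  have fi: "integrable Mbar (\<lambda>x. f x i)" for i
    by (rule Mbar.integrable_const_bound[of _ 1]) (auto simp: f01 intro!: AE_I2)
  have fM: "(\<integral>x. f x i \<partial>Mbar) = measure M (A i)" for i
  proof -
    have "(\<integral>x. f x i \<partial>Mbar) = (\<integral>x. indicator (space Mbar) x * measure (\<mu> x) (A i) \<partial>Mbar)"
      by (rule Bochner_Integration.integral_cong) (auto simp: f_def)
    also have "\<dots> = measure M (A i \<inter> \<pi> -` space Mbar)" by (rule ED(12)) auto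
    also have "A i \<inter> \<pi> -` space Mbar = A i"
      using sets.sets_into_space[OF AM[of i]] measurable_space[OF ED(2)] by auto
    finally show ?thesis .
  qed
  have prod: "measure (\<mu> x \<Otimes>\<^sub>M \<mu> y) (A i \<times> A j) = f x i * f y j" if "x \<in> space Mbar" "y \<in> space Mbar" for x y i j
  proof -
    interpret X: prob_space "\<mu> x" by (rule ED(8)[OF that(1)])
    interpret Y: prob_space "\<mu> y" by (rule ED(8)[OF that(2)])
    show ?thesis
      using Y.emeasure_pair_measure_Times[of "A i" "\<mu> x" "A j"] ED(6)[OF that(1)] ED(6)[OF that(2)]
      by (simp add: f_def measure_def enn2real_mult)
  qed
  have exact: "approx_joining A ?tr (space M) \<delta> k (\<lambda>i j. measure L (A i \<times> A j)) (f x) (f y)"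
    if x: "x \<in> space Mbar" "y \<in> space Mbar" and L: "L \<in> joinings (\<mu> x) T (\<mu> y) T" and "0 \<le> \<delta>" for x y L \<delta> k
    unfolding f_def
    by (rule approx_joining_exact[OF L ED(7)[OF x(1)] ED(7)[OF x(2)] TX[OF x(1)] TX[OF x(2)] _ _ \<open>0 \<le> \<delta>\<close>])
      (simp_all add: ED(6)[OF x(1)] ED(6)[OF x(2)])

  \<comment> \<open>Borel sets covering the non-disjoint pairs\<close>
  define ok where "ok a b \<epsilon> k p x y \<longleftrightarrow> approx_joining A ?tr (space M) (1 / real k) k p (f x) (f y) \<and>
    (a < k \<longrightarrow> b < k \<longrightarrow> f x a * f y b + \<epsilon> - 1 / real k \<le> p a b)" for a b \<epsilon> k p x y
  \<comment> \<open>For each \<open>k\<close> a finite union over the grid, then a countable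
    intersection over \<open>k\<close>, of conditions on measurable functions: this makes
    \<open>E\<close> Borel. The slack \<open>1 / real k\<close> in \<open>ok\<close> absorbs the
    rounding and disappears in the limit.\<close>
  define E where "E a b \<epsilon> = {z \<in> space ?BB. \<forall>k. \<exists>p\<in>grid k. ok a b \<epsilon> k p (fst z) (snd z)}" for a b \<epsilon>
  have okm: "Measurable.pred ?BB (\<lambda>z. ok a b \<epsilon> k p (fst z) (snd z))" for a b \<epsilon> k p
    unfolding ok_def approx_joining_def by measurable
  have okm1: "Measurable.pred Mbar (\<lambda>x. ok a b \<epsilon> k p x y)" if "y \<in> space Mbar" for a b \<epsilon> k p y
    unfolding ok_def approx_joining_def by measurable
  note [simp] = finite_grid
  have Em[measurable]: "E a b \<epsilon> \<in> sets ?BB" for a b \<epsilon>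
    unfolding E_def using okm by measurable

  \<comment> \<open>Sections of the cover are null\<close>
  have slice: "emeasure Mbar ((\<lambda>x. (x, y)) -` E (ix X) (ix Y) \<epsilon>) = 0"
    if y: "y \<in> space Mbar" and XY: "X \<in> \<A>" "Y \<in> \<A>" and \<epsilon>: "\<epsilon> > 0" for y X Y \<epsilon>
  proof -
    define a b where "a = ix X" and "b = ix Y"
    note okm1' = okm1[OF y, of a b \<epsilon>]
    define F where "F = {x \<in> space Mbar. \<forall>k. \<exists>p\<in>grid k. ok a b \<epsilon> k p x y}"
    have F[measurable]: "F \<in> sets Mbar"
      unfolding F_def using okm1' by measurable
    have vimF: "(\<lambda>x. (x, y)) -` E (ix X) (ix Y) \<epsilon> = F"
      using y unfolding E_def F_def a_def b_def by (auto simp: space_pair_measure)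
    have "measure Mbar F \<le> 0"
    proof (rule ccontr)
      assume "\<not> measure Mbar F \<le> 0"
      then have \<phi>: "measure Mbar F > 0" by simp
      interpret N: prob_space "\<mu> y" by (rule ED(8)[OF y])
      define G where "G k = from_nat_into (grid k)" for k
      \<comment> \<open>A measurable choice of an approximate joining: the first member of the
        enumerated grid that fits.\<close>
      define idx where "idx k x = (LEAST n. ok a b \<epsilon> k (G k n) x y)" for k x
      have idx: "idx k \<in> measurable Mbar (count_space UNIV)" for k
        unfolding idx_def by (rule measurable_Least) (rule okm1')
      have okF: "ok a b \<epsilon> k (G k (idx k x)) x y" and GF: "G k (idx k x) \<in> grid k" if x: "x \<in> F" for x k
      proof -
        obtain p where p: "p \<in> grid k" "ok a b \<epsilon> k p x y" using x unfolding F_def by blast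
        obtain n where "from_nat_into (grid k) n = p"
          using from_nat_into_surj[OF countable_finite[OF finite_grid] p(1)] by blast
        then have "ok a b \<epsilon> k (G k n) x y" using p by (simp add: G_def)
        then show "ok a b \<epsilon> k (G k (idx k x)) x y" unfolding idx_def by (rule LeastI)
        show "G k (idx k x) \<in> grid k" unfolding G_def using p(1) by (intro from_nat_into) auto
      qed
      \<comment> \<open>Off \<open>F\<close> the product joining is substituted. It has the right
        marginals, so the average over all components has first marginal \<open>M\<close>, and it
        leaves the excess collected on \<open>F\<close> intact. Outside the \<open>k\<close> by
        \<open>k\<close> block the same values keep \<open>g\<close> within
        \<open>[0, 1]\<close>.\<close>
      define g where "g k x i j = (if x \<in> F \<and> i < k \<and> j < k then G k (idx k x) i j else f x i * f y j)" for k x i j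
      have gm[measurable]: "(\<lambda>x. g k x i j) \<in> borel_measurable Mbar" for k i j
      proof -
        have [measurable]: "(\<lambda>x. G k (idx k x) i j) \<in> borel_measurable Mbar"
          by (rule measurable_compose[OF idx]) simp
        show ?thesis unfolding g_def by measurable
      qed
      have g01: "0 \<le> g k x i j" "g k x i j \<le> 1" if x: "x \<in> space Mbar" for k x i j
      proof -
        have "0 \<le> f x i * f y j" "f x i * f y j \<le> 1"
          using f01[OF x] f01[OF y] by (auto intro!: mult_le_one)
        then show "0 \<le> g k x i j" "g k x i j \<le> 1" unfolding g_def using grid_bounds[OF GF] by auto
      qed
      have gi: "integrable Mbar (\<lambda>x. g k x i j)" for k i j
        by (rule Mbar.integrable_const_bound[of _ 1]) (auto simp: g01 intro!: AE_I2)
      have ga: "approx_joining A ?tr (space M) (1 / real k) k (g k x) (f x) (f y)" if x: "x \<in> space Mbar" for k x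
      proof (cases "x \<in> F")
        case True
        have "approx_joining A ?tr (space M) (1 / real k) k (G k (idx k x)) (f x) (f y)"
          using okF[OF True] unfolding ok_def by blast
        then show ?thesis
          by (rule approx_joining_cong[THEN iffD1, rotated]) (simp add: g_def True)
      next
        case False
        have "approx_joining A ?tr (space M) (1 / real k) k (\<lambda>i j. measure (\<mu> x \<Otimes>\<^sub>M \<mu> y) (A i \<times> A j)) (f x) (f y)"
          by (rule exact[OF x y product_joining[OF ED(9)[OF x] ED(9)[OF y]]]) simp
        then show ?thesis
          by (rule approx_joining_cong[THEN iffD1, rotated]) (simp add: g_def False prod[OF x y])
      qed
      define Q where "Q k i j = (\<integral>x. g k x i j \<partial>Mbar)" for k i j
      have Qa: "approx_joining A ?tr (space M) (1 / real k) k (Q k) (\<lambda>i. measure M (A i)) (f y)" for k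
        using approx_joining_integral[OF Mbar.prob_space_axioms ga gi fi, of k] by (simp add: Q_def[abs_def] fM Mbar.prob_space)
      have Q01: "Q k i j \<in> {0..1}" for k i j
      proof -
        have "(\<integral>x. g k x i j \<partial>Mbar) \<le> (\<integral>x. 1 \<partial>Mbar)" by (rule integral_mono) (auto simp: gi g01)
        moreover have "0 \<le> (\<integral>x. g k x i j \<partial>Mbar)" by (rule Bochner_Integration.integral_nonneg) (simp add: g01)
        ultimately show ?thesis by (simp add: Q_def Mbar.prob_space)
      qed
      have Qgap: "measure M (A a) * f y b + (\<epsilon> - 1 / real k) * measure Mbar F \<le> Q k a b" if "a < k" "b < k" for k
      proof -
        have "(\<integral>x. f x a * f y b + (\<epsilon> - 1 / real k) * indicator F x \<partial>Mbar) \<le> Q k a b"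
          unfolding Q_def
        proof (rule integral_mono)
          show "integrable Mbar (\<lambda>x. f x a * f y b + (\<epsilon> - 1 / real k) * indicator F x)"
            using fi[of a] F by (intro Bochner_Integration.integrable_add integrable_mult_left integrable_mult_right integrable_real_indicator) (auto simp: less_top[symmetric])
          fix x assume "x \<in> space Mbar"
          show "f x a * f y b + (\<epsilon> - 1 / real k) * indicator F x \<le> g k x a b"
          proof (cases "x \<in> F")
            case True
            then show ?thesis using okF[OF True, of k] that by (simp add: ok_def g_def)
          qed (simp add: g_def)
        qed (rule gi)
        also have "(\<integral>x. f x a * f y b + (\<epsilon> - 1 / real k) * indicator F x \<partial>Mbar) =
            measure M (A a) * f y b + (\<epsilon> - 1 / real k) * measure Mbar F"
          using fi[of a] F by (subst Bochner_Integration.integral_add) (auto simp: fM less_top[symmetric] intro!: integrable_mult_right integrable_real_indicator)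
        finally show ?thesis .
      qed
      obtain s where s: "strict_mono s" "\<And>n. convergent (\<lambda>k. Q (s k) (fst (prod_decode n)) (snd (prod_decode n)))"
        using bounded_diagonal_subsequence[of "\<lambda>k n. Q k (fst (prod_decode n)) (snd (prod_decode n))"] Q01 by blast
      define q where "q i j = lim (\<lambda>k. Q (s k) i j)" for i j
      have q: "(\<lambda>k. Q (s k) i j) \<longlonglongrightarrow> q i j" for i j
        using s(2)[of "prod_encode (i, j)"] unfolding q_def by (simp add: convergent_LIMSEQ_iff)
      have inv0: "(\<lambda>k. 1 / real (s k)) \<longlonglongrightarrow> 0"
        using LIMSEQ_subseq_LIMSEQ[OF lim_1_over_n s(1)] by (simp add: comp_def)
      \<comment> \<open>Each axiom of a joining concerns finitely many indices; it is among the
        tested ones as soon as \<open>s k\<close> exceeds them, with an error that tends to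
        0.\<close>
      have large: "\<forall>\<^sub>F k in sequentially. n < s k" for n
        using seq_suble[OF s(1)] by (auto simp: eventually_sequentially intro!: exI[of _ "Suc n"] intro: less_le_trans)
      have lim0: "l = 0" if "u \<longlonglongrightarrow> l" "\<forall>\<^sub>F k in sequentially. \<bar>u k\<bar> \<le> 1 / real (s k)" for u :: "nat \<Rightarrow> real" and l
        using LIMSEQ_unique[OF that(1) Lim_null_comparison[OF _ inv0]] that(2) by simp
      have qadd: "q l n = q i n + q j n" "q n l = q n i + q n j" if "A i \<inter> A j = {}" "A l = A i \<union> A j" for i j l n
      proof -
        have "q l n - (q i n + q j n) = 0"
        proof (rule lim0)
          show "(\<lambda>k. Q (s k) l n - (Q (s k) i n + Q (s k) j n)) \<longlonglongrightarrow> q l n - (q i n + q j n)"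
            by (intro tendsto_intros q)
          show "\<forall>\<^sub>F k in sequentially. \<bar>Q (s k) l n - (Q (s k) i n + Q (s k) j n)\<bar> \<le> 1 / real (s k)"
            using large[of i] large[of j] large[of l] large[of n]
            by eventually_elim (rule approx_joiningD(1)[OF Qa _ _ _ _ that])
        qed
        then show "q l n = q i n + q j n" by simp
        have "q n l - (q n i + q n j) = 0"
        proof (rule lim0)
          show "(\<lambda>k. Q (s k) n l - (Q (s k) n i + Q (s k) n j)) \<longlonglongrightarrow> q n l - (q n i + q n j)"
            by (intro tendsto_intros q)
          show "\<forall>\<^sub>F k in sequentially. \<bar>Q (s k) n l - (Q (s k) n i + Q (s k) n j)\<bar> \<le> 1 / real (s k)"
            using large[of i] large[of j] large[of l] large[of n]
            by eventually_elim (rule approx_joiningD(2)[OF Qa _ _ _ _ that])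
        qed
        then show "q n l = q n i + q n j" by simp
      qed
      have qinv: "q i l = q j n" if "A i = ?tr (A j)" "A l = ?tr (A n)" for i j l n
      proof -
        have "q i l - q j n = 0"
        proof (rule lim0)
          show "(\<lambda>k. Q (s k) i l - Q (s k) j n) \<longlonglongrightarrow> q i l - q j n"
            by (intro tendsto_intros q)
          show "\<forall>\<^sub>F k in sequentially. \<bar>Q (s k) i l - Q (s k) j n\<bar> \<le> 1 / real (s k)"
            using large[of i] large[of j] large[of l] large[of n]
            by eventually_elim (rule approx_joiningD(3)[OF Qa _ _ _ _ that])
        qed
        then show ?thesis by simp
      qed
      have qmarg: "q i j = measure M (A i)" "q j i = f y i" if "A j = space M" for i j
      proof -
        have "q i j - measure M (A i) = 0"
        proof (rule lim0)
          show "(\<lambda>k. Q (s k) i j - measure M (A i)) \<longlonglongrightarrow> q i j - measure M (A i)"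
            by (intro tendsto_intros q)
          show "\<forall>\<^sub>F k in sequentially. \<bar>Q (s k) i j - measure M (A i)\<bar> \<le> 1 / real (s k)"
            using large[of i] large[of j]
            by eventually_elim (rule approx_joiningD(4)[OF Qa _ _ _ _ that])
        qed
        then show "q i j = measure M (A i)" by simp
        have "q j i - f y i = 0"
        proof (rule lim0)
          show "(\<lambda>k. Q (s k) j i - f y i) \<longlonglongrightarrow> q j i - f y i"
            by (intro tendsto_intros q)
          show "\<forall>\<^sub>F k in sequentially. \<bar>Q (s k) j i - f y i\<bar> \<le> 1 / real (s k)"
            using large[of i] large[of j]
            by eventually_elim (rule approx_joiningD(5)[OF Qa _ _ _ _ that])
        qed
        then show "q j i = f y i" by simp
      qed
      have q0: "0 \<le> q i j" for i j
        by (rule LIMSEQ_le_const[OF q]) (use Q01 in auto)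
      have qgap: "measure M (A a) * f y b + \<epsilon> * measure Mbar F \<le> q a b"
      proof (rule tendsto_le[OF _ q])
        show "(\<lambda>k. measure M (A a) * f y b + (\<epsilon> - 1 / real (s k)) * measure Mbar F) \<longlonglongrightarrow> measure M (A a) * f y b + \<epsilon> * measure Mbar F"
          using tendsto_add[OF tendsto_const tendsto_mult_right[OF tendsto_diff[OF tendsto_const inv0]]] by simp
        show "\<forall>\<^sub>F k in sequentially. measure M (A a) * f y b + (\<epsilon> - 1 / real (s k)) * measure Mbar F \<le> Q (s k) a b"
          using large[of a] large[of b] by eventually_elim (rule Qgap)
      qed simp
      have e2: "e \<in> borel_measurable (\<mu> y)" "r \<in> measurable borel (\<mu> y)"
        unfolding measurable_cong_sets[OF ED(6)[OF y] refl] measurable_cong_sets[OF refl ED(6)[OF y]]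
        by (rule er)+
      \<comment> \<open>The limit \<open>q\<close> is finitely additive with marginals
        \<open>M\<close> and \<open>\<mu> y\<close>, hence extends to a joining of \<open>T\<close>
        with the component over \<open>y\<close>. By \<open>qgap\<close> its excess on
        \<open>X \<times> Y\<close> is at least \<open>\<epsilon> * measure Mbar F\<close>, against
        the assumed disjointness.\<close>
      obtain L where L: "L \<in> joinings M T (\<mu> y) T" "\<And>B C. B \<in> \<A> \<Longrightarrow> C \<in> \<A> \<Longrightarrow> measure L (B \<times> C) = q (ix B) (ix C)"
      proof (rule joining_extension[OF M.prob_space_axioms T \<A>(2,3) N.prob_space_axioms TX[OF y] _ _ e2(1) er(4) e2(2), of \<A> "\<lambda>B C. q (ix B) (ix C)"])
        show "algebra (space (\<mu> y)) \<A>" using \<A>(2) by (simp add: ED(7)[OF y])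
        show "sets (\<mu> y) = sigma_sets (space (\<mu> y)) \<A>" using \<A>(3) by (simp add: ED(6,7)[OF y])
        show "r (e x) = x" if "x \<in> space (\<mu> y)" for x using er(3) that by (simp add: ED(7)[OF y])
        show "{x \<in> space (\<mu> y). e x < t} \<in> \<A>" if "t \<in> \<rat>" for t using \<A>(5)[OF that] by (simp add: ED(7)[OF y])
        show "T -` B \<inter> space M \<in> \<A>" "T -` B \<inter> space (\<mu> y) \<in> \<A>" if "B \<in> \<A>" for B
          using \<A>(4)[OF that] by (simp_all add: ED(7)[OF y])
        show "0 \<le> q (ix B) (ix C)" for B C by (rule q0)
        show "q (ix (B \<union> B')) (ix C) = q (ix B) (ix C) + q (ix B') (ix C)" if "B \<in> \<A>" "B' \<in> \<A>" "C \<in> \<A>" "B \<inter> B' = {}" for B B' C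
          using that \<A>.Un[of B B'] by (intro qadd(1)) (simp_all add: Aix)
        show "q (ix C) (ix (B \<union> B')) = q (ix C) (ix B) + q (ix C) (ix B')" if "C \<in> \<A>" "B \<in> \<A>" "B' \<in> \<A>" "B \<inter> B' = {}" for B B' C
          using that \<A>.Un[of B B'] by (intro qadd(2)) (simp_all add: Aix)
        show "q (ix B) (ix (space (\<mu> y))) = measure M B" if "B \<in> \<A>" for B
          using qmarg(1)[of "ix (space M)" "ix B"] that \<A>.top by (simp add: Aix ED(7)[OF y])
        show "q (ix (space M)) (ix B) = measure (\<mu> y) B" if "B \<in> \<A>" for B
          using qmarg(2)[of "ix (space M)" "ix B"] that \<A>.top by (simp add: Aix f_def)
        show "q (ix (T -` B \<inter> space M)) (ix (T -` C \<inter> space (\<mu> y))) = q (ix B) (ix C)" if "B \<in> \<A>" "C \<in> \<A>" for B C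
          using that \<A>(4) by (intro qinv) (simp_all add: Aix ED(7)[OF y])
      qed (rule that, assumption, blast)
      have "measure L (X \<times> Y) = measure M X * measure (\<mu> y) Y"
        using disj[OF y] L(1) sub[OF XY(1)] sub[OF XY(2)] ED(6)[OF y]
        unfolding disjoint_systems_iff[OF pM ED(9)[OF y]] by simp
      then have "q a b = measure M (A a) * f y b"
        using L(2)[OF XY] XY by (simp add: a_def b_def f_def Aix)
      then have "\<epsilon> * measure Mbar F \<le> 0" using qgap by simp
      then show False using \<epsilon> \<phi> by (simp add: mult_le_0_iff)
    qed
    then show ?thesis unfolding vimF by (simp add: Mbar.emeasure_eq_measure measure_le_0_iff)
  qed
  have Enull: "E (ix X) (ix Y) \<epsilon> \<in> null_sets ?BB" if "X \<in> \<A>" "Y \<in> \<A>" "\<epsilon> > 0" for X Y \<epsilon>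
  proof -
    have "emeasure ?BB (E (ix X) (ix Y) \<epsilon>) = (\<integral>\<^sup>+y. emeasure Mbar ((\<lambda>x. (x, y)) -` E (ix X) (ix Y) \<epsilon>) \<partial>Mbar)"
      by (rule BB.emeasure_pair_measure_alt2[OF Em])
    also have "\<dots> = (\<integral>\<^sup>+y. 0 \<partial>Mbar)" by (rule nn_integral_cong) (rule slice[OF _ that])
    finally show ?thesis using Em by (simp add: null_sets_def)
  qed

  \<comment> \<open>Non-disjoint pairs lie in the cover\<close>
  define D where "D = disjoint_pairs T Mbar \<mu>"
  define NN where "NN = (\<Union>X\<in>\<A>. \<Union>Y\<in>\<A>. \<Union>m. E (ix X) (ix Y) (1 / real (Suc m)))"
  have NN: "NN \<in> null_sets ?BB"
    unfolding NN_def by (intro null_sets_UN' \<A>(1) countableI_type Enull) auto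
  have cover: "z \<in> NN" if z: "z \<in> space ?BB" "z \<notin> D" for z
  proof -
    obtain x y where xy: "z = (x, y)" "x \<in> space Mbar" "y \<in> space Mbar" using z(1) by (auto simp: space_pair_measure)
    have "\<not> disjoint_systems (\<mu> x) T (\<mu> y) T" using z(2) xy unfolding D_def disjoint_pairs_def by auto
    then obtain L where L: "L \<in> joinings (\<mu> x) T (\<mu> y) T" "L \<noteq> \<mu> x \<Otimes>\<^sub>M \<mu> y"
      unfolding disjoint_systems_def using product_joining[OF ED(9)[OF xy(2)] ED(9)[OF xy(3)]] by auto
    note JD = joiningsD[OF L(1)]
    interpret X: prob_space "\<mu> x" by (rule ED(8)[OF xy(2)])
    interpret Y: prob_space "\<mu> y" by (rule ED(8)[OF xy(3)])
    interpret XY: pair_prob_space "\<mu> x" "\<mu> y" ..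
    interpret L: prob_space L by (rule JD(2))
    have "\<exists>X\<in>\<A>. \<exists>Y\<in>\<A>. measure L (X \<times> Y) \<noteq> measure (\<mu> x \<Otimes>\<^sub>M \<mu> y) (X \<times> Y)"
    proof (rule ccontr)
      assume *: "\<not> ?thesis"
      have "L = \<mu> x \<Otimes>\<^sub>M \<mu> y"
      proof (rule pair_measure_eqI_algebras[of "\<mu> x" \<A> "\<mu> y" \<A>])
        show "algebra (space (\<mu> x)) \<A>" "algebra (space (\<mu> y)) \<A>" using \<A>(2) ED(7) xy by simp_all
        show "sets (\<mu> x) = sigma_sets (space (\<mu> x)) \<A>" "sets (\<mu> y) = sigma_sets (space (\<mu> y)) \<A>"
          using \<A>(3) ED(6,7) xy by simp_all
      qed (use * JD(1) L.finite_measure_axioms XY.P.finite_measure_axioms in auto)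
      then show False using L(2) by simp
    qed
    then obtain X Y where XY: "X \<in> \<A>" "Y \<in> \<A>" "measure L (X \<times> Y) \<noteq> measure (\<mu> x \<Otimes>\<^sub>M \<mu> y) (X \<times> Y)" by blast
    have pr: "measure (\<mu> x \<Otimes>\<^sub>M \<mu> y) (B \<times> C) = measure (\<mu> x) B * measure (\<mu> y) C" if "B \<in> \<A>" "C \<in> \<A>" for B C
      using prod[OF xy(2,3), of "ix B" "ix C"] that by (simp add: f_def Aix)
    \<comment> \<open>If the joining falls short of the product on \<open>X \<times> Y\<close>, it
      exceeds it on the complement of \<open>X\<close> times \<open>Y\<close>, because both measures
      have the same second marginal.\<close>
    have "\<exists>X\<in>\<A>. measure L (X \<times> Y) > measure (\<mu> x) X * measure (\<mu> y) Y"
    proof (cases "measure L (X \<times> Y) > measure (\<mu> x) X * measure (\<mu> y) Y")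
      case True
      then show ?thesis using XY by blast
    next
      case False
      then have less: "measure L (X \<times> Y) < measure (\<mu> x) X * measure (\<mu> y) Y" using XY pr by simp
      have XS: "X \<in> sets (\<mu> x)" "Y \<in> sets (\<mu> y)" using sub XY ED(6) xy by auto
      have "measure L ((space M - X) \<times> Y) = measure L (space M \<times> Y) - measure L (X \<times> Y)"
      proof -
        have "(space M - X) \<times> Y = (space M \<times> Y) - (X \<times> Y)" by auto
        moreover have "X \<subseteq> space M" using sub[OF XY(1)] sets.sets_into_space by blast
        moreover have "space M \<times> Y \<in> sets L" "X \<times> Y \<in> sets L"
          using XS sets.top[of "\<mu> x"] ED(7)[OF xy(2)] by (auto simp: JD(1) intro!: pair_measureI)
        ultimately show ?thesis by (simp add: L.finite_measure_Diff Sigma_mono)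
      qed
      also have "measure L (space M \<times> Y) = measure (\<mu> y) Y" using JD(5)[OF XS(2)] ED(7)[OF xy(2)] by simp
      finally have "measure L ((space M - X) \<times> Y) > measure (\<mu> y) Y - measure (\<mu> x) X * measure (\<mu> y) Y" using less by simp
      moreover have "measure (\<mu> x) (space M - X) = 1 - measure (\<mu> x) X"
        using X.prob_compl[OF XS(1)] ED(7)[OF xy(2)] by simp
      ultimately have "measure L ((space M - X) \<times> Y) > measure (\<mu> x) (space M - X) * measure (\<mu> y) Y"
        by (simp add: left_diff_distrib)
      then show ?thesis using \<A>.compl_sets[OF XY(1)] by blast
    qed
    then obtain X where X: "X \<in> \<A>" "measure L (X \<times> Y) > measure (\<mu> x) X * measure (\<mu> y) Y" by blast
    then obtain m where m: "1 / real (Suc m) < measure L (X \<times> Y) - measure (\<mu> x) X * measure (\<mu> y) Y"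
      using nat_approx_posE[of "measure L (X \<times> Y) - measure (\<mu> x) X * measure (\<mu> y) Y"] by auto
    have "\<exists>p\<in>grid k. ok (ix X) (ix Y) (1 / real (Suc m)) k p x y" for k
    proof -
      obtain p where p: "p \<in> grid k" "\<And>i j. i < k \<Longrightarrow> j < k \<Longrightarrow> \<bar>p i j - measure L (A i \<times> A j)\<bar> \<le> 1 / real (3 * k)"
        using grid_close[of "\<lambda>i j. measure L (A i \<times> A j)" k] by auto
      have "approx_joining A ?tr (space M) (3 * (1 / real (3 * k))) k p (f x) (f y)"
        by (rule approx_joining_perturb[OF exact[OF xy(2,3) L(1)] p(2)]) simp_all
      then have "approx_joining A ?tr (space M) (1 / real k) k p (f x) (f y)" by simp
      moreover have "f x (ix X) * f y (ix Y) + 1 / real (Suc m) - 1 / real k \<le> p (ix X) (ix Y)" if "ix X < k" "ix Y < k"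
      proof -
        have "1 / real (3 * k) \<le> 1 / real k" using that by (simp add: field_simps)
        moreover have "\<bar>p (ix X) (ix Y) - measure L (X \<times> Y)\<bar> \<le> 1 / real (3 * k)"
          using p(2)[OF that] XY X by (simp add: Aix)
        ultimately show ?thesis using m XY X by (simp add: f_def Aix abs_le_iff)
      qed
      ultimately show ?thesis using p(1) unfolding ok_def by blast
    qed
    then have "z \<in> E (ix X) (ix Y) (1 / real (Suc m))" using z(1) xy unfolding E_def by simp
    then show "z \<in> NN" unfolding NN_def using X XY by blast
  qed
  have Dsub: "D \<subseteq> space ?BB" unfolding D_def disjoint_pairs_def by (auto simp: space_pair_measure)
  interpret CB: prob_space "completion ?BB" by (rule BB.prob_space_completion)
  \<comment> \<open>\<open>D\<close> is the union of a Borel set and a subset of a Borel null set,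
    which makes it measurable for the completion.\<close>
  have "D = (space ?BB - NN) \<union> (D \<inter> NN)" using Dsub cover by auto
  then have DS: "D \<in> sets (completion ?BB)"
    by (rule sets_completionI[OF _ _ NN]) (use NN in auto)
  have "AE z in ?BB. z \<in> D"
    using AE_not_in[OF NN] AE_space by eventually_elim (use cover in blast)
  then have "AE z in completion ?BB. z \<in> D" by (rule AE_completion)
  then have "CB.prob D = 1" using DS by (subst CB.AE_in_set_eq_1[symmetric]) auto
  then show ?thesis unfolding D_def[symmetric] by (simp add: CB.emeasure_eq_measure del: emeasure_completion)
qed

theorem theorem2p2:
  fixes M :: "'a measure" and T :: "'a \<Rightarrow> 'a"
    and Mbar :: "'b measure" and \<pi> :: "'a \<Rightarrow> 'b" and \<mu> :: "'b \<Rightarrow> 'a measure"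
  assumes "standard_prob_space M"
    and "invertible_pmp_system M T"
    and "ergodic_decomposition M T Mbar \<pi> \<mu>"
  shows "((\<forall>S \<in> MPT. ergodic_system unit_interval_measure S \<longrightarrow>
             disjoint_systems M T unit_interval_measure S) \<longrightarrow>
           emeasure (completion (Mbar \<Otimes>\<^sub>M Mbar)) (disjoint_pairs T Mbar \<mu>) = 1)
       \<and> ((\<nexists>A. measure_atom Mbar A) \<longrightarrow>
           emeasure (completion (Mbar \<Otimes>\<^sub>M Mbar)) (disjoint_pairs T Mbar \<mu>) = 1 \<longrightarrow>
           (\<forall>(N :: 'c measure) S. standard_prob_space N \<longrightarrow> ergodic_system N S \<longrightarrow>
              disjoint_systems M T N S))"
proof -
  have pM: "pmp_system M T" using assms(2) unfolding invertible_pmp_system_def by simp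
  note ED = ergodic_decompositionD[OF pM assms(3)]
  have "emeasure (completion (Mbar \<Otimes>\<^sub>M Mbar)) (disjoint_pairs T Mbar \<mu>) = 1"
    if disj: "\<And>S. S \<in> MPT \<Longrightarrow> ergodic_system unit_interval_measure S \<Longrightarrow> disjoint_systems M T unit_interval_measure S"
  proof (rule almost_all_pairs_disjoint[OF assms(1) pM assms(3)])
    fix x assume x: "x \<in> space Mbar"
    obtain R where R: "R \<in> measurable M M" "\<And>y. y \<in> space M \<Longrightarrow> R (T y) = y" "\<And>y. y \<in> space M \<Longrightarrow> T (R y) = y"
      using assms(2) unfolding invertible_pmp_system_def by blast
    \<comment> \<open>A retract depends only on the space and its \<sigma>-algebra, which every
      component shares with \<open>M\<close>.\<close>
    have "measurable_retract (\<mu> x) cantor_space"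
      using standard_prob_space_retract[OF assms(1)]
      unfolding measurable_retract_def measurable_cong_sets[OF ED(6)[OF x] refl]
        measurable_cong_sets[OF refl ED(6)[OF x]] ED(7)[OF x] .
    then show "disjoint_systems M T (\<mu> x) T"
      using R by (intro disjoint_from_standard_ergodic[OF pM disj ED(10)[OF x], of R])
        (simp_all add: measurable_cong_sets[OF ED(6)[OF x] ED(6)[OF x]] ED(7)[OF x])
  qed
  then show ?thesis using disjoint_from_ergodic[OF assms(1) pM assms(3)] by blast
qed

end
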